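(* Let $f,g\in\mathbb{R}[x,y]$ be nonzero polynomials with $f(0,0)=g(0,0)=0$, and let $$G_{f,g}:=y\left(g\frac{\partial f}{\partial x}-f\frac{\partial g}{\partial x}\right)-x\left(g\frac{\partial f}{\partial y}-f\frac{\partial g}{\partial y}\right).$$ Assume that $f$, $g$ and $G_{f,g}$ are $y$-regular. For a sign $*\in\{+,-\}$ write $f^{*}(x,y):=f( *x,y)$ and $g^{*}(x,y):=g( *x,y)$. Then $\displaystyle\lim_{(x,y)\to(0,0)}\frac{f(x,y)}{g(x,y)}=0$ if and only if the following conditions hold: (i) $\operatorname{ord} f>\operatorname{ord} g$. (ii) For $*\in\{+,-\}$ and for any $\gamma\in\mathbf{P}^{*}(G_{f,g})\setminus\big(\mathbf{P}^{*}(f)\cup\mathbf{P}^{*}(g)\big)$, we have $$\operatorname{ord} f( *x,\gamma(x))>\operatorname{ord} g( *x,\gamma(x)).$$ (iii) For $*\in\{+,-\}$ and for any $\gamma\in\mathbf{P}^{*}(g)$, we have $\gamma\in\mathbf{P}^{*}(f)$ and either $\operatorname{mult}_{f^{*}}(\gamma)>\operatorname{mult}_{g^{*}}(\gamma)$, or $\operatorname{mult}_{f^{*}}(\gamma)=\operatorname{mult}_{g^{*}}(\gamma)$ and $$\sum_{\varphi\in\mathbf{P}(f^{*})\setminus\{\gamma\}}\operatorname{mult}_{f^{*}}(\varphi)\,\operatorname{ord}(\gamma-\varphi)>\sum_{\psi\in\mathbf{P}(g^{*})\setminus\{\gamma\}}\operatorname{mult}_{g^{*}}(\psi)\,\ope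ratorname{ord}(\gamma-\psi).$$
   Context: Order and $y$-regularity: for a nonzero polynomial $h=h_m+h_{m+1}+\cdots$ (homogeneous components, $h_m\not\equiv0$ of lowest degree $m$), $\operatorname{ord} h:=m$; $h$ is $y$-regular (of order $m$) if $h_m(0,1)\neq0$. Puiseux series: a Puiseux series is either $\varphi\equiv 0$ or $\varphi(x)=c_1x^{n_1/n}+c_2x^{n_2/n}+\cdots$ with $c_k\in\mathbb{C}$ and positive integers $n\le n_1<n_2<\cdots$ having no common divisor, such that the power series $\varphi(t^n)$ has positive radius of convergence. It is real if all $c_k$ are real. The order $\operatorname{ord}$ of a series in fractional powers of $x$ is its smallest exponent with nonzero coefficient, and $+\infty$ for the zero series. $\varphi$ is a Newton–Puiseux root of $h$ if $h(x,\varphi(x))\equiv0$; $\mathbf{P}(h)$ is the set of Newton–Puiseux roots of $h$. If $h$ is $y$-regular, then $h=u(x,y)\prod_{\varphi\in\mathbf{P}(h)}(y-\varphi(x))^{\operatorname{mult}_h(\varphi)}$ with $u\in\mathbb{C}\{x,y\}$ (convergent power series), $u(0,0)\ne0$; $\operatorname{mult}_h(\varphi)$ is the multiplicity of $\varphi$. For $h\in\mathbb{R}[x,y]$, $\mathbf{P}^{+}(h):=\{\varphi\in\mathbf{P}(h):\varphi\text{ is real}\}$ and $\mathbf{P}^{-}(h):=\mathbf{P}^{+}(h(-x,y))$. The notation $*x$ means $x$ if $*=+$ and $-x$ if $*=-$. The limit is taken over points of $\mathbb{R}^2$ where $g\ne0$. *)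

theory Defs
  imports "HOL-Analysis.Analysis" "HOL-Computational_Algebra.Computational_Algebra"
begin

text \<open>
  An element \<open>h\<close> of \<open>\<real>[x,y] = \<real>[x][y]\<close> is a \<^typ>\<open>real poly poly\<close>: the outer variable is \<open>y\<close>, the inner
  one \<open>x\<close>, so that \<open>coeff (coeff h j) i\<close> is the coefficient of \<open>x\<^sup>i y\<^sup>j\<close>.
\<close>

definition peval :: "real poly poly \<Rightarrow> real \<Rightarrow> real \<Rightarrow> real" where
  "peval h x y = poly (poly h [:y:]) x"

definition xvar :: "real poly poly" where "xvar = [:[:0, 1:]:]"

definition yvar :: "real poly poly" where "yvar = [:0, 1:]"

definition dx :: "real poly poly \<Rightarrow> real poly poly" where
  "dx h = map_poly pderiv h"

definition dy :: "real poly poly \<Rightarrow> real poly poly" where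
  "dy h = pderiv h"

definition hom_comp :: "nat \<Rightarrow> real poly poly \<Rightarrow> real poly poly" where
  "hom_comp m h = (\<Sum>i\<le>m. monom (monom (coeff (coeff h (m - i)) i) i) (m - i))"

definition ord_poly :: "real poly poly \<Rightarrow> nat" where
  "ord_poly h = (LEAST m. hom_comp m h \<noteq> 0)"

definition y_regular :: "real poly poly \<Rightarrow> bool" where
  "y_regular h \<longleftrightarrow> h \<noteq> 0 \<and> peval (hom_comp (ord_poly h) h) 0 1 \<noteq> 0"

definition G_poly :: "real poly poly \<Rightarrow> real poly poly \<Rightarrow> real poly poly" where
  "G_poly f g = yvar * (g * dx f - f * dx g) - xvar * (g * dy f - f * dy g)"

text \<open>The polynomial \<open>h(s x, y)\<close>. A sign is encoded as \<open>s = 1\<close> or \<open>s = -1\<close>, so that the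
  polynomial written with a sign superscript is \<open>xscale s h\<close>.\<close>

definition xscale :: "real \<Rightarrow> real poly poly \<Rightarrow> real poly poly" where
  "xscale s h = map_poly (\<lambda>c. pcompose c [:0, s:]) h"

text \<open>
  A series in fractional powers of \<open>x\<close> is represented by its coefficient function: \<open>\<phi> q\<close> is the
  coefficient of \<open>x\<close> to the power \<open>q\<close>. Only functions whose exponents have a common denominator
  are meaningful. The least positive common denominator is the \<open>n\<close> for which \<open>n\<close> and the numerators
  \<open>n\<^sub>1, n\<^sub>2, \<dots>\<close> have no common divisor; it is 1 for the zero series.
\<close>

type_synonym frac_series = "rat \<Rightarrow> complex"

definition has_denom :: "nat \<Rightarrow> frac_series \<Rightarrow> bool" where
  "has_denom n \<phi> \<longleftrightarrow> n > 0 \<and> (\<forall>q. \<phi> q \<noteq> 0 \<longrightarrow> q * of_nat n \<in> \<int>)"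

definition denom :: "frac_series \<Rightarrow> nat" where
  "denom \<phi> = (LEAST n. has_denom n \<phi>)"

text \<open>The power series \<open>\<phi>(t\<^sup>n)\<close>, for \<open>n\<close> a common denominator and \<open>\<phi>\<close> without negative exponents.\<close>

definition ramify :: "nat \<Rightarrow> frac_series \<Rightarrow> complex fps" where
  "ramify n \<phi> = Abs_fps (\<lambda>k. \<phi> (of_nat k / of_nat n))"

text \<open>Inverse to the above: \<open>F(t)\<close> with \<open>t\<close> the \<open>n\<close>-th root of \<open>x\<close>.\<close>

definition unramify :: "nat \<Rightarrow> complex fps \<Rightarrow> frac_series" where
  "unramify n F = (\<lambda>q. if q \<ge> 0 \<and> q * of_nat n \<in> \<int> then fps_nth F (nat \<lfloor>q * of_nat n\<rfloor>) else 0)"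

definition puiseux :: "frac_series \<Rightarrow> bool" where
  "puiseux \<phi> \<longleftrightarrow> (\<exists>n. has_denom n \<phi>) \<and> (\<forall>q. \<phi> q \<noteq> 0 \<longrightarrow> q \<ge> 1) \<and>
     fps_conv_radius (ramify (denom \<phi>) \<phi>) > 0"

definition real_series :: "frac_series \<Rightarrow> bool" where
  "real_series \<phi> \<longleftrightarrow> (\<forall>q. \<phi> q \<in> \<real>)"

definition ord_series :: "frac_series \<Rightarrow> ereal" where
  "ord_series \<phi> = (if \<forall>q. \<phi> q = 0 then \<infinity> else ereal (real_of_rat (LEAST q. \<phi> q \<noteq> 0)))"

definition series_diff :: "frac_series \<Rightarrow> frac_series \<Rightarrow> frac_series" where
  "series_diff \<phi> \<psi> = (\<lambda>q. \<phi> q - \<psi> q)"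

text \<open>The polynomial \<open>h(t\<^sup>n, y)\<close> in \<open>y\<close>, with coefficients in \<open>\<complex>[[t]]\<close>.\<close>

definition ramify_poly :: "nat \<Rightarrow> real poly poly \<Rightarrow> complex fps poly" where
  "ramify_poly n h =
     map_poly (\<lambda>c. fps_of_poly (pcompose (map_poly complex_of_real c) (monom 1 n))) h"

text \<open>The series \<open>h(x, \<phi>(x))\<close>, obtained from \<open>h(t\<^sup>n, \<phi>(t\<^sup>n))\<close>.\<close>

definition subst :: "real poly poly \<Rightarrow> frac_series \<Rightarrow> frac_series" where
  "subst h \<phi> = unramify (denom \<phi>) (poly (ramify_poly (denom \<phi>) h) (ramify (denom \<phi>) \<phi>))"

definition NP_roots :: "real poly poly \<Rightarrow> frac_series set" where
  "NP_roots h = {\<phi>. puiseux \<phi> \<and> (\<forall>q. subst h \<phi> q = 0)}"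

definition NP_real_roots :: "real \<Rightarrow> real poly poly \<Rightarrow> frac_series set" where
  "NP_real_roots s h = {\<phi> \<in> NP_roots (xscale s h). real_series \<phi>}"

text \<open>
  The library's root multiplicity \<open>order\<close> over \<open>\<complex>[[t]]\<close>: the largest \<open>k\<close> such that
  \<open>(y - \<phi>(t\<^sup>n))\<^sup>k\<close> divides \<open>h(t\<^sup>n, y)\<close>. For \<open>y\<close>-regular \<open>h\<close> and \<open>\<phi> \<in> NP_roots h\<close> it is the exponent of
  \<open>y - \<phi>(x)\<close> in the factorization of \<open>h\<close> as a unit of \<open>\<complex>{x,y}\<close> times powers of the
  \<open>y - \<psi>(x)\<close>, \<open>\<psi> \<in> NP_roots h\<close>.
\<close>

definition NP_mult :: "real poly poly \<Rightarrow> frac_series \<Rightarrow> nat" where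
  "NP_mult h \<phi> = order (ramify (denom \<phi>) \<phi>) (ramify_poly (denom \<phi>) h)"

end

theory Submission
  imports Defs
begin

unbundle no vec_syntax

text \<open>
  The angular derivative of \<open>f / g\<close> is \<open>- G / g\<^sup>2\<close> with \<open>G = G_poly f g\<close>. Hence on a small circle
  \<open>\<bar>f / g\<bar>\<close> is as large as it gets either at a zero of \<open>G\<close> or near a zero of \<open>g\<close>, and by the
  Newton--Puiseux theorem these zeros lie on the real half-branches \<open>y = \<gamma>(\<bar>x\<bar>)\<close> of \<open>G\<close> and \<open>g\<close>.
  Near such a half-branch write \<open>f = (y - \<gamma>)\<^sup>a f\<^sub>1\<close> and \<open>g = (y - \<gamma>)\<^sup>b g\<^sub>1\<close> with \<open>f\<^sub>1\<close>, \<open>g\<^sub>1\<close> nonzero along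
  \<open>\<gamma>\<close>: there \<open>f / g\<close> is small iff \<open>a > b\<close>, or \<open>a = b\<close> and \<open>ord f\<^sub>1(x, \<gamma>) > ord g\<^sub>1(x, \<gamma>)\<close>. The factorization
  of \<open>f\<close> and \<open>g\<close> over all their Newton--Puiseux roots turns the last two orders into the sums of the
  theorem. Newton--Puiseux roots are produced together with their convergence: a simple root is the
  fixed point of \<open>\<psi> = b + t R(\<psi>)\<close>, and a root of multiplicity \<open>m\<close> is reduced to smaller multiplicity
  by shifting along the simple root of the \<open>(m - 1)\<close>st derivative and one Newton polygon step.
\<close>

section \<open>Convergent power series\<close>

text \<open>Convergence is carried through every construction because the formal roots have to be
  evaluated: the zeros of \<open>G\<close> and \<open>g\<close> must be actual points
  \<open>(x, \<gamma>(x))\<close>. Two obstacles shape the rest. First, \<open>f / g\<close> is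
  undefined at the zeros of \<open>g\<close>, so the maximum on a circle exists only if the points
  with \<open>\<bar>f / g\<bar> \<ge> \<epsilon>\<close> cannot accumulate there; hence
  \<open>f / g\<close> has to be small on a full neighbourhood of each point of a half-branch of
  \<open>g\<close>, not only along it. Second, every root has its own denominator. Two denominators
  are compared over their product, where multiplicities are unchanged and subdegrees scale by a
  known factor, so that subdegree divided by denominator is intrinsic. Half-branches describe x > 0
  only: the side x < 0 is reached by the reflection \<open>xscale (- 1)\<close>, and on the axis x =
  0 y-regularity leaves no zeros of \<open>g\<close> or \<open>G\<close> near the origin except the
  origin.\<close>

definition conv :: "complex fps \<Rightarrow> bool" where
  "conv F \<longleftrightarrow> fps_conv_radius F > 0"

definition conv_poly :: "complex fps poly \<Rightarrow> bool" where
  "conv_poly P \<longleftrightarrow> (\<forall>i. conv (coeff P i))"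

lemma conv_0 [simp]: "conv 0" and conv_1 [simp]: "conv 1" and conv_const [simp]: "conv (fps_const c)"
  and conv_X_power [simp]: "conv (fps_X ^ n)" and conv_X [simp]: "conv fps_X"
  and conv_shift [simp]: "conv (fps_shift n F) \<longleftrightarrow> conv F"
  and conv_uminus [simp]: "conv (- F) \<longleftrightarrow> conv F"
  and conv_fps_of_poly [simp]: "conv (fps_of_poly p)"
  by (simp_all add: conv_def)

lemma conv_add: "conv F \<Longrightarrow> conv G \<Longrightarrow> conv (F + G)"
  unfolding conv_def using fps_conv_radius_add[of F G] by (metis min_less_iff_conj order_less_le_trans)

lemma conv_mult: "conv F \<Longrightarrow> conv G \<Longrightarrow> conv (F * G)"
  unfolding conv_def using fps_conv_radius_mult[of F G] by (metis min_less_iff_conj order_less_le_trans)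

lemma conv_sum: "(\<And>i. i \<in> A \<Longrightarrow> conv (F i)) \<Longrightarrow> conv (sum F A)"
  by (induction A rule: infinite_finite_induct) (auto intro: conv_add)

lemma conv_inverse: "conv F \<Longrightarrow> F $ 0 \<noteq> 0 \<Longrightarrow> conv (inverse F)"
  unfolding conv_def by (rule fps_conv_radius_inverse_pos)

text \<open>Comparison with a geometric series at half the radius. Together with
  \<open>conv_boundedD\<close> it turns convergence into a growth bound on coefficients, the form in
  which fixed points, ramified and conjugate series are checked.\<close>

lemma conv_bounded:
  assumes "r > 0" and "\<And>n. norm (F $ n) * r ^ n \<le> M"
  shows "conv F"
proof -
  have "summable (\<lambda>n. F $ n * of_real (r / 2) ^ n)"
  proof (rule summable_comparison_test')
    show "summable (\<lambda>n. M * (1 / 2) ^ n)" by (intro summable_mult summable_geometric) auto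
    show "norm (F $ n * of_real (r / 2) ^ n) \<le> M * (1 / 2) ^ n" if "n \<ge> 0" for n
      using assms(2)[of n] assms(1)
      by (simp add: norm_mult norm_divide norm_power power_divide divide_right_mono)
  qed
  from conv_radius_geI[OF this] have "fps_conv_radius F \<ge> ereal (r / 2)"
    using assms(1) by (simp add: fps_conv_radius_def)
  then show ?thesis unfolding conv_def using assms(1)
    by (metis ereal_less(2) half_gt_zero order_less_le_trans)
qed

lemma conv_summable:
  assumes "conv F"
  obtains r where "r > 0" "summable (\<lambda>n. norm (F $ n) * r ^ n)"
proof -
  from assms obtain r where r: "0 < ereal r" "ereal r < fps_conv_radius F"
    unfolding conv_def using ereal_dense2 by blast
  then have "summable (\<lambda>n. norm (F $ n * of_real r ^ n))"
    unfolding fps_conv_radius_def by (intro abs_summable_in_conv_radius) auto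
  then show ?thesis using that[of r] r by (simp add: norm_mult norm_power)
qed

lemma conv_poly_0 [simp]: "conv_poly 0"
  by (simp add: conv_poly_def)

lemma conv_poly_pCons [simp]: "conv_poly (pCons a P) \<longleftrightarrow> conv a \<and> conv_poly P"
  by (auto simp: conv_poly_def coeff_pCons split: nat.splits)

lemma conv_poly_1 [simp]: "conv_poly 1"
  by (simp add: one_pCons)

lemma conv_poly_add: "conv_poly P \<Longrightarrow> conv_poly Q \<Longrightarrow> conv_poly (P + Q)"
  by (simp add: conv_poly_def conv_add)

lemma conv_poly_smult: "conv a \<Longrightarrow> conv_poly P \<Longrightarrow> conv_poly (smult a P)"
  by (simp add: conv_poly_def conv_mult)

lemma conv_poly_mult: "conv_poly P \<Longrightarrow> conv_poly Q \<Longrightarrow> conv_poly (P * Q)"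
  by (simp add: conv_poly_def coeff_mult conv_sum conv_mult)

lemma conv_poly_power: "conv_poly P \<Longrightarrow> conv_poly (P ^ n)"
  by (induction n) (auto intro: conv_poly_mult)

lemma conv_poly_poly: "conv_poly P \<Longrightarrow> conv a \<Longrightarrow> conv (poly P a)"
  by (induction P) (auto intro: conv_add conv_mult)

lemma conv_poly_pcompose: "conv_poly P \<Longrightarrow> conv_poly Q \<Longrightarrow> conv_poly (pcompose P Q)"
  by (induction P) (auto simp: pcompose_pCons intro!: conv_poly_add conv_poly_mult)

lemma conv_poly_synthetic_div: "conv_poly P \<Longrightarrow> conv a \<Longrightarrow> conv_poly (synthetic_div P a)"
  by (induction P) (auto intro: conv_poly_poly)

text \<open>Division by a monic linear factor is Horner's scheme, which only adds and multiplies, so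
  the quotient stays convergent.\<close>

lemma conv_poly_linear_cancel:
  assumes "conv_poly ([:- a, 1:] * Q)" "conv a"
  shows "conv_poly Q"
proof -
  have "[:- a, 1:] * Q + smult a Q = pCons 0 Q" by simp
  then have "Q = synthetic_div ([:- a, 1:] * Q) a" using synthetic_div_unique by blast
  with conv_poly_synthetic_div[OF assms] show ?thesis by simp
qed

lemma conv_poly_linear_power_cancel:
  "conv_poly ([:- a, 1:] ^ n * Q) \<Longrightarrow> conv a \<Longrightarrow> conv_poly Q"
proof (induction n)
  case (Suc n)
  then show ?case using conv_poly_linear_cancel[of a "[:- a, 1:] ^ n * Q"]
    by (simp only: power_Suc mult.assoc)
qed simp

text \<open>The truncated weighted \<open>\<ell>\<^sup>1\<close> norm is submultiplicative; this replaces majorant series.\<close>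

definition tnorm :: "real \<Rightarrow> nat \<Rightarrow> complex fps \<Rightarrow> real" where
  "tnorm r k F = (\<Sum>i<k. norm (F $ i) * r ^ i)"

lemma tnorm_nonneg: "r \<ge> 0 \<Longrightarrow> tnorm r k F \<ge> 0"
  by (simp add: tnorm_def sum_nonneg)

lemma tnorm_0 [simp]: "tnorm r k 0 = 0"
  by (simp add: tnorm_def)

lemma tnorm_add: "r \<ge> 0 \<Longrightarrow> tnorm r k (F + G) \<le> tnorm r k F + tnorm r k G"
  unfolding tnorm_def sum.distrib[symmetric]
  by (intro sum_mono) (simp add: distrib_right[symmetric] mult_right_mono norm_triangle_ineq)

lemma tnorm_mult:
  assumes r: "r \<ge> 0"
  shows "tnorm r k (F * G) \<le> tnorm r k F * tnorm r k G"
proof -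
  let ?a = "\<lambda>i. norm (F $ i) * r ^ i" and ?b = "\<lambda>i. norm (G $ i) * r ^ i"
  have "tnorm r k (F * G) \<le> (\<Sum>n<k. \<Sum>i\<le>n. ?a i * ?b (n - i))"
    unfolding tnorm_def
  proof (rule sum_mono)
    fix n
    have "norm ((F * G) $ n) * r ^ n \<le> (\<Sum>i\<le>n. norm (F $ i * G $ (n - i))) * r ^ n"
      using r by (intro mult_right_mono) (auto simp: fps_mult_nth atLeast0AtMost norm_sum)
    also have "\<dots> = (\<Sum>i\<le>n. ?a i * ?b (n - i))"
      unfolding sum_distrib_right
      by (intro sum.cong) (auto simp: norm_mult power_add[symmetric])
    finally show "norm ((F * G) $ n) * r ^ n \<le> (\<Sum>i\<le>n. ?a i * ?b (n - i))" .
  qed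
  \<comment> \<open>The truncated product sees only the triangle of pairs with total index below k;
    the full square bounds it because all terms are nonnegative.\<close>
  also have "\<dots> = (\<Sum>(i,j) \<in> {(i,j). i + j < k}. ?a i * ?b j)"
    by (rule sum.triangle_reindex[symmetric])
  also have "\<dots> \<le> (\<Sum>(i,j) \<in> {..<k} \<times> {..<k}. ?a i * ?b j)"
    by (rule sum_mono2) (auto simp: r)
  also have "\<dots> = tnorm r k F * tnorm r k G"
    by (simp add: tnorm_def sum_product sum.cartesian_product)
  finally show ?thesis .
qed

text \<open>The factor \<open>fps_X\<close> lowers the number of visible coefficients by one; this
  gain drives the induction in \<open>fixpoint\<close>.\<close>

lemma tnorm_X_mult: "tnorm r (Suc k) (fps_X * F) = r * tnorm r k F"
  unfolding tnorm_def by (subst sum.lessThan_Suc_shift) (simp add: sum_distrib_left mult_ac)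

text \<open>One bound for all truncations and all smaller radii: the radius is shrunk afterwards,
  when the other constants are known.\<close>

lemma conv_tnorm_bounded:
  assumes "conv F"
  obtains r M where "r > 0" "\<And>\<rho> k. 0 \<le> \<rho> \<Longrightarrow> \<rho> \<le> r \<Longrightarrow> tnorm \<rho> k F \<le> M"
proof -
  from conv_summable[OF assms] obtain r where r: "r > 0" "summable (\<lambda>n. norm (F $ n) * r ^ n)" .
  have "tnorm \<rho> k F \<le> (\<Sum>n. norm (F $ n) * r ^ n)" if "0 \<le> \<rho>" "\<rho> \<le> r" for \<rho> k
  proof -
    have "tnorm \<rho> k F \<le> (\<Sum>i<k. norm (F $ i) * r ^ i)"
      unfolding tnorm_def using that by (intro sum_mono mult_left_mono power_mono) auto
    also have "\<dots> \<le> (\<Sum>n. norm (F $ n) * r ^ n)"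
      using r by (intro sum_le_suminf) auto
    finally show ?thesis .
  qed
  with r(1) show ?thesis using that by blast
qed

text \<open>\<open>r\<close> and \<open>M\<close> depend on \<open>P\<close> and \<open>B\<close>
  alone, so the bound applies to a series of which only the truncated norm is under control.\<close>

lemma tnorm_poly_bounded:
  assumes "conv_poly P"
  shows "\<exists>r>0. \<exists>M. \<forall>\<rho> k a. 0 \<le> \<rho> \<longrightarrow> \<rho> \<le> r \<longrightarrow> tnorm \<rho> k a \<le> B \<longrightarrow> tnorm \<rho> k (poly P a) \<le> M"
  using assms
proof (induction P)
  case 0
  then show ?case by (intro exI[of _ 1] conjI exI[of _ 0]) auto
next
  case (pCons c P)
  then have "conv_poly P" by simp
  from pCons.IH[OF this] obtain r M where r: "r > 0"
    "\<And>\<rho> k a. 0 \<le> \<rho> \<Longrightarrow> \<rho> \<le> r \<Longrightarrow> tnorm \<rho> k a \<le> B \<Longrightarrow> tnorm \<rho> k (poly P a) \<le> M" by blast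
  from pCons have "conv c" by simp
  then obtain r' M' where r': "r' > 0" "\<And>\<rho> k. 0 \<le> \<rho> \<Longrightarrow> \<rho> \<le> r' \<Longrightarrow> tnorm \<rho> k c \<le> M'"
    using conv_tnorm_bounded by blast
  have "tnorm \<rho> k (poly (pCons c P) a) \<le> M' + B * M"
    if \<rho>: "0 \<le> \<rho>" "\<rho> \<le> min r r'" "tnorm \<rho> k a \<le> B" for \<rho> k a
  proof -
    have "tnorm \<rho> k (poly (pCons c P) a) \<le> tnorm \<rho> k c + tnorm \<rho> k a * tnorm \<rho> k (poly P a)"
      using tnorm_add[OF \<rho>(1), of k c "a * poly P a"] tnorm_mult[OF \<rho>(1), of k a "poly P a"] by simp
    also have "\<dots> \<le> M' + B * M"
      using \<rho> r r' tnorm_nonneg[OF \<rho>(1), of k a]  tnorm_nonneg[OF \<rho>(1), of k "poly P a"]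
      by (intro add_mono mult_mono) auto
    finally show ?thesis .
  qed
  with r(1) r'(1) show ?case by (intro exI[of _ "min r r'"] conjI exI[of _ "M' + B * M"]) auto
qed

lemma dvd_poly_diff: "(a - b) dvd (poly P a - poly P b)" for a :: "'a :: comm_ring_1"
proof (induction P)
  case (pCons c P)
  have "poly (pCons c P) a - poly (pCons c P) b = (a - b) * poly P a + b * (poly P a - poly P b)"
    by (simp add: algebra_simps)
  with pCons show ?case by auto
qed auto

lemma X_power_dvd_iff: "fps_X ^ k dvd F \<longleftrightarrow> (\<forall>i<k. F $ i = 0)" for F :: "complex fps"
proof
  assume "\<forall>i<k. F $ i = 0"
  then have "F = fps_X ^ k * fps_shift k F"
    by (intro fps_ext) (auto simp: fps_X_power_mult_nth)
  then show "fps_X ^ k dvd F" by (rule dvdI)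
qed (auto simp: fps_X_power_mult_nth elim!: dvdE)

text \<open>The right-hand side contracts X-adically, which yields a formal solution. The factor
  \<open>fps_X\<close> also lets a bound on k coefficients imply the same bound on k + 1, which
  yields convergence.\<close>

lemma fixpoint:
  assumes b: "conv b" and R: "conv_poly R"
  obtains \<psi> where "conv \<psi>" "\<psi> = b + fps_X * poly R \<psi>"
proof -
  let ?T = "\<lambda>a. b + fps_X * poly R a"
  define it where "it k = (?T ^^ k) 0" for k
  have it_Suc: "it (Suc k) = ?T (it k)" for k by (simp add: it_def)
  have T: "fps_X ^ Suc k dvd ?T x - ?T y" if "fps_X ^ k dvd x - y" for k x y
  proof -
    have "?T x - ?T y = fps_X * (poly R x - poly R y)" by (simp add: algebra_simps)
    then show ?thesis
      using mult_dvd_mono[OF dvd_refl dvd_trans[OF that dvd_poly_diff]] by (simp only: power_Suc)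
  qed
  have step: "fps_X ^ k dvd it (Suc k) - it k" for k
  proof (induction k)
    case (Suc k)
    from T[OF this] show ?case by (simp only: it_Suc)
  qed simp
  have stab: "fps_X ^ k dvd it (k + j) - it k" for k j
  proof (induction j)
    case (Suc j)
    have "fps_X ^ k dvd (it (Suc (k + j)) - it (k + j)) + (it (k + j) - it k)"
      by (intro dvd_add Suc dvd_trans[OF le_imp_power_dvd step]) simp
    then show ?case by simp
  qed simp
  \<comment> \<open>Later iterates agree up to and including index n, so the coefficient of index n
    is final from iterate n + 1 on.\<close>
  define \<psi> where "\<psi> = Abs_fps (\<lambda>n. it (Suc n) $ n)"
  have \<psi>_it: "fps_X ^ k dvd \<psi> - it k" for k
  proof (subst X_power_dvd_iff, safe)
    fix i assume "i < k"
    then have "fps_X ^ Suc i dvd it k - it (Suc i)" using stab[of "Suc i" "k - Suc i"] by simp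
    then show "(\<psi> - it k) $ i = 0" by (subst (asm) X_power_dvd_iff) (auto simp: \<psi>_def)
  qed
  have eq: "\<psi> = ?T \<psi>"
  proof (rule fps_ext)
    fix n
    have "fps_X ^ Suc n dvd (\<psi> - it (Suc n)) - (?T \<psi> - ?T (it n))"
      by (intro dvd_diff \<psi>_it T)
    also have "(\<psi> - it (Suc n)) - (?T \<psi> - ?T (it n)) = \<psi> - ?T \<psi>"
      by (simp only: it_Suc) (simp add: algebra_simps)
    finally have "(\<psi> - ?T \<psi>) $ n = 0"
      unfolding X_power_dvd_iff by blast
    then show "\<psi> $ n = ?T \<psi> $ n" by (simp only: fps_sub_nth right_minus_eq)
  qed
  from b obtain r0 B where r0: "r0 > 0" "\<And>\<rho> k. 0 \<le> \<rho> \<Longrightarrow> \<rho> \<le> r0 \<Longrightarrow> tnorm \<rho> k b \<le> B"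
    using conv_tnorm_bounded by blast
  from tnorm_poly_bounded[OF R, of "B + 1"] obtain r1 M where r1: "r1 > 0"
    "\<And>\<rho> k a. 0 \<le> \<rho> \<Longrightarrow> \<rho> \<le> r1 \<Longrightarrow> tnorm \<rho> k a \<le> B + 1 \<Longrightarrow> tnorm \<rho> k (poly R a) \<le> M" by blast
  \<comment> \<open>Small enough for both bounds and for \<open>r * M \<le> 1\<close>, so that the
    perturbation costs at most the 1 in \<open>B + 1\<close>.\<close>
  define r where "r = min (min r0 r1) (1 / (\<bar>M\<bar> + 1))"
  have r: "0 < r" "r \<le> r0" "r \<le> r1" "r * M \<le> 1"
  proof -
    show "0 < r" "r \<le> r0" "r \<le> r1" using r0 r1 by (auto simp: r_def)
    have "r * M \<le> r * \<bar>M\<bar>" using \<open>0 < r\<close> by (intro mult_left_mono) auto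
    also have "\<dots> \<le> 1 / (\<bar>M\<bar> + 1) * (\<bar>M\<bar> + 1)"
      unfolding r_def by (intro mult_mono) auto
    also have "\<dots> = 1" by (simp add: field_simps)
    finally show "r * M \<le> 1" .
  qed
  have "tnorm r k \<psi> \<le> B + 1" for k
  proof (induction k)
    case 0
    then show ?case using r0(2)[of 0 0] r0(1) by (simp add: tnorm_def)
  next
    case (Suc k)
    have "tnorm r (Suc k) \<psi> = tnorm r (Suc k) (b + fps_X * poly R \<psi>)" using eq by simp
    also have "\<dots> \<le> tnorm r (Suc k) b + r * tnorm r k (poly R \<psi>)"
      using tnorm_add[of r "Suc k" b "fps_X * poly R \<psi>"] r by (simp add: tnorm_X_mult)
    also have "\<dots> \<le> B + r * M"
      using r r0(2)[of r "Suc k"] r1(2)[of r k \<psi>] Suc by (intro add_mono mult_left_mono) auto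
    finally show ?case using r by simp
  qed
  then have "norm (\<psi> $ n) * r ^ n \<le> B + 1" for n
  proof -
    have "norm (\<psi> $ n) * r ^ n \<le> tnorm r (Suc n) \<psi>"
      unfolding tnorm_def using r by (simp add: sum_nonneg)
    with \<open>tnorm r (Suc n) \<psi> \<le> B + 1\<close> show ?thesis by simp
  qed
  with r(1) have "conv \<psi>" by (rule conv_bounded)
  with eq show ?thesis using that by blast
qed

section \<open>Ramification and simple roots\<close>

locale ring_morph =
  fixes h :: "'a :: comm_ring_1 \<Rightarrow> 'b :: comm_ring_1"
  assumes zero [simp]: "h 0 = 0" and one [simp]: "h 1 = 1"
    and add: "h (x + y) = h x + h y" and mult: "h (x * y) = h x * h y"
begin

lemma minus: "h (- x) = - h x"
  using add[of x "- x"] by (simp add: minus_unique)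

lemma coeff_map [simp]: "coeff (map_poly h P) i = h (coeff P i)"
  by (simp add: coeff_map_poly)

lemma map_add: "map_poly h (P + Q) = map_poly h P + map_poly h Q"
  by (rule poly_eqI) (simp add: add)

lemma map_smult: "map_poly h (smult a P) = smult (h a) (map_poly h P)"
  by (rule poly_eqI) (simp add: mult)

lemma map_pCons [simp]: "map_poly h (pCons a P) = pCons (h a) (map_poly h P)"
  by (rule map_poly_pCons) simp

lemma map_mult: "map_poly h (P * Q) = map_poly h P * map_poly h Q"
  by (induction P) (simp_all add: map_add map_smult)

lemma map_power: "map_poly h (P ^ n) = map_poly h P ^ n"
  by (induction n) (simp_all add: map_mult)

lemma map_prod: "map_poly h (\<Prod>x\<in>A. P x) = (\<Prod>x\<in>A. map_poly h (P x))"
  by (induction A rule: infinite_finite_induct) (simp_all add: map_mult)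

lemma poly_map: "poly (map_poly h P) (h a) = h (poly P a)"
  by (induction P) (simp_all add: add mult)

lemma map_pcompose: "map_poly h (pcompose P Q) = pcompose (map_poly h P) (map_poly h Q)"
  by (induction P) (simp_all add: pcompose_pCons map_add map_mult)

end

text \<open>Refining a denominator d to d * n makes the old root of x the n-th power of the new one;
  see \<open>ramify_mult\<close>.\<close>

definition rm :: "nat \<Rightarrow> complex fps \<Rightarrow> complex fps" where
  "rm n F = F oo fps_X ^ n"

abbreviation "rmP n P \<equiv> map_poly (rm n) P"

lemma rm_nth: "n > 0 \<Longrightarrow> rm n F $ k = (if n dvd k then F $ (k div n) else 0)"
proof -
  assume n: "n > 0"
  have "rm n F $ k = (\<Sum>i\<in>{0..k}. if n dvd k \<and> i = k div n then F $ i else 0)"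
    unfolding rm_def fps_compose_nth using n
    by (intro sum.cong refl) (auto simp: power_mult[symmetric])
  also have "\<dots> = (if n dvd k then F $ (k div n) else 0)"
    by (auto simp: sum.delta)
  finally show ?thesis .
qed

lemma rm_nth_0 [simp]: "n > 0 \<Longrightarrow> rm n F $ 0 = F $ 0"
  by (simp add: rm_nth)

lemma rm_0 [simp]: "rm n 0 = 0"
  by (simp add: rm_def)

lemma ring_morph_rm: "n > 0 \<Longrightarrow> ring_morph (rm n)"
  by unfold_locales
    (simp_all add: rm_def fps_compose_add_distrib fps_compose_mult_distrib)

lemma rm_const [simp]: "rm n (fps_const c) = fps_const c"
  by (simp add: rm_def)

lemma rm_X_power: "n > 0 \<Longrightarrow> rm n (fps_X ^ k) = fps_X ^ (n * k)"
  by (simp add: rm_def fps_X_power_compose power_mult)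

lemma rm_rm: "m > 0 \<Longrightarrow> n > 0 \<Longrightarrow> rm m (rm n F) = rm (n * m) F"
  unfolding rm_def
  by (simp add: fps_compose_assoc[symmetric] fps_X_power_compose power_mult[symmetric] mult.commute)

lemma rm_1 [simp]: "rm (Suc 0) F = F"
  by (simp add: rm_def)

lemma rm_eq_iff: "n > 0 \<Longrightarrow> rm n F = rm n G \<longleftrightarrow> F = G"
  by (metis rm_nth fps_ext dvd_triv_left nonzero_mult_div_cancel_left not_gr_zero)

lemma rm_eq_0_iff: "n > 0 \<Longrightarrow> rm n F = 0 \<longleftrightarrow> F = 0"
  using rm_eq_iff[of n F 0] by simp

lemma subdegree_rm: "n > 0 \<Longrightarrow> subdegree (rm n F) = n * subdegree F"
  by (simp add: rm_def)

lemma rmP_rmP: "m > 0 \<Longrightarrow> n > 0 \<Longrightarrow> rmP m (rmP n P) = rmP (n * m) P"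
  by (simp add: map_poly_map_poly comp_def rm_rm)

lemma conv_boundedD:
  assumes "conv F"
  obtains r M where "r > 0" "\<And>n. norm (F $ n) * r ^ n \<le> M"
proof -
  from conv_summable[OF assms] obtain r where r: "r > 0" "summable (\<lambda>n. norm (F $ n) * r ^ n)" .
  have "norm (F $ n) * r ^ n \<le> (\<Sum>n. norm (F $ n) * r ^ n)" for n
    using sum_le_suminf[of "\<lambda>n. norm (F $ n) * r ^ n" "{n}"] r by auto
  with r show ?thesis using that by blast
qed

lemma conv_rm_iff:
  assumes n: "n > 0"
  shows "conv (rm n F) \<longleftrightarrow> conv F"
proof
  assume "conv (rm n F)"
  then obtain r M where r: "r > 0" "\<And>k. norm (rm n F $ k) * r ^ k \<le> M"
    using conv_boundedD by blast
  show "conv F"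
  proof (rule conv_bounded)
    show "r ^ n > 0" using r by simp
    show "norm (F $ k) * (r ^ n) ^ k \<le> M" for k
      using r(2)[of "n * k"] n by (simp add: rm_nth power_mult)
  qed
next
  assume "conv F"
  then obtain r M where r: "r > 0" "\<And>k. norm (F $ k) * r ^ k \<le> M"
    using conv_boundedD by blast
  have M: "M \<ge> 0" using r(2)[of 0] norm_ge_zero[of "F $ 0"] by (simp del: norm_ge_zero)
  \<comment> \<open>A radius of at most 1 keeps the power n * j below the power j.\<close>
  let ?s = "min r 1"
  show "conv (rm n F)"
  proof (rule conv_bounded)
    show "?s > 0" using r by simp
    show "norm (rm n F $ k) * ?s ^ k \<le> M" for k
    proof (cases "n dvd k")
      case True
      then obtain j where j: "k = n * j" by auto
      have "?s ^ k \<le> ?s ^ j"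
        using n r by (intro power_decreasing) (auto simp: j)
      also have "\<dots> \<le> r ^ j" using r by (intro power_mono) auto
      finally have "norm (F $ j) * ?s ^ k \<le> norm (F $ j) * r ^ j"
        by (intro mult_left_mono) auto
      then show ?thesis using r(2)[of j] n by (simp add: rm_nth j)
    qed (simp add: rm_nth n M)
  qed
qed

lemma conv_poly_rmP: "n > 0 \<Longrightarrow> conv_poly P \<Longrightarrow> conv_poly (rmP n P)"
  by (simp add: conv_poly_def coeff_map_poly conv_rm_iff)

section \<open>Reduction at t = 0 and the implicit function theorem\<close>

abbreviation red :: "complex fps poly \<Rightarrow> complex poly" where
  "red P \<equiv> map_poly (\<lambda>c. c $ 0) P"

lemma ring_morph_nth_0: "ring_morph (\<lambda>c :: complex fps. c $ 0)"
  by unfold_locales simp_all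

interpretation nth_0: ring_morph "\<lambda>c :: complex fps. c $ 0"
  by (rule ring_morph_nth_0)

lemma red_rmP: "n > 0 \<Longrightarrow> red (rmP n P) = red P"
  by (rule poly_eqI) (simp add: coeff_map_poly)

lemma red_shift: "a $ 0 = 0 \<Longrightarrow> red (pcompose P [:a, 1:]) = red P"
  by (simp add: nth_0.map_pcompose)

text \<open>The Weierstrass degree: P(0, y) vanishes at y = 0 to order exactly m. Coefficients above
  m are left free.\<close>

definition y_order :: "nat \<Rightarrow> complex fps poly \<Rightarrow> bool" where
  "y_order m P \<longleftrightarrow> (\<forall>i<m. coeff (red P) i = 0) \<and> coeff (red P) m \<noteq> 0"

text \<open>Implicit function theorem. With P = a0 + a1 y + y^2 Q and y = t \<psi> the equation is
  divisible by t, and dividing by t a1 puts it in the form that \<open>fixpoint\<close>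
  solves.\<close>

lemma simple_root:
  assumes P: "conv_poly P" and y: "y_order 1 P"
  obtains \<phi> where "conv \<phi>" "\<phi> $ 0 = 0" "poly P \<phi> = 0"
proof -
  obtain a0 a1 Q where PQ: "P = pCons a0 (pCons a1 Q)"
    by (metis pCons_cases)
  with P y have c: "conv a0" "conv a1" "conv_poly Q" "a0 $ 0 = 0" "a1 $ 0 \<noteq> 0"
    by (auto simp: y_order_def)
  have aux: "A * a = 1 \<Longrightarrow> a * (- A * b + x * (- A * S)) = - b - x * S"
    for A a b x S :: "complex fps"
  proof -
    assume "A * a = 1"
    moreover have "a * (- A * b + x * (- A * S)) = - (A * a) * b - x * ((A * a) * S)"
      by (simp only: ring_distribs mult_minus_left mult_minus_right mult_ac minus_add_distrib
          diff_conv_add_uminus)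
    ultimately show ?thesis by simp
  qed
  have aux2: "x * b + x * p * (a + x * p * q) = x * (b + a * p + x * (p * p * q))"
    for a b x p q :: "complex fps"
    by (simp only: ring_distribs mult_ac add_ac)
  define A where "A = inverse a1"
  have A: "A * a1 = 1" "conv A" using c by (auto simp: A_def inverse_mult_eq_1 conv_inverse)
  define b where "b = fps_shift 1 a0"
  have b: "a0 = fps_X * b" "conv b"
    using c by (auto simp: b_def fps_eq_iff)
  \<comment> \<open>The quadratic part after y = t \<psi>: it carries t^2, so a factor t survives
    the division.\<close>
  define R where "R = smult (- A) ([:0, 0, 1:] * pcompose Q [:0, fps_X:])"
  have R: "conv_poly R" unfolding R_def
    by (intro conv_poly_smult conv_poly_mult conv_poly_pcompose) (auto simp: A c)
  have "conv (- A * b)" using A b by (simp add: conv_mult)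
  from fixpoint[OF this R] obtain \<psi> where \<psi>: "conv \<psi>" "\<psi> = - A * b + fps_X * poly R \<psi>"
    by blast
  define S where "S = \<psi> * \<psi> * poly Q (fps_X * \<psi>)"
  have "a1 * \<psi> = a1 * (- A * b + fps_X * poly R \<psi>)"
    by (rule arg_cong[where f = "(*) a1", OF \<psi>(2)])
  also have "poly R \<psi> = - A * S"
    by (simp add: R_def S_def poly_pcompose mult_ac)
  also note aux[OF A(1)]
  finally have "a1 * \<psi> = - b - fps_X * S" .
  then have *: "b + a1 * \<psi> + fps_X * S = 0" by simp
  have "poly P (fps_X * \<psi>) = fps_X * b + fps_X * \<psi> * (a1 + fps_X * \<psi> * poly Q (fps_X * \<psi>))"
    by (simp only: PQ b poly_pCons)
  also have "\<dots> = fps_X * (b + a1 * \<psi> + fps_X * S)"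
    unfolding S_def by (rule aux2)
  also have "\<dots> = 0" unfolding * by simp
  finally have "poly P (fps_X * \<psi>) = 0" .
  moreover have "conv (fps_X * \<psi>)" by (intro conv_mult conv_X \<psi>(1))
  moreover have "(fps_X * \<psi>) $ 0 = 0" by simp
  ultimately show ?thesis by (rule that[rotated 2])
qed

section \<open>Taylor shifts\<close>

lemma pderiv_power_shift:
  "(pderiv ^^ k) (pcompose P [:a, 1:]) = pcompose ((pderiv ^^ k) P) [:a, 1:]"
  by (induction k) (simp_all add: pderiv_pcompose pderiv_pCons)

text \<open>Taylor's formula. It shows that shifting by a root of the (m - 1)st derivative kills the
  coefficient of y^(m - 1).\<close>

lemma coeff_shift:
  "fact k * coeff (pcompose P [:a, 1:]) k = poly ((pderiv ^^ k) P) a" for a :: "'a :: {idom, semiring_char_0}"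
proof -
  have "coeff ((pderiv ^^ k) (pcompose P [:a, 1:])) 0 = poly ((pderiv ^^ k) P) a"
    unfolding pderiv_power_shift by simp
  then show ?thesis by (simp add: coeff_higher_pderiv pochhammer_fact)
qed

lemma coeff_pcompose_scale: "coeff (pcompose P [:0, b:]) i = b ^ i * coeff P i" for b :: "'a :: comm_ring_1"
proof (induction P arbitrary: i)
  case (pCons a P)
  then show ?case by (cases i) (auto simp: pcompose_pCons mult_ac)
qed simp

text \<open>Moves the root c to 0, where its multiplicity is read off the coefficients as
  \<open>y_order\<close> requires.\<close>

lemma order_shift:
  fixes w :: "'a :: idom poly"
  assumes "w \<noteq> 0"
  shows "(\<forall>i<order c w. coeff (pcompose w [:c, 1:]) i = 0) \<and> coeff (pcompose w [:c, 1:]) (order c w) \<noteq> 0"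
proof -
  from order_decomp[OF assms] obtain q where q: "w = [:- c, 1:] ^ order c w * q" "\<not> [:- c, 1:] dvd q"
    by blast
  have pw: "pcompose ([:- c, 1:] ^ n) [:c, 1:] = monom 1 n" for n
  proof (induction n)
    case (Suc n)
    have "pcompose [:- c, 1:] [:c, 1:] = [:0, 1:]" by (simp add: pcompose_pCons)
    then show ?case by (simp only: power_Suc pcompose_mult Suc) (simp add: monom_Suc)
  qed (simp add: monom_0 pcompose_1)
  have "pcompose w [:c, 1:] = monom 1 (order c w) * pcompose q [:c, 1:]"
    by (subst q(1)) (simp add: pcompose_mult pw)
  moreover have "poly q c \<noteq> 0" using q(2) by (simp add: poly_eq_0_iff_dvd)
  ultimately show ?thesis by (simp add: coeff_monom_mult)
qed

lemma X_power_mult_cancel_conv: "conv (fps_X ^ k * F) \<Longrightarrow> conv F"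
proof -
  assume "conv (fps_X ^ k * F)"
  then have "conv (fps_shift k (fps_X ^ k * F))" by simp
  moreover have "fps_shift k (fps_X ^ k * F) = F" by (simp add: fps_eq_iff fps_X_power_mult_nth)
  ultimately show ?thesis by simp
qed

section \<open>Newton--Puiseux factorization\<close>

lemma y_order_rmP: "n > 0 \<Longrightarrow> y_order m (rmP n P) \<longleftrightarrow> y_order m P"
  by (simp add: y_order_def red_rmP)

text \<open>The Newton polygon step: the substitution \<open>x = t\<^sup>q\<close>, \<open>y \<rightarrow> t\<^sup>p y\<close> along the edge of smallest
  slope \<open>p / q\<close> makes a coefficient below the leading one a unit.\<close>

lemma newton_step:
  assumes P: "conv_poly P" and y: "y_order m P" and m: "m \<ge> 2" and c0: "coeff P (m - 1) = 0"
    and nz: "\<exists>i<m. coeff P i \<noteq> 0"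
  obtains p q Q i where "p > 0" "q > 0" "conv_poly Q"
    "pcompose (rmP q P) [:0, fps_X ^ p:] = smult (fps_X ^ (p * m)) Q"
    "degree (red Q) = m" "coeff (red Q) (m - 1) = 0" "i < m" "coeff (red Q) i \<noteq> 0"
proof -
  let ?S = "{i. i < m \<and> coeff P i \<noteq> 0}" and ?d = "\<lambda>i. subdegree (coeff P i)"
  have "finite ?S" "?S \<noteq> {}" using nz by auto
  then obtain i0 where i0: "i0 \<in> ?S" and
    min: "\<And>i. i \<in> ?S \<Longrightarrow> real (?d i0) / real (m - i0) \<le> real (?d i) / real (m - i)"
    using ex_is_arg_min_if_finite[of ?S "\<lambda>i. real (?d i) / real (m - i)"]
    by (auto simp: is_arg_min_linorder)
  \<comment> \<open>The fraction p / q need not be in lowest terms; it only matters that after x =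
    t^q the edge has the integral slope p.\<close>
  define p where "p = ?d i0"
  define q where "q = m - i0"
  have low: "coeff P i $ 0 = 0" if "i < m" for i
    using y that by (simp add: y_order_def)
  have top: "coeff P m $ 0 \<noteq> 0" using y by (simp add: y_order_def)
  have q: "q > 0" using i0 by (simp add: q_def)
  have p: "p > 0" using i0 low[of i0] by (auto simp: p_def subdegree_eq_0_iff intro: gr0I)
  have slope: "p * (m - i) \<le> ?d i * q" if "i < m" "coeff P i \<noteq> 0" for i
  proof -
    have "real p / real q \<le> real (?d i) / real (m - i)"
      using min[of i] that by (simp add: p_def q_def)
    then have "real p * real (m - i) \<le> real (?d i) * real q"
      using q that by (simp add: field_simps)
    then show ?thesis by (simp only: of_nat_mult[symmetric] of_nat_le_iff)
  qed
  interpret rm: ring_morph "rm q" using q by (rule ring_morph_rm)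
  let ?P' = "pcompose (rmP q P) [:0, fps_X ^ p:]"
  have co: "coeff ?P' i = fps_X ^ (p * i) * rm q (coeff P i)" for i
    by (simp add: coeff_pcompose_scale power_mult)
  \<comment> \<open>For i >= m the factor t^(p i) suffices; for i < m the minimality of the slope
    supplies the missing t^(p (m - i)).\<close>
  have "fps_X ^ (p * m) dvd coeff ?P' i" for i
    unfolding X_power_dvd_iff
  proof safe
    fix j assume j: "j < p * m"
    show "coeff ?P' i $ j = 0"
    proof (cases "j < p * i")
      case False
      then have "p * i < p * m" using j by linarith
      then have im: "i < m" by simp
      have "coeff P i $ ((j - p * i) div q) = 0" if "coeff P i \<noteq> 0" "q dvd j - p * i"
      proof -
        have "j - p * i < p * (m - i)" using j False im by (simp add: diff_mult_distrib2)
        also have "\<dots> \<le> ?d i * q" using slope im that by simp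
        finally have "(j - p * i) div q < ?d i"
          by (simp add: less_mult_imp_div_less)
        then show ?thesis by (rule nth_less_subdegree_zero)
      qed
      with False q show ?thesis
        by (cases "coeff P i = 0") (auto simp: co fps_X_power_mult_nth rm_nth)
    qed (simp add: co fps_X_power_mult_nth)
  qed
  then have "[:fps_X ^ (p * m):] dvd ?P'" by (simp add: const_poly_dvd_iff)
  then obtain Q where "?P' = [:fps_X ^ (p * m):] * Q" by (rule dvdE)
  then have Q: "?P' = smult (fps_X ^ (p * m)) Q" by simp
  have "conv_poly Q" unfolding conv_poly_def
  proof
    fix i
    have "conv_poly ?P'" using P q by (intro conv_poly_pcompose conv_poly_rmP) auto
    then have "conv (coeff ?P' i)" by (simp add: conv_poly_def)
    then have "conv (fps_X ^ (p * m) * coeff Q i)" unfolding Q by simp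
    then show "conv (coeff Q i)" by (rule X_power_mult_cancel_conv)
  qed
  \<comment> \<open>Reduction keeps exactly the points on the edge; above m nothing survives because
    p > 0.\<close>
  have coQ: "coeff (red Q) i = (if i \<le> m then rm q (coeff P i) $ (p * (m - i)) else 0)" for i
  proof -
    have "coeff ?P' i $ (p * m) = coeff (smult (fps_X ^ (p * m)) Q) i $ (p * m)" by (simp only: Q)
    also have "\<dots> = coeff Q i $ 0" by (simp add: fps_X_power_mult_nth)
    finally have "coeff Q i $ 0 = (fps_X ^ (p * i) * rm q (coeff P i)) $ (p * m)"
      by (simp only: co)
    then show ?thesis using p by (auto simp: fps_X_power_mult_nth diff_mult_distrib2)
  qed
  have coQm: "coeff (red Q) m \<noteq> 0" using top q by (simp add: coQ del: nth_0.coeff_map)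
  have "degree (red Q) = m"
  proof (rule antisym)
    show "degree (red Q) \<le> m" by (rule degree_le) (simp add: coQ del: nth_0.coeff_map)
    show "m \<le> degree (red Q)" by (rule le_degree) (rule coQm)
  qed
  moreover have "coeff (red Q) (m - 1) = 0" using c0 by (simp add: coQ del: nth_0.coeff_map)
  moreover have "i0 < m" using i0 by simp
  moreover have "coeff (red Q) i0 \<noteq> 0"
  proof -
    have "coeff (red Q) i0 = rm q (coeff P i0) $ (q * p)"
      using i0 by (simp add: coQ q_def mult.commute del: nth_0.coeff_map)
    also have "\<dots> = coeff P i0 $ ?d i0" using q by (simp add: rm_nth p_def)
    also have "\<dots> \<noteq> 0" using i0 by simp
    finally show ?thesis .
  qed
  ultimately show ?thesis using that[OF p q \<open>conv_poly Q\<close> Q] by blast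
qed

text \<open>If a root c had full multiplicity, then w = e (y - c)^m, whose coefficient of y^(m - 1)
  is - m c e. Its vanishing forces c = 0, and then w has no term below y^m.\<close>

lemma small_multiplicity_root:
  fixes w :: "complex poly"
  assumes d: "degree w = m" and m: "m \<ge> 2" and c0: "coeff w (m - 1) = 0"
    and i: "i < m" "coeff w i \<noteq> 0"
  obtains c where "0 < order c w" "order c w < m"
proof -
  have "w \<noteq> 0" using i by auto
  have "\<not> constant (poly w)" using d m by (simp add: constant_degree)
  then obtain c where c: "poly w c = 0" using fundamental_theorem_of_algebra by blast
  have "order c w > 0" using c \<open>w \<noteq> 0\<close> by (simp add: order_gt_0_iff)
  moreover have "order c w \<noteq> m"
  proof
    assume o: "order c w = m"
    from order_decomp[OF \<open>w \<noteq> 0\<close>, of c] obtain r where r: "w = [:- c, 1:] ^ m * r"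
      unfolding o by blast
    have "r \<noteq> 0" using r \<open>w \<noteq> 0\<close> by auto
    then have "degree w = m + degree r"
      unfolding r by (subst degree_mult_eq) (auto simp: degree_linear_power)
    then obtain e where e: "r = [:e:]" using d by (auto elim: degree_eq_zeroE)
    have "e \<noteq> 0" using \<open>r \<noteq> 0\<close> e by simp
    have "coeff w j = e * coeff ([:- c, 1:] ^ m) j" for j by (simp add: r e mult.commute)
    note co = this coeff_linear_poly_power[of _ m "- c" 1]
    have "of_nat (m choose (m - 1)) * (- c) ^ (m - (m - 1)) = (0 :: complex)"
      using c0 co \<open>e \<noteq> 0\<close> by simp
    moreover have "m choose (m - 1) = m" "m - (m - 1) = 1"
      using m binomial_symmetric[of "m - 1" m] by auto
    ultimately have "c = 0" using m by auto
    then have "coeff w i = 0" using i co by simp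
    with i show False by simp
  qed
  moreover have "order c w \<le> m" using order_degree[OF \<open>w \<noteq> 0\<close>, of c] d by simp
  ultimately show ?thesis using that[of c] by linarith
qed

text \<open>Strong induction on m. After the shift the coefficient of y^(m - 1) is zero, so the
  reduced polynomial of the Newton step is not a multiple of an m-th power of a linear factor and
  has a root of smaller multiplicity to recurse at.\<close>

lemma puiseux_root:
  assumes "conv_poly P" "y_order m P" "m > 0"
  shows "\<exists>n>0. \<exists>\<phi>. conv \<phi> \<and> \<phi> $ 0 = 0 \<and> poly (rmP n P) \<phi> = 0"
  using assms
proof (induction m arbitrary: P rule: less_induct)
  case (less m)
  note P = less.prems(1) and y = less.prems(2)
  show ?case
  proof (cases "m = 1")
    case True
    with y have "y_order 1 P" by simp
    from simple_root[OF P this] obtain \<phi> where "conv \<phi>" "\<phi> $ 0 = 0" "poly P \<phi> = 0" by blast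
    then show ?thesis by (intro exI[of _ 1]) auto
  next
    case False
    with less.prems have m: "m \<ge> 2" by simp
    \<comment> \<open>The reduction of P starts at y^m, so that of its (m - 1)st derivative starts
      with a nonzero multiple of y.\<close>
    let ?D = "(pderiv ^^ (m - 1)) P"
    have "conv_poly ?D"
      unfolding conv_poly_def coeff_higher_pderiv
    proof
      fix i
      have "pochhammer (of_nat (Suc i)) (m - 1) = fps_const (pochhammer (of_nat (Suc i)) (m - 1) :: complex)"
        unfolding pochhammer_of_nat by (simp only: fps_of_nat)
      then show "conv (pochhammer (of_nat (Suc i)) (m - 1) * coeff P (i + (m - 1)))"
        using P by (simp add: conv_poly_def conv_mult del: of_nat_Suc)
    qed
    moreover have "y_order 1 ?D"
    proof -
      have "coeff ?D i $ 0 = of_nat (pochhammer (Suc i) (m - 1)) * coeff P (i + (m - 1)) $ 0" for i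
        unfolding coeff_higher_pderiv pochhammer_of_nat by (simp del: of_nat_Suc)
      moreover have "pochhammer (Suc 1) (m - 1) \<noteq> 0"
        using pochhammer_pos[of "Suc 1" "m - 1"] by simp
      ultimately show ?thesis using y m by (simp add: y_order_def)
    qed
    ultimately obtain \<alpha> where \<alpha>: "conv \<alpha>" "\<alpha> $ 0 = 0" "poly ?D \<alpha> = 0"
      by (rule simple_root)
    define P1 where "P1 = pcompose P [:\<alpha>, 1:]"
    have P1: "conv_poly P1" unfolding P1_def using P \<alpha> by (intro conv_poly_pcompose) auto
    have y1: "y_order m P1" using y \<alpha> by (simp add: y_order_def P1_def red_shift del: nth_0.coeff_map)
    have c1: "coeff P1 (m - 1) = 0"
      using coeff_shift[of "m - 1" P \<alpha>] \<alpha>(3) by (simp add: P1_def)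
    show ?thesis
    proof (cases "\<exists>i<m. coeff P1 i \<noteq> 0")
      case False
      \<comment> \<open>All coefficients below m vanish, so the shift \<open>\<alpha>\<close> is
        itself a root.\<close>
      then have "coeff P1 0 = 0" using m by simp
      then have "poly P \<alpha> = 0" by (simp add: P1_def)
      with \<alpha> show ?thesis by (intro exI[of _ 1]) auto
    next
      case True
      from newton_step[OF P1 y1 m c1 True] obtain p q Q i where Q: "p > 0" "q > 0" "conv_poly Q"
        "pcompose (rmP q P1) [:0, fps_X ^ p:] = smult (fps_X ^ (p * m)) Q"
        "degree (red Q) = m" "coeff (red Q) (m - 1) = 0" "i < m" "coeff (red Q) i \<noteq> 0" .
      from small_multiplicity_root[OF Q(5) m Q(6-8)] obtain c
        where c: "0 < order c (red Q)" "order c (red Q) < m" .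
      define P2 where "P2 = pcompose Q [:fps_const c, 1:]"
      have "red Q \<noteq> 0" using Q by auto
      have "y_order (order c (red Q)) P2"
        unfolding y_order_def P2_def nth_0.map_pcompose
        using order_shift[OF \<open>red Q \<noteq> 0\<close>, of c] by simp
      moreover have "conv_poly P2"
        unfolding P2_def using Q by (intro conv_poly_pcompose) auto
      ultimately obtain n \<phi> where n: "n > 0" "conv \<phi>" "\<phi> $ 0 = 0" "poly (rmP n P2) \<phi> = 0"
        using less.IH[OF c(2) _ _ c(1)] by blast
      interpret rn: ring_morph "rm n" using n by (intro ring_morph_rm)
      interpret rq: ring_morph "rm q" using Q by (intro ring_morph_rm)
      have nq: "q * n > 0" using n Q by simp
      \<comment> \<open>Undoes the shift by c, the scaling y -> t^p y and the shift by
        \<open>\<alpha>\<close>, each pulled back to the final denominator q * n.\<close>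
      let ?\<psi> = "rm (q * n) \<alpha> + fps_X ^ (n * p) * (fps_const c + \<phi>)"
      have "poly (rmP n Q) (fps_const c + \<phi>) = 0"
        using n(4) by (simp add: P2_def rn.map_pcompose poly_pcompose)
      then have "poly (rmP n (smult (fps_X ^ (p * m)) Q)) (fps_const c + \<phi>) = 0"
        by (simp add: rn.map_smult)
      then have "poly (rmP n (pcompose (rmP q P1) [:0, fps_X ^ p:])) (fps_const c + \<phi>) = 0"
        by (simp only: Q(4))
      then have "poly (rmP (q * n) P1) (fps_X ^ (n * p) * (fps_const c + \<phi>)) = 0"
        using n(1) Q(2) by (simp add: rn.map_pcompose poly_pcompose rmP_rmP rm_X_power mult.commute)
      then have "poly (rmP (q * n) P) ?\<psi> = 0"
        using ring_morph.map_pcompose[OF ring_morph_rm[OF nq], of P "[:\<alpha>, 1:]"]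
        by (simp add: P1_def poly_pcompose ring_morph.map_pCons[OF ring_morph_rm[OF nq]]
            ring_morph.one[OF ring_morph_rm[OF nq]])
      moreover have "conv ?\<psi>"
        using \<alpha> n nq by (intro conv_add conv_mult) (auto simp: conv_rm_iff)
      moreover have "?\<psi> $ 0 = 0"
        using \<alpha>(2) nq n Q(1) by (simp add: fps_X_power_mult_nth)
      ultimately show ?thesis using nq by blast
    qed
  qed
qed

lemma red_linear_cancel:
  assumes "\<phi> $ 0 = 0" "y_order (Suc m) ([:- \<phi>, 1:] * Q)"
  shows "y_order m Q"
proof -
  have "red ([:- \<phi>, 1:] * Q) = pCons 0 (red Q)"
    using assms(1) by (simp add: nth_0.map_mult del: mult_pCons_left) simp
  with assms(2) show ?thesis by (auto simp: y_order_def simp del: nth_0.coeff_map)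
qed

text \<open>Roots are split off one at a time, each lowering \<open>y_order\<close> by one. The
  remaining factor may need a finer denominator, to which the root already found is carried by
  \<open>rm\<close>; at m = 0 the rest is a unit at the origin.\<close>

lemma puiseux_factorization:
  assumes "conv_poly P" "y_order m P"
  shows "\<exists>n>0. \<exists>\<phi>s u. conv_poly u \<and> coeff u 0 $ 0 \<noteq> 0 \<and> (\<forall>\<phi>\<in>set \<phi>s. conv \<phi> \<and> \<phi> $ 0 = 0) \<and>
           rmP n P = u * prod_list (map (\<lambda>\<phi>. [:- \<phi>, 1:]) \<phi>s)"
  using assms
proof (induction m arbitrary: P)
  case 0
  then show ?case by (intro exI[of _ 1] conjI exI[of _ "[]"] exI[of _ P]) (auto simp: y_order_def)
next
  case (Suc m)
  from puiseux_root[OF Suc.prems] obtain n \<phi> where n: "n > 0" "conv \<phi>" "\<phi> $ 0 = 0" "poly (rmP n P) \<phi> = 0"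
    by blast
  then obtain Q where Q: "rmP n P = [:- \<phi>, 1:] * Q"
    by (auto simp: poly_eq_0_iff_dvd)
  have "conv_poly Q"
    using conv_poly_linear_cancel[of \<phi> Q] conv_poly_rmP[OF n(1) Suc.prems(1)] n(2) by (simp only: Q)
  moreover have "y_order m Q"
    using red_linear_cancel[OF n(3), of m Q] Suc.prems(2) n(1) by (simp only: Q[symmetric] y_order_rmP)
  ultimately obtain k \<phi>s u where k: "k > 0" "conv_poly u" "coeff u 0 $ 0 \<noteq> 0"
    "\<forall>\<phi>\<in>set \<phi>s. conv \<phi> \<and> \<phi> $ 0 = 0" "rmP k Q = u * prod_list (map (\<lambda>\<phi>. [:- \<phi>, 1:]) \<phi>s)"
    using Suc.IH by blast
  interpret rk: ring_morph "rm k" using k by (intro ring_morph_rm)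
  have "rmP (n * k) P = rmP k (rmP n P)" using n k by (simp add: rmP_rmP)
  also have "\<dots> = [:- rm k \<phi>, 1:] * rmP k Q" by (simp add: Q rk.map_mult rk.minus del: mult_pCons_left)
  also have "\<dots> = u * prod_list (map (\<lambda>\<phi>. [:- \<phi>, 1:]) (rm k \<phi> # \<phi>s))"
    by (simp add: k(5) mult_ac del: mult_pCons_left mult_pCons_right)
  finally have "rmP (n * k) P = u * prod_list (map (\<lambda>\<phi>. [:- \<phi>, 1:]) (rm k \<phi> # \<phi>s))" .
  moreover have "\<forall>\<psi>\<in>set (rm k \<phi> # \<phi>s). conv \<psi> \<and> \<psi> $ 0 = 0"
    using k n by (simp add: conv_rm_iff)
  moreover have "n * k > 0" using n k by simp
  ultimately show ?case using k(2,3) by blast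
qed

section \<open>Newton--Puiseux roots of real polynomials\<close>

text \<open>The unramified form of \<open>ramify_poly\<close>: with the embedding separated, every
  change of denominator is an application of \<open>rm\<close>.\<close>

definition emb :: "real poly poly \<Rightarrow> complex fps poly" where
  "emb h = map_poly (\<lambda>c. fps_of_poly (map_poly complex_of_real c)) h"

lemma coeff_emb: "coeff (emb h) j $ i = complex_of_real (coeff (coeff h j) i)"
  by (simp add: emb_def coeff_map_poly)

lemma conv_poly_emb: "conv_poly (emb h)"
  by (simp add: conv_poly_def emb_def coeff_map_poly)

lemma ramify_poly_eq: "n > 0 \<Longrightarrow> ramify_poly n h = rmP n (emb h)"
  by (rule poly_eqI)
    (simp add: ramify_poly_def emb_def coeff_map_poly fps_of_poly_pcompose rm_def fps_of_poly_monom')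

lemma conv_poly_ramify_poly: "n > 0 \<Longrightarrow> conv_poly (ramify_poly n h)"
  by (simp add: ramify_poly_eq conv_poly_rmP conv_poly_emb)

lemma ramify_poly_mult: "n > 0 \<Longrightarrow> e > 0 \<Longrightarrow> ramify_poly (n * e) h = rmP e (ramify_poly n h)"
  by (simp add: ramify_poly_eq rmP_rmP)

lemma ramify_poly_nonzero: "n > 0 \<Longrightarrow> h \<noteq> 0 \<Longrightarrow> ramify_poly n h \<noteq> 0"
proof
  assume n: "n > 0" and h: "h \<noteq> 0" and r: "ramify_poly n h = 0"
  have "coeff (emb h) j = 0" for j
  proof -
    have "rm n (coeff (emb h) j) = coeff (ramify_poly n h) j" using n by (simp add: ramify_poly_eq coeff_map_poly)
    then show ?thesis using n r by (simp add: rm_eq_0_iff)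
  qed
  then have "complex_of_real (coeff (coeff h j) i) = 0" for i j
    by (simp add: coeff_emb[symmetric])
  then have "h = 0" by (auto simp: poly_eq_iff)
  with h show False by simp
qed

text \<open>y-regularity with the order as a parameter; a condition on coefficients passes directly
  to \<open>xscale\<close> and \<open>emb\<close>.\<close>

definition regular :: "nat \<Rightarrow> real poly poly \<Rightarrow> bool" where
  "regular m h \<longleftrightarrow> (\<forall>i j. i + j < m \<longrightarrow> coeff (coeff h j) i = 0) \<and> coeff (coeff h m) 0 \<noteq> 0"

lemma coeff_hom_comp: "coeff (coeff (hom_comp m h) j) i = (if i + j = m then coeff (coeff h j) i else 0)"
proof -
  have "coeff (coeff (hom_comp m h) j) i =
      (\<Sum>k\<le>m. if k = i then (if i + j = m then coeff (coeff h j) i else 0) else 0)"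
    unfolding hom_comp_def coeff_sum
    by (intro sum.cong refl) auto
  also have "\<dots> = (if i + j = m then coeff (coeff h j) i else 0)"
    by (auto simp: sum.delta)
  finally show ?thesis .
qed

lemma y_regularD:
  assumes "y_regular h"
  shows "regular (ord_poly h) h"
proof -
  have hc: "hom_comp (i + j) h \<noteq> 0" if "coeff (coeff h j) i \<noteq> 0" for i j
    using that coeff_hom_comp[of "i + j" h j i] by auto
  have "coeff (coeff h j) i = 0" if "i + j < ord_poly h" for i j
    using not_less_Least[OF that[unfolded ord_poly_def]] hc by blast
  moreover have "peval (hom_comp m h) 0 1 = coeff (coeff h m) 0" for m
  proof -
    have "peval (hom_comp m h) 0 1 = (\<Sum>k\<le>m. if k = 0 then coeff (coeff h m) 0 else 0)"
      unfolding peval_def hom_comp_def poly_sum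
      by (intro sum.cong refl) (auto simp: poly_monom pCons_one[symmetric] poly_power power_0_left)
    then show ?thesis by simp
  qed
  ultimately show ?thesis using assms by (auto simp: regular_def y_regular_def)
qed

lemma regular_nonzero: "regular m h \<Longrightarrow> h \<noteq> 0"
  by (auto simp: regular_def)

lemma coeff_xscale: "coeff (coeff (xscale s h) j) i = s ^ i * coeff (coeff h j) i"
  by (simp add: xscale_def coeff_map_poly coeff_pcompose_scale)

lemma regular_xscale: "s \<noteq> 0 \<Longrightarrow> regular m (xscale s h) \<longleftrightarrow> regular m h"
  by (auto simp: regular_def coeff_xscale)

lemma y_order_emb: "regular m h \<Longrightarrow> y_order m (emb h)"
  by (simp add: y_order_def coeff_map_poly coeff_emb regular_def)

section \<open>Dictionary between fractional series and power series in a root of x\<close>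

lemma ramify_unramify: "n > 0 \<Longrightarrow> ramify n (unramify n F) = F"
  by (rule fps_ext) (simp add: ramify_def unramify_def)

lemma has_denom_unramify: "n > 0 \<Longrightarrow> has_denom n (unramify n F)"
  by (auto simp: has_denom_def unramify_def split: if_splits)

lemma unramify_nonneg: "unramify n F q \<noteq> 0 \<Longrightarrow> q \<ge> 0"
  by (auto simp: unramify_def split: if_splits)

lemma has_denomE:
  assumes "has_denom n \<phi>" "\<phi> q \<noteq> 0" "q \<ge> 0"
  obtains k where "q = of_nat k / of_nat n" "ramify n \<phi> $ k \<noteq> 0"
proof -
  have n: "n > 0" using assms by (simp add: has_denom_def)
  from assms obtain z :: int where z: "q * of_nat n = of_int z" by (auto simp: has_denom_def elim: Ints_cases)
  have "of_int z \<ge> (0 :: rat)" unfolding z[symmetric] using assms(3) by simp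
  then have "q * of_nat n = of_nat (nat z)" unfolding z by simp
  then have q: "q = of_nat (nat z) / of_nat n" using n by (simp add: field_simps)
  then have "ramify n \<phi> $ nat z \<noteq> 0" using assms(2) by (simp add: ramify_def)
  with q show ?thesis using that by blast
qed

text \<open>\<open>ramify\<close> reads only exponents k / n with k >= 0, so the sign conditions and
  the common denominator are what make it injective.\<close>

lemma frac_series_eqI:
  assumes "has_denom n \<phi>" "has_denom n \<psi>" "\<And>q. \<phi> q \<noteq> 0 \<Longrightarrow> q \<ge> 0" "\<And>q. \<psi> q \<noteq> 0 \<Longrightarrow> q \<ge> 0"
    and "ramify n \<phi> = ramify n \<psi>"
  shows "\<phi> = \<psi>"
proof
  fix q
  have "\<phi> (of_nat k / of_nat n) = \<psi> (of_nat k / of_nat n)" for k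
    using arg_cong[OF assms(5), of "\<lambda>F. F $ k"] by (simp add: ramify_def)
  then show "\<phi> q = \<psi> q"
    using has_denomE[OF assms(1) _ assms(3)] has_denomE[OF assms(2) _ assms(4)] by metis
qed

lemma has_denom_mult: "has_denom n \<phi> \<Longrightarrow> e > 0 \<Longrightarrow> has_denom (n * e) \<phi>"
  by (auto simp: has_denom_def mult.assoc[symmetric])

text \<open>Since n is already a denominator, the finer grid meets no further nonzero
  coefficients.\<close>

lemma ramify_mult:
  assumes "has_denom n \<phi>" "e > 0"
  shows "ramify (n * e) \<phi> = rm e (ramify n \<phi>)"
proof (rule fps_ext)
  fix k
  have n: "n > 0" using assms by (simp add: has_denom_def)
  show "ramify (n * e) \<phi> $ k = rm e (ramify n \<phi>) $ k"
  proof (cases "e dvd k")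
    case True
    then show ?thesis using assms(2) by (auto simp: ramify_def rm_nth elim!: dvdE)
  next
    case False
    have "\<phi> (of_nat k / of_nat (n * e)) = 0"
    proof (rule ccontr)
      assume "\<phi> (of_nat k / of_nat (n * e)) \<noteq> 0"
      from has_denomE[OF assms(1) this] obtain j where
        "(of_nat k / of_nat (n * e) :: rat) = of_nat j / of_nat n" by auto
      then have "(of_nat k :: rat) = of_nat (j * e)" using n assms(2) by (simp add: field_simps)
      then have "k = j * e" by (simp only: of_nat_eq_iff)
      with False show False by simp
    qed
    then show ?thesis using False assms(2) by (simp add: ramify_def rm_nth)
  qed
qed

lemma has_denom_denom: "has_denom n \<phi> \<Longrightarrow> has_denom (denom \<phi>) \<phi>"
  unfolding denom_def by (rule LeastI)

lemma denom_pos: "has_denom n \<phi> \<Longrightarrow> denom \<phi> > 0"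
  using has_denom_denom by (auto simp: has_denom_def)

lemma conv_ramify_iff:
  assumes "has_denom m \<phi>" "has_denom n \<phi>"
  shows "conv (ramify m \<phi>) \<longleftrightarrow> conv (ramify n \<phi>)"
proof -
  have mn: "m > 0" "n > 0" using assms by (auto simp: has_denom_def)
  have "rm n (ramify m \<phi>) = rm m (ramify n \<phi>)"
    using ramify_mult[OF assms(1) mn(2)] ramify_mult[OF assms(2) mn(1)] by (simp add: mult.commute)
  then show ?thesis using mn conv_rm_iff by metis
qed

text \<open>The definitions fix the least denominator; this lemma, \<open>NP_roots_iff\<close> and
  \<open>NP_mult_eq\<close> allow any, by comparing both over their product.\<close>

lemma puiseux_iff:
  assumes "has_denom n \<phi>"
  shows "puiseux \<phi> \<longleftrightarrow> (\<forall>q. \<phi> q \<noteq> 0 \<longrightarrow> q \<ge> 1) \<and> conv (ramify n \<phi>)"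
  using assms conv_ramify_iff[OF has_denom_denom[OF assms] assms]
  by (auto simp: puiseux_def conv_def)

lemma puiseuxD:
  assumes "puiseux \<phi>"
  shows "has_denom (denom \<phi>) \<phi>" "denom \<phi> > 0" "\<And>q. \<phi> q \<noteq> 0 \<Longrightarrow> q \<ge> 0"
  using assms has_denom_denom denom_pos unfolding puiseux_def
  by (blast, blast, meson order_trans zero_le_one)

lemma puiseux_ramify_0:
  assumes "puiseux \<phi>" "n > 0"
  shows "ramify n \<phi> $ 0 = 0"
  using assms by (auto simp: puiseux_def ramify_def)

lemma puiseux_unramify:
  assumes "n > 0" "conv F" "\<And>k. k < n \<Longrightarrow> F $ k = 0"
  shows "puiseux (unramify n F)"
proof -
  have "q \<ge> 1" if q: "unramify n F q \<noteq> 0" for q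
  proof -
    from has_denomE[OF has_denom_unramify q unramify_nonneg[OF q]] assms(1)
    obtain k where k: "q = of_nat k / of_nat n" "F $ k \<noteq> 0" by (auto simp: ramify_unramify)
    then have "n \<le> k" using assms(3) not_le by blast
    with k assms(1) show ?thesis by (simp add: le_divide_eq)
  qed
  then show ?thesis
    using puiseux_iff[OF has_denom_unramify[OF assms(1)]] assms by (simp add: ramify_unramify)
qed

lemma unramify_eq_0_iff: "n > 0 \<Longrightarrow> (\<forall>q. unramify n F q = 0) \<longleftrightarrow> F = 0"
proof
  assume "n > 0" "\<forall>q. unramify n F q = 0"
  then have "ramify n (unramify n F) = 0" by (simp add: ramify_def fps_eq_iff)
  then show "F = 0" using \<open>n > 0\<close> by (simp add: ramify_unramify)
qed (simp add: unramify_def)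

lemma poly_ramify_mult:
  assumes "has_denom n \<phi>" "e > 0"
  shows "poly (ramify_poly (n * e) h) (ramify (n * e) \<phi>) = rm e (poly (ramify_poly n h) (ramify n \<phi>))"
proof -
  have "n > 0" using assms by (simp add: has_denom_def)
  then show ?thesis using assms
    by (simp add: ramify_poly_mult ramify_mult ring_morph.poly_map[OF ring_morph_rm])
qed

lemma NP_roots_iff:
  assumes "has_denom n \<phi>"
  shows "\<phi> \<in> NP_roots h \<longleftrightarrow> puiseux \<phi> \<and> poly (ramify_poly n h) (ramify n \<phi>) = 0"
proof -
  let ?d = "denom \<phi>"
  have d: "has_denom ?d \<phi>" "?d > 0" "n > 0"
    using assms has_denom_denom denom_pos by (auto simp: has_denom_def)
  have "(\<forall>q. subst h \<phi> q = 0) \<longleftrightarrow> rm n (poly (ramify_poly ?d h) (ramify ?d \<phi>)) = 0"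
    using d by (simp add: subst_def unramify_eq_0_iff rm_eq_0_iff)
  also have "\<dots> \<longleftrightarrow> rm ?d (poly (ramify_poly n h) (ramify n \<phi>)) = 0"
    using d by (simp only: poly_ramify_mult[symmetric] assms mult.commute)
  also have "\<dots> \<longleftrightarrow> poly (ramify_poly n h) (ramify n \<phi>) = 0"
    using d by (simp add: rm_eq_0_iff)
  finally show ?thesis by (simp add: NP_roots_def)
qed

lemma order_eqI:
  fixes a :: "'a :: idom"
  assumes "P = [:- a, 1:] ^ k * Q" "poly Q a \<noteq> 0"
  shows "order a P = k"
proof -
  have "Q \<noteq> 0" using assms by auto
  then have "order a P = order a ([:- a, 1:] ^ k) + order a Q"
    unfolding assms(1) by (intro order_mult) auto
  then show ?thesis using assms(2) by (simp add: order_power_n_n order_0I)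
qed

lemma order_decomp':
  fixes a :: "'a :: idom"
  assumes "P \<noteq> 0"
  obtains Q where "P = [:- a, 1:] ^ order a P * Q" "poly Q a \<noteq> 0"
  using order_decomp[OF assms] by (metis poly_eq_0_iff_dvd)

lemma order_rmP:
  assumes "n > 0" "P \<noteq> 0"
  shows "order (rm n a) (rmP n P) = order a P"
proof -
  interpret ring_morph "rm n" using assms by (intro ring_morph_rm)
  from order_decomp'[OF assms(2), of a] obtain Q where
    Q: "P = [:- a, 1:] ^ order a P * Q" "poly Q a \<noteq> 0" by blast
  have "rmP n P = [:- rm n a, 1:] ^ order a P * rmP n Q"
    by (subst Q(1)) (simp add: map_mult map_power minus)
  moreover have "poly (rmP n Q) (rm n a) \<noteq> 0" using Q(2) assms by (simp add: poly_map rm_eq_0_iff)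
  ultimately show ?thesis by (rule order_eqI)
qed

lemma NP_mult_eq:
  assumes "has_denom n \<phi>" "h \<noteq> 0"
  shows "NP_mult h \<phi> = order (ramify n \<phi>) (ramify_poly n h)"
proof -
  let ?d = "denom \<phi>"
  have d: "has_denom ?d \<phi>" "?d > 0" "n > 0"
    using assms has_denom_denom denom_pos by (auto simp: has_denom_def)
  have "order (rm n (ramify ?d \<phi>)) (rmP n (ramify_poly ?d h)) =
        order (rm ?d (ramify n \<phi>)) (rmP ?d (ramify_poly n h))"
    using d assms(1) by (simp only: ramify_mult[symmetric] ramify_poly_mult[symmetric] mult.commute)
  then show ?thesis using d assms by (simp add: order_rmP ramify_poly_nonzero NP_mult_def)
qed

text \<open>By \<open>y\<close>-regularity the term \<open>y\<^sup>m\<close> would dominate along a root of order less than one.\<close>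

lemma root_order_ge_1:
  assumes h: "regular m h" and n: "n > 0" and r: "poly (ramify_poly n h) \<phi> = 0" and z: "\<phi> $ 0 = 0"
    and kn: "k < n"
  shows "\<phi> $ k = 0"
proof (cases "\<phi> = 0")
  case False
  let ?P = "ramify_poly n h"
  define l where "l = subdegree \<phi>"
  define \<psi> where "\<psi> = fps_shift l \<phi>"
  have \<phi>: "\<phi> = fps_X ^ l * \<psi>" "\<psi> $ 0 \<noteq> 0" "l > 0"
    using subdegree_decompose[of \<phi>] False z
    by (auto simp: l_def \<psi>_def mult.commute subdegree_eq_0_iff intro: gr0I)
  have \<phi>j: "\<phi> ^ j = fps_X ^ (l * j) * \<psi> ^ j" for j
    by (simp only: \<phi>(1) power_mult_distrib power_mult)
  have coP: "coeff ?P j = rm n (coeff (emb h) j)" for j using n by (simp add: ramify_poly_eq coeff_map_poly)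
  have "n \<le> l"
  proof (rule ccontr)
    assume "\<not> n \<le> l"
    then have ln: "l < n" by simp
    \<comment> \<open>At t^(l m), terms with j > m start only at t^(l j), and those with j < m are
      divisible by t^(n (m - j) + l j), which is beyond t^(l m) because l < n. The term j = m alone
      remains and cannot cancel.\<close>
    have "(coeff ?P j * \<phi> ^ j) $ (l * m) = (if j = m then coeff (emb h) m $ 0 * (\<psi> $ 0) ^ m else 0)" for j
    proof (cases "j \<ge> m")
      case True
      have "(coeff ?P j * \<phi> ^ j) $ (l * m) = (fps_X ^ (l * j) * (rm n (coeff (emb h) j) * \<psi> ^ j)) $ (l * m)"
        by (simp only: \<phi>j coP mult_ac)
      then show ?thesis using True \<phi>(3) n by (auto simp: fps_X_power_mult_nth fps_nth_power_0)
    next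
      case False
      have "fps_X ^ (n * (m - j)) dvd coeff ?P j"
        unfolding X_power_dvd_iff coP
      proof safe
        fix i assume i: "i < n * (m - j)"
        then have "i div n < m - j" using n by (simp add: less_mult_imp_div_less mult.commute)
        then have "coeff (coeff h j) (i div n) = 0" using h by (simp add: regular_def)
        then show "rm n (coeff (emb h) j) $ i = 0" using n by (simp add: rm_nth coeff_emb)
      qed
      then obtain w where w: "coeff ?P j = fps_X ^ (n * (m - j)) * w" by (auto elim: dvdE)
      have "(coeff ?P j * \<phi> ^ j) $ (l * m) = (fps_X ^ (n * (m - j) + l * j) * (w * \<psi> ^ j)) $ (l * m)"
        by (simp only: \<phi>j w power_add mult_ac)
      moreover have "l * m < n * (m - j) + l * j"
      proof -
        have "l * m = l * (m - j) + l * j" using False by (simp add: distrib_left[symmetric])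
        also have "\<dots> < n * (m - j) + l * j" using ln False by simp
        finally show ?thesis .
      qed
      ultimately show ?thesis using False by (simp add: fps_X_power_mult_nth)
    qed
    then have "poly ?P \<phi> $ (l * m) =
        (\<Sum>j\<le>degree ?P. if j = m then coeff (emb h) m $ 0 * (\<psi> $ 0) ^ m else 0)"
      by (simp add: poly_altdef fps_sum_nth)
    moreover have c: "coeff (emb h) m $ 0 \<noteq> 0" using h by (simp add: coeff_emb regular_def)
    moreover have "m \<le> degree ?P"
    proof (rule le_degree)
      have "coeff ?P m $ 0 \<noteq> 0" using c n by (simp add: coP)
      then show "coeff ?P m \<noteq> 0" by auto
    qed
    ultimately show False using r \<phi>(2) by (simp add: sum.delta')
  qed
  with kn show ?thesis by (intro nth_less_subdegree_zero) (simp add: l_def)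
qed simp

lemma prod_list_count: "prod_list (map f xs) = (\<Prod>x\<in>set xs. f x ^ count_list xs x)"
  for f :: "'a \<Rightarrow> 'b :: comm_monoid_mult"
proof (induction xs)
  case (Cons a xs)
  show ?case
  proof (cases "a \<in> set xs")
    case True
    have "(\<Prod>x\<in>set (a # xs). f x ^ count_list (a # xs) x) =
        (\<Prod>x\<in>set xs. f x ^ count_list xs x * (if x = a then f a else 1))"
      using True by (intro prod.cong) (auto simp: mult.commute)
    then show ?thesis using True by (simp add: prod.distrib Cons mult.commute)
  next
    case False
    then have "(\<Prod>x\<in>set xs. f x ^ count_list (a # xs) x) = (\<Prod>x\<in>set xs. f x ^ count_list xs x)"
      by (intro prod.cong) auto
    with False show ?thesis by (simp add: Cons count_list_0_iff)
  qed
qed simp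

lemma order_prod_list_linear:
  "order a (prod_list (map (\<lambda>\<phi>. [:- \<phi>, 1:]) xs)) = count_list xs a \<and>
   prod_list (map (\<lambda>\<phi>. [:- \<phi>, 1:]) xs) \<noteq> 0" for a :: "'a :: idom"
proof (induction xs)
  case (Cons b xs)
  have "order a [:- b, 1:] = (if b = a then 1 else 0)"
    using order_power_n_n[of a 1] by (auto intro!: order_0I)
  with Cons show ?case
    by (simp add: order_mult del: mult_pCons_left mult_pCons_right)
qed simp

lemma poly_unit_nonzero:
  assumes "coeff u 0 $ 0 \<noteq> 0" "\<phi> $ 0 = 0"
  shows "poly u \<phi> $ 0 \<noteq> (0 :: complex)"
proof -
  have "poly u \<phi> $ 0 = poly (red u) (\<phi> $ 0)" by (simp add: nth_0.poly_map)
  also have "\<dots> = coeff u 0 $ 0" by (simp add: assms(2) poly_0_coeff_0)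
  finally show ?thesis using assms(1) by simp
qed

text \<open>The factorization over a single n captures all roots: a root with another denominator d
  is a zero of the product pulled back to n * d, hence one of the listed series. So n is a common
  denominator of all roots.\<close>

theorem newton_puiseux:
  assumes h: "regular m h"
  obtains n u where "n > 0" "finite (NP_roots h)" "\<And>\<phi>. \<phi> \<in> NP_roots h \<Longrightarrow> has_denom n \<phi>"
    "conv_poly u" "coeff u 0 $ 0 \<noteq> 0"
    "ramify_poly n h = u * (\<Prod>\<phi>\<in>NP_roots h. [:- ramify n \<phi>, 1:] ^ NP_mult h \<phi>)"
proof -
  from puiseux_factorization[OF conv_poly_emb y_order_emb[OF h]] obtain n \<phi>s u where
    n: "n > 0" and u: "conv_poly u" "coeff u 0 $ 0 \<noteq> 0" and \<phi>s: "\<forall>\<phi>\<in>set \<phi>s. conv \<phi> \<and> \<phi> $ 0 = 0"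
    and fact: "rmP n (emb h) = u * prod_list (map (\<lambda>\<phi>. [:- \<phi>, 1:]) \<phi>s)" by blast
  then have fact: "ramify_poly n h = u * prod_list (map (\<lambda>\<phi>. [:- \<phi>, 1:]) \<phi>s)"
    by (simp add: ramify_poly_eq)
  have "u \<noteq> 0" using u by auto
  \<comment> \<open>Stated over every multiple n * e, since a competing root need not have
    denominator n.\<close>
  have root_iff: "poly (ramify_poly k h) \<psi> = 0 \<longleftrightarrow> \<psi> \<in> rm e ` set \<phi>s"
    if "\<psi> $ 0 = 0" "k = n * e" "e > 0" for k e \<psi>
  proof -
    interpret ring_morph "rm e" using that by (intro ring_morph_rm)
    have "rmP e (prod_list (map (\<lambda>\<phi>. [:- \<phi>, 1:]) xs)) = prod_list (map (\<lambda>\<phi>. [:- rm e \<phi>, 1:]) xs)" for xs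
      by (induction xs) (simp_all add: map_mult minus del: mult_pCons_left mult_pCons_right)
    then have "ramify_poly k h = rmP e u * prod_list (map (\<lambda>\<phi>. [:- rm e \<phi>, 1:]) \<phi>s)"
      using that n fact by (simp add: ramify_poly_mult map_mult)
    moreover have "poly (rmP e u) \<psi> \<noteq> 0"
      using poly_unit_nonzero[of "rmP e u" \<psi>] u that by auto
    moreover have "poly (prod_list (map (\<lambda>\<phi>. [:- rm e \<phi>, 1:]) xs)) \<psi> = 0 \<longleftrightarrow> \<psi> \<in> rm e ` set xs" for xs
      by (induction xs) (auto simp del: mult_pCons_left mult_pCons_right)
    ultimately show ?thesis by simp
  qed
  have roots: "NP_roots h = unramify n ` set \<phi>s"
  proof (intro subset_antisym subsetI)
    fix \<phi> assume \<phi>: "\<phi> \<in> NP_roots h"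
    then have p: "puiseux \<phi>" by (simp add: NP_roots_def)
    let ?d = "denom \<phi>"
    note d = puiseuxD[OF p]
    have N: "has_denom (n * ?d) \<phi>" using has_denom_mult[OF d(1) n] by (simp add: mult.commute)
    then have "poly (ramify_poly (n * ?d) h) (ramify (n * ?d) \<phi>) = 0"
      using \<phi> NP_roots_iff by blast
    then obtain \<psi> where \<psi>: "\<psi> \<in> set \<phi>s" "ramify (n * ?d) \<phi> = rm ?d \<psi>"
      using root_iff[of "ramify (n * ?d) \<phi>" "n * ?d" ?d] d n p by (auto simp: puiseux_ramify_0)
    have "\<phi> = unramify n \<psi>"
    proof (rule frac_series_eqI[OF N])
      show "has_denom (n * ?d) (unramify n \<psi>)" using n d by (intro has_denom_mult has_denom_unramify)
      show "ramify (n * ?d) \<phi> = ramify (n * ?d) (unramify n \<psi>)"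
        using n d by (simp add: \<psi>(2) ramify_mult has_denom_unramify ramify_unramify)
    qed (use d unramify_nonneg in auto)
    with \<psi> show "\<phi> \<in> unramify n ` set \<phi>s" by blast
  next
    fix \<phi> assume "\<phi> \<in> unramify n ` set \<phi>s"
    then obtain \<psi> where \<psi>: "\<phi> = unramify n \<psi>" "\<psi> \<in> set \<phi>s" by blast
    then have z: "poly (ramify_poly n h) \<psi> = 0" using root_iff[of \<psi> n 1] \<phi>s by auto
    \<comment> \<open>The requirement that exponents are at least 1 is where y-regularity
      enters.\<close>
    have "puiseux \<phi>"
      unfolding \<psi>(1) using root_order_ge_1[OF h n z] \<phi>s \<psi>(2) n by (intro puiseux_unramify) auto
    with z show "\<phi> \<in> NP_roots h"
      using NP_roots_iff[OF has_denom_unramify[OF n]] n by (simp add: \<psi>(1) ramify_unramify)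
  qed
  have dn: "has_denom n \<phi>" if "\<phi> \<in> NP_roots h" for \<phi>
    using that n by (auto simp: roots has_denom_unramify)
  have mult: "NP_mult h (unramify n \<psi>) = count_list \<phi>s \<psi>" if "\<psi> \<in> set \<phi>s" for \<psi>
  proof -
    have "poly u \<psi> \<noteq> 0" using poly_unit_nonzero[OF u(2), of \<psi>] \<phi>s that by auto
    then have "order \<psi> u = 0" by (rule order_0I)
    then show ?thesis
      using NP_mult_eq[OF has_denom_unramify[OF n] regular_nonzero[OF h]] n \<open>u \<noteq> 0\<close>
        order_prod_list_linear[of \<psi> \<phi>s]
      by (simp add: ramify_unramify fact order_mult)
  qed
  have "inj_on (unramify n) (set \<phi>s)"
    by (rule inj_on_inverseI[of _ "ramify n"]) (simp add: ramify_unramify n)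
  then have "(\<Prod>\<phi>\<in>NP_roots h. [:- ramify n \<phi>, 1:] ^ NP_mult h \<phi>) =
      (\<Prod>\<psi>\<in>set \<phi>s. [:- \<psi>, 1:] ^ count_list \<phi>s \<psi>)"
    unfolding roots using n by (simp add: prod.reindex mult ramify_unramify)
  also have "\<dots> = prod_list (map (\<lambda>\<phi>. [:- \<phi>, 1:]) \<phi>s)"
    by (rule prod_list_count[symmetric])
  finally have "ramify_poly n h = u * (\<Prod>\<phi>\<in>NP_roots h. [:- ramify n \<phi>, 1:] ^ NP_mult h \<phi>)"
    by (simp add: fact)
  moreover have "finite (NP_roots h)" by (simp add: roots)
  ultimately show ?thesis using that n dn u by blast
qed

section \<open>Orders of series and the sums of condition (iii)\<close>

lemma ord_series_eq:
  assumes "has_denom n \<phi>" "\<And>q. \<phi> q \<noteq> 0 \<Longrightarrow> q \<ge> 0" "ramify n \<phi> \<noteq> 0"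
  shows "ord_series \<phi> = ereal (real (subdegree (ramify n \<phi>)) / real n)"
proof -
  let ?k = "subdegree (ramify n \<phi>)"
  have nz: "\<phi> (of_nat ?k / of_nat n) \<noteq> 0"
    using nth_subdegree_nonzero[OF assms(3)] by (simp add: ramify_def)
  have "(LEAST q. \<phi> q \<noteq> 0) = of_nat ?k / of_nat n"
  proof (rule Least_equality)
    fix q assume q: "\<phi> q \<noteq> 0"
    from has_denomE[OF assms(1) q assms(2)[OF q]] obtain k where
      k: "q = of_nat k / of_nat n" "ramify n \<phi> $ k \<noteq> 0" by blast
    then have "?k \<le> k" by (intro subdegree_leI)
    then show "of_nat ?k / of_nat n \<le> q" by (simp add: k divide_right_mono)
  qed (rule nz)
  moreover have "\<not> (\<forall>q. \<phi> q = 0)" using nz by blast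
  ultimately show ?thesis by (simp add: ord_series_def of_rat_divide)
qed

lemma ord_series_subst:
  assumes "puiseux \<gamma>" "\<gamma> \<notin> NP_roots h"
  shows "ord_series (subst h \<gamma>) =
    ereal (real (subdegree (poly (ramify_poly (denom \<gamma>) h) (ramify (denom \<gamma>) \<gamma>))) / real (denom \<gamma>))"
proof -
  note d = puiseuxD[OF assms(1)]
  show ?thesis using d assms NP_roots_iff[OF d(1), of h]
    unfolding subst_def
    by (subst ord_series_eq[OF has_denom_unramify]) (auto simp: ramify_unramify dest: unramify_nonneg)
qed

lemma ramify_series_diff: "ramify n (series_diff \<phi> \<psi>) = ramify n \<phi> - ramify n \<psi>"
  by (simp add: ramify_def series_diff_def fps_eq_iff)

lemma ord_series_diff:
  assumes "puiseux \<phi>" "puiseux \<psi>" "has_denom n \<phi>" "has_denom n \<psi>" "\<phi> \<noteq> \<psi>"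
  shows "ord_series (series_diff \<phi> \<psi>) = ereal (real (subdegree (ramify n \<phi> - ramify n \<psi>)) / real n)"
    and "ramify n \<phi> \<noteq> ramify n \<psi>"
proof -
  show ne: "ramify n \<phi> \<noteq> ramify n \<psi>"
    using frac_series_eqI[OF assms(3,4) puiseuxD(3)[OF assms(1)] puiseuxD(3)[OF assms(2)]] assms(5) by blast
  have "has_denom n (series_diff \<phi> \<psi>)"
    using assms(3,4) unfolding has_denom_def series_diff_def by (metis diff_zero)
  moreover have "q \<ge> 0" if "series_diff \<phi> \<psi> q \<noteq> 0" for q
    using that puiseuxD(3)[OF assms(1)] puiseuxD(3)[OF assms(2)]
    unfolding series_diff_def by (metis diff_zero)
  ultimately show "ord_series (series_diff \<phi> \<psi>) = ereal (real (subdegree (ramify n \<phi> - ramify n \<psi>)) / real n)"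
    using ord_series_eq[of n "series_diff \<phi> \<psi>"] ne by (simp add: ramify_series_diff)
qed

lemma subdegree_prod_power:
  "finite A \<Longrightarrow> (\<And>x. x \<in> A \<Longrightarrow> F x \<noteq> 0) \<Longrightarrow>
    subdegree (\<Prod>x\<in>A. F x ^ k x) = (\<Sum>x\<in>A. k x * subdegree (F x))"
  for F :: "'a \<Rightarrow> complex fps"
  by (induction A rule: finite_induct) auto

text \<open>Over a common denominator, cancellation identifies Q with a unit times the linear
  factors of the other roots. At \<open>\<gamma>\<close> these become the differences of
  \<open>\<gamma>\<close> and \<open>\<phi>\<close>, and the subdegree of their product is the
  weighted sum of orders.\<close>

lemma mult_sum_eq:
  assumes h: "regular m h" and \<gamma>: "\<gamma> \<in> NP_roots h" and N: "has_denom N \<gamma>"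
    and Q: "ramify_poly N h = [:- ramify N \<gamma>, 1:] ^ a * Q" "poly Q (ramify N \<gamma>) \<noteq> 0"
  shows "a = NP_mult h \<gamma>"
    and "(\<Sum>\<phi> \<in> NP_roots h - {\<gamma>}. ereal (real (NP_mult h \<phi>)) * ord_series (series_diff \<gamma> \<phi>)) =
      ereal (real (subdegree (poly Q (ramify N \<gamma>))) / real N)"
proof -
  show a: "a = NP_mult h \<gamma>"
    using NP_mult_eq[OF N regular_nonzero[OF h]] order_eqI[OF Q] by simp
  from newton_puiseux[OF h] obtain n u where n: "n > 0" and fin: "finite (NP_roots h)"
    and den: "\<And>\<phi>. \<phi> \<in> NP_roots h \<Longrightarrow> has_denom n \<phi>" and u: "conv_poly u" "coeff u 0 $ 0 \<noteq> 0"
    and fact: "ramify_poly n h = u * (\<Prod>\<phi>\<in>NP_roots h. [:- ramify n \<phi>, 1:] ^ NP_mult h \<phi>)" by blast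
  have N0: "N > 0" using N by (simp add: has_denom_def)
  let ?M = "n * N"
  interpret rN: ring_morph "rm N" using N0 by (rule ring_morph_rm)
  interpret rn: ring_morph "rm n" using n by (rule ring_morph_rm)
  have den': "has_denom ?M \<phi>" if "\<phi> \<in> NP_roots h" for \<phi> using den[OF that] N0 by (rule has_denom_mult)
  have pui: "puiseux \<phi>" if "\<phi> \<in> NP_roots h" for \<phi> using that by (simp add: NP_roots_def)
  let ?\<Gamma> = "ramify ?M \<gamma>" and ?L = "\<lambda>\<phi>. [:- ramify ?M \<phi>, 1:]"
  define Q' where "Q' = rmP N u * (\<Prod>\<phi>\<in>NP_roots h - {\<gamma>}. ?L \<phi> ^ NP_mult h \<phi>)"
  have "ramify_poly ?M h = rmP N u * (\<Prod>\<phi>\<in>NP_roots h. ?L \<phi> ^ NP_mult h \<phi>)"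
    using n N0 by (simp add: ramify_poly_mult fact rN.map_mult rN.map_prod rN.map_power rN.minus
        ramify_mult[OF den N0])
  also have "(\<Prod>\<phi>\<in>NP_roots h. ?L \<phi> ^ NP_mult h \<phi>) =
      ?L \<gamma> ^ NP_mult h \<gamma> * (\<Prod>\<phi>\<in>NP_roots h - {\<gamma>}. ?L \<phi> ^ NP_mult h \<phi>)"
    by (rule prod.remove[OF fin \<gamma>])
  finally have "ramify_poly ?M h = ?L \<gamma> ^ a * Q'" by (simp only: Q'_def a mult_ac)
  moreover have "ramify_poly ?M h = ?L \<gamma> ^ a * rmP n Q"
    using ramify_poly_mult[OF N0 n, of h] ramify_mult[OF N n] Q(1)
    by (simp add: rn.map_mult rn.map_power rn.minus mult.commute)
  ultimately have "?L \<gamma> ^ a * rmP n Q = ?L \<gamma> ^ a * Q'" by simp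
  then have eq: "rmP n Q = Q'" by (subst (asm) mult_left_cancel) simp_all
  have "poly Q' ?\<Gamma> = rm n (poly Q (ramify N \<gamma>))"
    using ramify_mult[OF N n] rn.poly_map[of Q "ramify N \<gamma>"] by (simp add: eq mult.commute)
  then have "n * subdegree (poly Q (ramify N \<gamma>)) = subdegree (poly Q' ?\<Gamma>)"
    using n by (simp add: subdegree_rm)
  also have "poly Q' ?\<Gamma> = poly (rmP N u) ?\<Gamma> * (\<Prod>\<phi>\<in>NP_roots h - {\<gamma>}. (?\<Gamma> - ramify ?M \<phi>) ^ NP_mult h \<phi>)"
    by (simp add: Q'_def poly_prod)
  also have "subdegree \<dots> = (\<Sum>\<phi>\<in>NP_roots h - {\<gamma>}. NP_mult h \<phi> * subdegree (?\<Gamma> - ramify ?M \<phi>))"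
  proof -
    have nz: "?\<Gamma> - ramify ?M \<phi> \<noteq> 0" if "\<phi> \<in> NP_roots h - {\<gamma>}" for \<phi>
      using ord_series_diff(2)[of \<gamma> \<phi> ?M] that \<gamma> pui den' by auto
    have "poly (rmP N u) ?\<Gamma> $ 0 \<noteq> 0"
      using u N0 n pui[OF \<gamma>] by (intro poly_unit_nonzero) (auto simp: puiseux_ramify_0)
    then have "poly (rmP N u) ?\<Gamma> \<noteq> 0" "subdegree (poly (rmP N u) ?\<Gamma>) = 0" by auto
    moreover have "(\<Prod>\<phi>\<in>NP_roots h - {\<gamma>}. (?\<Gamma> - ramify ?M \<phi>) ^ NP_mult h \<phi>) \<noteq> 0"
      using nz fin by simp
    moreover have "subdegree (\<Prod>\<phi>\<in>NP_roots h - {\<gamma>}. (?\<Gamma> - ramify ?M \<phi>) ^ NP_mult h \<phi>) =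
        (\<Sum>\<phi>\<in>NP_roots h - {\<gamma>}. NP_mult h \<phi> * subdegree (?\<Gamma> - ramify ?M \<phi>))"
      using nz fin by (intro subdegree_prod_power) auto
    ultimately show ?thesis by (simp add: subdegree_mult)
  qed
  finally have sub: "n * subdegree (poly Q (ramify N \<gamma>)) =
    (\<Sum>\<phi>\<in>NP_roots h - {\<gamma>}. NP_mult h \<phi> * subdegree (?\<Gamma> - ramify ?M \<phi>))" .
  have "(\<Sum>\<phi> \<in> NP_roots h - {\<gamma>}. ereal (real (NP_mult h \<phi>)) * ord_series (series_diff \<gamma> \<phi>)) =
      (\<Sum>\<phi> \<in> NP_roots h - {\<gamma>}. ereal (real (NP_mult h \<phi> * subdegree (?\<Gamma> - ramify ?M \<phi>)) / real ?M))"
    using ord_series_diff(1)[of \<gamma> _ ?M] \<gamma> pui den' by (intro sum.cong refl) auto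
  also have "\<dots> = ereal (real (n * subdegree (poly Q (ramify N \<gamma>))) / real ?M)"
    unfolding sub by (simp only: sum_ereal sum_divide_distrib of_nat_sum)
  finally show "(\<Sum>\<phi> \<in> NP_roots h - {\<gamma>}. ereal (real (NP_mult h \<phi>)) * ord_series (series_diff \<gamma> \<phi>)) =
      ereal (real (subdegree (poly Q (ramify N \<gamma>))) / real N)" using n by simp
qed

section \<open>Evaluation along real half-branches\<close>

lemma conv_eventually:
  assumes "conv F"
  shows "\<forall>\<^sub>F t in nhds (0 :: complex). ereal (norm t) < fps_conv_radius F"
proof -
  have "\<forall>\<^sub>F t in nhds 0. t \<in> eball (0 :: complex) (fps_conv_radius F)"
    using assms by (intro eventually_nhds_in_open) (auto simp: conv_def zero_ereal_def)
  then show ?thesis by (simp add: dist_norm)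
qed

lemma eval_fps_add_eventually:
  assumes "conv F" "conv G"
  shows "\<forall>\<^sub>F t in nhds 0. eval_fps (F + G) t = eval_fps F t + eval_fps G t"
  using conv_eventually[OF assms(1)] conv_eventually[OF assms(2)]
  by eventually_elim (rule eval_fps_add)

lemma eval_fps_mult_eventually:
  assumes "conv F" "conv G"
  shows "\<forall>\<^sub>F t in nhds 0. eval_fps (F * G) t = eval_fps F t * eval_fps G t"
  using conv_eventually[OF assms(1)] conv_eventually[OF assms(2)]
  by eventually_elim (rule eval_fps_mult)

lemma eval_fps_minus_eventually:
  assumes "conv F"
  shows "\<forall>\<^sub>F t in nhds 0. eval_fps (- F) t = - eval_fps F t"
  using conv_eventually[OF assms(1)] by eventually_elim (rule eval_fps_minus)

lemma isCont_eval_fps_eventually: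
  assumes "conv F"
  shows "\<forall>\<^sub>F t in nhds 0. isCont (eval_fps F) t"
  using conv_eventually[OF assms(1)] by eventually_elim (rule continuous_eval_fps)

lemma tendsto_eval_fps: "conv F \<Longrightarrow> (eval_fps F \<longlongrightarrow> F $ 0) (nhds 0)"
  using continuous_eval_fps[of 0 F UNIV] tendsto_at_iff_tendsto_nhds[of "eval_fps F" 0]
  by (simp add: conv_def isCont_def eval_fps_at_0 zero_ereal_def)

lemma eval_fps_rm: "n > 0 \<Longrightarrow> eval_fps (rm n F) t = eval_fps F (t ^ n)"
proof -
  assume n: "n > 0"
  have "(\<Sum>k. rm n F $ (n * k) * t ^ (n * k)) = (\<Sum>k. rm n F $ k * t ^ k)"
    using n by (intro suminf_mono_reindex) (auto simp: strict_mono_def rm_nth)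
  then show ?thesis using n by (simp add: eval_fps_def rm_nth power_mult)
qed

text \<open>Real series are those fixed by this conjugation; comparing a series with its conjugate
  decides whether its values at small t > 0 are real.\<close>

definition cnj_fps :: "complex fps \<Rightarrow> complex fps" where
  "cnj_fps F = Abs_fps (\<lambda>k. cnj (F $ k))"

lemma conv_cnj_fps: "conv F \<Longrightarrow> conv (cnj_fps F)"
  using conv_boundedD[of F] conv_bounded[of _ "cnj_fps F"] by (metis cnj_fps_def complex_mod_cnj fps_nth_Abs_fps)

lemma eval_cnj_fps:
  assumes "conv F"
  shows "\<forall>\<^sub>F t in nhds 0. eval_fps (cnj_fps F) t = cnj (eval_fps F (cnj t))"
  using conv_eventually[OF assms(1)]
proof eventually_elim
  case (elim t)
  then have "(\<lambda>n. F $ n * cnj t ^ n) sums eval_fps F (cnj t)"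
    by (intro sums_eval_fps) simp
  then have "(\<lambda>n. cnj (F $ n * cnj t ^ n)) sums cnj (eval_fps F (cnj t))"
    by (simp only: sums_cnj)
  then have "(\<lambda>n. cnj_fps F $ n * t ^ n) sums cnj (eval_fps F (cnj t))"
    by (simp add: cnj_fps_def)
  then show ?case by (simp add: eval_fps_def sums_iff)
qed

lemma eval_fps_factor:
  assumes "conv F"
  shows "\<forall>\<^sub>F t in nhds 0. eval_fps F t = t ^ subdegree F * eval_fps (fps_shift (subdegree F) F) t"
proof -
  have "conv (fps_shift (subdegree F) F)" using assms by simp
  from eval_fps_mult_eventually[OF conv_X_power[of "subdegree F"] this]
  have "\<forall>\<^sub>F t in nhds 0. eval_fps (fps_X ^ subdegree F * fps_shift (subdegree F) F) t =
    eval_fps (fps_X ^ subdegree F) t * eval_fps (fps_shift (subdegree F) F) t" .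
  moreover have "fps_X ^ subdegree F * fps_shift (subdegree F) F = F"
    using subdegree_decompose[of F] by (simp add: mult.commute)
  ultimately show ?thesis by simp
qed

section \<open>Growth of power series as t tends to 0 from the right\<close>

lemma eventually_of_real:
  assumes "\<forall>\<^sub>F t in nhds (0 :: complex). Q t"
  shows "\<forall>\<^sub>F t in at_right (0 :: real). Q (of_real t)"
proof -
  have "filterlim complex_of_real (nhds 0) (at_right 0)"
    by (intro tendsto_eq_intros) auto
  then show ?thesis using assms by (auto simp: filterlim_iff)
qed

lemma tendsto_eval_fps_real:
  "conv F \<Longrightarrow> ((\<lambda>t. eval_fps F (complex_of_real t)) \<longlongrightarrow> F $ 0) (at_right 0)"
  by (rule filterlim_compose[OF tendsto_eval_fps]) (auto intro!: tendsto_eq_intros)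

text \<open>Once its power of t is split off, the series tends to a nonzero lowest
  coefficient.\<close>

lemma eval_fps_nonzero:
  assumes F: "conv F" "F \<noteq> 0"
  shows "\<forall>\<^sub>F t in at_right 0. eval_fps F (complex_of_real t) \<noteq> 0"
proof -
  let ?F = "fps_shift (subdegree F) F"
  have "?F $ 0 \<noteq> 0" using F by simp
  moreover have "((\<lambda>t. eval_fps ?F (complex_of_real t)) \<longlongrightarrow> ?F $ 0) (at_right 0)"
    using F by (intro tendsto_eval_fps_real) simp
  ultimately have "\<forall>\<^sub>F t in at_right 0. eval_fps ?F (complex_of_real t) \<noteq> 0"
    by (intro tendsto_imp_eventually_ne)
  then show ?thesis
    using eventually_of_real[OF eval_fps_factor[OF F(1)]] eventually_at_right_less[of 0]
    by eventually_elim simp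
qed

text \<open>If the order of F did not exceed that of G, dividing by a power of t and letting t tend
  to 0 would bound the lowest coefficient of F by every positive multiple of that of G, hence by
  0.\<close>

lemma subdegree_less_if_small:
  assumes F: "conv F" "F \<noteq> 0" and G: "conv G" "G \<noteq> 0"
    and small: "\<And>\<epsilon>. \<epsilon> > 0 \<Longrightarrow> \<forall>\<^sub>F t in at_right 0.
      norm (eval_fps F (complex_of_real t)) \<le> \<epsilon> * norm (eval_fps G (complex_of_real t))"
  shows "subdegree G < subdegree F"
proof (rule ccontr)
  let ?F = "fps_shift (subdegree F) F" and ?G = "fps_shift (subdegree G) G"
  assume "\<not> subdegree G < subdegree F"
  then have le: "subdegree F \<le> subdegree G" by simp
  have bound: "norm (?F $ 0) \<le> \<epsilon> * norm (?G $ 0)" if e: "\<epsilon> > 0" for \<epsilon>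
  proof (rule tendsto_le[of "at_right (0 :: real)"])
    show "((\<lambda>t. norm (eval_fps ?F (complex_of_real t))) \<longlongrightarrow> norm (?F $ 0)) (at_right 0)"
      using F by (intro tendsto_norm tendsto_eval_fps_real) simp
    show "((\<lambda>t. \<epsilon> * norm (eval_fps ?G (complex_of_real t))) \<longlongrightarrow> \<epsilon> * norm (?G $ 0)) (at_right 0)"
      using G by (intro tendsto_mult_left tendsto_norm tendsto_eval_fps_real) simp
    \<comment> \<open>Below 1 the higher power of t is the smaller one.\<close>
    have "\<forall>\<^sub>F t in at_right (0 :: real). t < 1"
      by (auto simp: eventually_at_right_field intro!: exI[of _ 1])
    then show "\<forall>\<^sub>F t in at_right 0. norm (eval_fps ?F (complex_of_real t)) \<le> \<epsilon> * norm (eval_fps ?G (complex_of_real t))"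
      using eventually_of_real[OF eval_fps_factor[OF F(1)]] eventually_of_real[OF eval_fps_factor[OF G(1)]]
        small[OF e] eventually_at_right_less[of 0]
    proof eventually_elim
      case (elim t)
      let ?a = "norm (eval_fps ?F (complex_of_real t))" and ?b = "norm (eval_fps ?G (complex_of_real t))"
      have "t ^ subdegree F * ?a \<le> \<epsilon> * (t ^ subdegree G * ?b)"
        using elim by (simp add: norm_mult norm_power)
      also have "\<dots> \<le> \<epsilon> * (t ^ subdegree F * ?b)"
        using elim le e by (intro mult_left_mono mult_right_mono power_decreasing) auto
      finally have "t ^ subdegree F * ?a \<le> t ^ subdegree F * (\<epsilon> * ?b)" by (simp add: mult_ac)
      then show ?case by (rule mult_left_le_imp_le) (use elim in auto)
    qed
  qed simp
  have "norm (?F $ 0) = 0"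
  proof (rule ccontr)
    assume nz: "norm (?F $ 0) \<noteq> 0"
    \<comment> \<open>The + 1 makes \<open>?\<epsilon>\<close> times the lowest coefficient of G
      fall strictly short of that of F.\<close>
    let ?\<epsilon> = "norm (?F $ 0) / (norm (?G $ 0) + 1)"
    have pos: "norm (?F $ 0) > 0" "norm (?G $ 0) + 1 > 0" using nz by (auto simp: add_nonneg_pos)
    then have "norm (?F $ 0) \<le> ?\<epsilon> * norm (?G $ 0)" by (intro bound) (rule divide_pos_pos)
    then have "norm (?F $ 0) * (norm (?G $ 0) + 1) \<le> norm (?F $ 0) * norm (?G $ 0)"
      using pos by (simp add: field_simps)
    then show False using pos by (simp add: distrib_left)
  qed
  then show False using F by simp
qed

lemma small_if_subdegree_less:
  assumes F: "conv F" and G: "conv G" "G \<noteq> 0" and lt: "subdegree G < subdegree F" and e: "\<epsilon> > 0"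
  shows "\<forall>\<^sub>F t in at_right 0.
      norm (eval_fps F (complex_of_real t)) < \<epsilon> * norm (eval_fps G (complex_of_real t))"
proof -
  let ?F = "fps_shift (subdegree F) F" and ?G = "fps_shift (subdegree G) G"
  let ?d = "subdegree F - subdegree G"
  let ?D = "\<lambda>t. \<epsilon> * norm (eval_fps ?G (complex_of_real t)) - norm (complex_of_real t ^ ?d * eval_fps ?F (complex_of_real t))"
  have "(?D \<longlongrightarrow> \<epsilon> * norm (?G $ 0) - norm (of_real 0 ^ ?d * ?F $ 0)) (at_right 0)"
    using F G by (intro tendsto_intros tendsto_eval_fps_real) auto
  \<comment> \<open>The exponent is positive, so F disappears in the limit and only G
    remains.\<close>
  moreover have "(0 :: complex) ^ ?d = 0" using lt by (simp add: power_0_left)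
  ultimately have "(?D \<longlongrightarrow> \<epsilon> * norm (?G $ 0)) (at_right 0)"
    by (simp only: of_real_0 mult_zero_left norm_zero diff_zero)
  moreover have "\<epsilon> * norm (?G $ 0) > 0" using e G by simp
  ultimately have "\<forall>\<^sub>F t in at_right 0. ?D t > 0" by (rule order_tendstoD(1))
  then show ?thesis
    using eventually_of_real[OF eval_fps_factor[OF F(1)]] eventually_of_real[OF eval_fps_factor[OF G(1)]]
      eventually_at_right_less[of 0]
  proof eventually_elim
    case (elim t)
    let ?a = "norm (eval_fps ?F (complex_of_real t))" and ?b = "norm (eval_fps ?G (complex_of_real t))"
    have "norm (eval_fps F (complex_of_real t)) = t ^ subdegree F * ?a"
      using elim(2,4) by (simp add: norm_mult norm_power)
    also have "\<dots> = t ^ subdegree G * (t ^ ?d * ?a)"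
      using lt by (simp add: power_add[symmetric] mult.assoc[symmetric])
    also have "\<dots> < t ^ subdegree G * (\<epsilon> * ?b)"
      using elim(1,4) by (intro mult_strict_left_mono) (auto simp: norm_mult norm_power)
    also have "\<dots> = \<epsilon> * norm (eval_fps G (complex_of_real t))"
      using elim(3,4) by (simp add: norm_mult norm_power)
    finally show ?case .
  qed
qed

section \<open>Evaluation of polynomials in y over convergent series\<close>

definition ev :: "complex fps poly \<Rightarrow> complex \<Rightarrow> complex \<Rightarrow> complex" where
  "ev P t y = poly (map_poly (\<lambda>c. eval_fps c t) P) y"

lemma ev_0 [simp]: "ev 0 t y = 0"
  by (simp add: ev_def)

lemma ev_pCons [simp]: "ev (pCons a P) t y = eval_fps a t + y * ev P t y"
  by (simp add: ev_def map_poly_pCons)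

text \<open>Only t has to be small, because P is a polynomial in y: the neighbourhood does not
  depend on y. The following rules for \<open>ev\<close> keep this uniformity.\<close>

lemma ev_add:
  "conv_poly P \<Longrightarrow> conv_poly Q \<Longrightarrow> \<forall>\<^sub>F t in nhds 0. \<forall>y. ev (P + Q) t y = ev P t y + ev Q t y"
proof (induction P Q rule: poly_induct2)
  case (pCons a P b Q)
  then have *: "conv_poly P" "conv_poly Q" "conv a" "conv b" by auto
  show ?case using pCons.IH[OF *(1,2)] eval_fps_add_eventually[OF *(3,4)]
    by eventually_elim (simp add: algebra_simps)
qed simp

lemma ev_smult:
  "conv a \<Longrightarrow> conv_poly P \<Longrightarrow> \<forall>\<^sub>F t in nhds 0. \<forall>y. ev (smult a P) t y = eval_fps a t * ev P t y"
proof (induction P)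
  case (pCons b P)
  then have *: "conv_poly P" "conv b" by auto
  show ?case using pCons.IH[OF pCons.prems(1) *(1)] eval_fps_mult_eventually[OF pCons.prems(1) *(2)]
    by eventually_elim (simp add: algebra_simps)
qed simp

lemma ev_mult:
  "conv_poly P \<Longrightarrow> conv_poly Q \<Longrightarrow> \<forall>\<^sub>F t in nhds 0. \<forall>y. ev (P * Q) t y = ev P t y * ev Q t y"
proof (induction P)
  case (pCons a P)
  then have *: "conv_poly P" "conv a" by auto
  have "conv_poly (smult a Q)" "conv_poly (pCons 0 (P * Q))"
    using * pCons.prems by (auto intro: conv_poly_smult conv_poly_mult)
  from ev_add[OF this] ev_smult[OF *(2) pCons.prems(2)] pCons.IH[OF *(1) pCons.prems(2)]
  show ?case by eventually_elim (simp add: algebra_simps)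
qed simp

lemma ev_1 [simp]: "ev 1 t y = 1"
  by (simp add: one_pCons)

lemma ev_power: "conv_poly P \<Longrightarrow> \<forall>\<^sub>F t in nhds 0. \<forall>y. ev (P ^ n) t y = ev P t y ^ n"
proof (induction n)
  case (Suc n)
  from Suc.IH[OF Suc.prems] ev_mult[OF Suc.prems conv_poly_power[OF Suc.prems], of n]
  show ?case by eventually_elim simp
qed simp

lemma ev_prod:
  "finite A \<Longrightarrow> (\<And>x. x \<in> A \<Longrightarrow> conv_poly (P x)) \<Longrightarrow>
    conv_poly (\<Prod>x\<in>A. P x) \<and> (\<forall>\<^sub>F t in nhds 0. \<forall>y. ev (\<Prod>x\<in>A. P x) t y = (\<Prod>x\<in>A. ev (P x) t y))"
proof (induction A rule: finite_induct)
  case (insert x A)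
  then have *: "conv_poly (P x)" "conv_poly (\<Prod>x\<in>A. P x)"
    "\<forall>\<^sub>F t in nhds 0. \<forall>y. ev (\<Prod>x\<in>A. P x) t y = (\<Prod>x\<in>A. ev (P x) t y)" by auto
  from *(3) ev_mult[OF *(1,2)]
  have "\<forall>\<^sub>F t in nhds 0. \<forall>y. ev (\<Prod>x\<in>insert x A. P x) t y = (\<Prod>x\<in>insert x A. ev (P x) t y)"
    by eventually_elim (simp add: insert.hyps)
  with * insert.hyps show ?case by (simp add: conv_poly_mult)
qed simp

lemma ev_linear_power:
  assumes "conv a"
  shows "\<forall>\<^sub>F t in nhds 0. \<forall>y. ev ([:- a, 1:] ^ n) t y = (y - eval_fps a t) ^ n"
proof -
  have "conv_poly [:- a, 1:]" using assms by simp
  from ev_power[OF this, of n] eval_fps_minus_eventually[OF assms] show ?thesis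
    by eventually_elim simp
qed

lemma ev_linear_power_mult:
  assumes "conv a" "conv_poly Q"
  shows "\<forall>\<^sub>F t in nhds 0. \<forall>y. ev ([:- a, 1:] ^ n * Q) t y = (y - eval_fps a t) ^ n * ev Q t y"
proof -
  have "conv_poly ([:- a, 1:] ^ n)" using assms by (intro conv_poly_power) simp
  from ev_mult[OF this assms(2)] ev_linear_power[OF assms(1), of n] show ?thesis
    by eventually_elim simp
qed

lemma eval_fps_poly:
  "conv_poly P \<Longrightarrow> conv \<phi> \<Longrightarrow> \<forall>\<^sub>F t in nhds 0. eval_fps (poly P \<phi>) t = ev P t (eval_fps \<phi> t)"
proof (induction P)
  case (pCons a P)
  then have *: "conv_poly P" "conv a" "conv (poly P \<phi>)" "conv (\<phi> * poly P \<phi>)"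
    by (auto intro: conv_poly_poly conv_mult)
  from eval_fps_add_eventually[OF *(2,4)] eval_fps_mult_eventually[OF pCons.prems(2) *(3)]
    pCons.IH[OF *(1) pCons.prems(2)]
  show ?case by eventually_elim simp
qed simp

lemma isCont_ev:
  "conv_poly P \<Longrightarrow> \<forall>\<^sub>F t in nhds 0. \<forall>y. isCont (\<lambda>z. ev P (fst z) (snd z)) (t, y)"
proof (induction P)
  case (pCons a P)
  then have *: "conv_poly P" "conv a" by auto
  from isCont_eval_fps_eventually[OF *(2)] pCons.IH[OF *(1)]
  show ?case
  proof eventually_elim
    case (elim t)
    have "isCont (\<lambda>z. eval_fps a (fst z)) (t, y)" for y :: complex
      using elim(1) by (intro isCont_o2[where f = fst and g = "eval_fps a"]) (auto intro: continuous_intros)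
    with elim show ?case unfolding ev_pCons by (auto intro!: continuous_intros)
  qed
qed simp

section \<open>Real polynomials along half-branches\<close>

lemma peval_pCons [simp]: "peval (pCons a h) x y = poly a x + y * peval h x y"
  by (simp add: peval_def)

lemma peval_0 [simp]: "peval 0 x y = 0"
  by (simp add: peval_def)

lemma peval_xscale: "peval (xscale s h) x y = peval h (s * x) y"
proof (induction h)
  case (pCons a h)
  have "xscale s (pCons a h) = pCons (pcompose a [:0, s:]) (xscale s h)"
    by (simp add: xscale_def map_poly_pCons)
  with pCons show ?case by (simp add: poly_pcompose mult.commute)
qed (simp add: xscale_def)

lemma poly_of_real: "poly (map_poly complex_of_real p) (of_real x) = of_real (poly p x)"
  by (induction p) (simp_all add: map_poly_pCons)

lemma ev_ramify_poly:
  "n > 0 \<Longrightarrow> ev (ramify_poly n h) (of_real t) (of_real y) = of_real (peval h (t ^ n) y)"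
proof (induction h)
  case (pCons a h)
  have "ramify_poly n (pCons a h) = pCons (fps_of_poly (pcompose (map_poly of_real a) (monom 1 n))) (ramify_poly n h)"
    by (simp add: ramify_poly_def map_poly_pCons)
  with pCons show ?case
    by (simp add: poly_pcompose poly_monom poly_of_real[symmetric])
qed (simp add: ramify_poly_def)

text \<open>\<open>Re\<close> only serves to obtain a real function: for a real series and small t >
  0 nothing is lost, by \<open>eval_real_series\<close>.\<close>

abbreviation branch_at :: "nat \<Rightarrow> frac_series \<Rightarrow> real \<Rightarrow> real" where
  "branch_at n \<gamma> t \<equiv> Re (eval_fps (ramify n \<gamma>) (of_real t))"

lemma puiseux_conv_ramify: "puiseux \<gamma> \<Longrightarrow> has_denom n \<gamma> \<Longrightarrow> conv (ramify n \<gamma>)"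
  by (simp add: puiseux_iff)

lemma eval_real_series:
  assumes "puiseux \<gamma>" "has_denom n \<gamma>" "real_series \<gamma>"
  shows "\<forall>\<^sub>F t in at_right 0. eval_fps (ramify n \<gamma>) (of_real t) = of_real (branch_at n \<gamma> t)"
proof -
  have "cnj_fps (ramify n \<gamma>) = ramify n \<gamma>"
    using assms(3) by (simp add: cnj_fps_def ramify_def real_series_def Reals_cnj_iff fps_eq_iff)
  with eventually_of_real[OF eval_cnj_fps[OF puiseux_conv_ramify[OF assms(1,2)]]]
  have "\<forall>\<^sub>F t in at_right 0. eval_fps (ramify n \<gamma>) (of_real t) = cnj (eval_fps (ramify n \<gamma>) (of_real t))"
    by simp
  then show ?thesis by eventually_elim (simp add: complex_eq_iff)
qed

text \<open>The difference between the series and its conjugate is nonzero, hence nonzero at all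
  small t > 0, whereas a real value would make it vanish there.\<close>

lemma eval_nonreal_series:
  assumes "puiseux \<gamma>" "has_denom n \<gamma>" "\<not> real_series \<gamma>"
  shows "\<forall>\<^sub>F t in at_right 0. \<forall>y. eval_fps (ramify n \<gamma>) (of_real t) \<noteq> complex_of_real y"
proof -
  let ?F = "ramify n \<gamma>"
  have F: "conv ?F" by (rule puiseux_conv_ramify[OF assms(1,2)])
  from assms(3) obtain q where q: "\<gamma> q \<notin> \<real>" by (auto simp: real_series_def)
  then have nz: "\<gamma> q \<noteq> 0" by auto
  then obtain k where "q = of_nat k / of_nat n"
    using has_denomE[OF assms(2) nz] puiseuxD(3)[OF assms(1)] by blast
  then have "cnj (?F $ k) \<noteq> ?F $ k" using q by (simp add: ramify_def Reals_cnj_iff)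
  then have "cnj_fps ?F - ?F \<noteq> 0" by (auto simp: cnj_fps_def fps_eq_iff)
  moreover have cd: "conv (- ?F)" "conv (cnj_fps ?F)" using F by (auto simp: conv_cnj_fps)
  ultimately have "\<forall>\<^sub>F t in at_right 0. eval_fps (cnj_fps ?F + - ?F) (complex_of_real t) \<noteq> 0"
    by (intro eval_fps_nonzero conv_add) auto
  then show ?thesis
    using eventually_of_real[OF eval_fps_add_eventually[OF cd(2,1)]]
      eventually_of_real[OF eval_fps_minus_eventually[OF F]] eventually_of_real[OF eval_cnj_fps[OF F]]
    by eventually_elim auto
qed

definition branch_val :: "frac_series \<Rightarrow> real \<Rightarrow> real" where
  "branch_val \<gamma> x = branch_at (denom \<gamma>) \<gamma> (root (denom \<gamma>) x)"

text \<open>The root of x of degree m * e, raised to the power e, is the root of degree m; so both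
  denominators give the value over their product.\<close>

lemma branch_val_eq:
  assumes "has_denom n \<gamma>" "x > 0"
  shows "branch_val \<gamma> x = branch_at n \<gamma> (root n x)"
proof -
  have step: "branch_at (m * e) \<gamma> (root (m * e) x) = branch_at m \<gamma> (root m x)"
    if "has_denom m \<gamma>" "e > 0" for m e
  proof -
    have "root (m * e) x = root e (root m x)" by (simp add: mult.commute real_root_mult_exp)
    moreover have "m > 0" using that by (simp add: has_denom_def)
    ultimately have "root (m * e) x ^ e = root m x"
      using that(2) assms(2) by (simp add: real_root_pow_pos2)
    then show ?thesis using that
      by (simp add: ramify_mult eval_fps_rm of_real_power[symmetric] del: of_real_power)
  qed
  have "denom \<gamma> > 0" "has_denom (denom \<gamma>) \<gamma>" "n > 0"
    using assms denom_pos has_denom_denom by (auto simp: has_denom_def)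
  then show ?thesis
    using step[of n "denom \<gamma>"] step[of "denom \<gamma>" n] assms(1) by (simp add: branch_val_def mult.commute)
qed

text \<open>Near the origin the unit does not vanish, so a zero with y real satisfies y =
  \<open>\<phi>\<close> for some root, and for small t > 0 a series that is not real takes no real
  value. There are finitely many roots, so one \<open>\<delta>\<close> serves all.\<close>

lemma real_zeros:
  assumes h: "regular m h"
  shows "\<exists>\<delta>>0. \<forall>x y. 0 < x \<longrightarrow> x < \<delta> \<longrightarrow> \<bar>y\<bar> < \<delta> \<longrightarrow> peval h x y = 0 \<longrightarrow>
    (\<exists>\<gamma>\<in>NP_roots h. real_series \<gamma> \<and> y = branch_val \<gamma> x)"
proof -
  from newton_puiseux[OF h] obtain n u where n: "n > 0" and fin: "finite (NP_roots h)"
    and den: "\<And>\<phi>. \<phi> \<in> NP_roots h \<Longrightarrow> has_denom n \<phi>" and u: "conv_poly u" "coeff u 0 $ 0 \<noteq> 0"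
    and fact: "ramify_poly n h = u * (\<Prod>\<phi>\<in>NP_roots h. [:- ramify n \<phi>, 1:] ^ NP_mult h \<phi>)" by blast
  have pui: "puiseux \<phi>" if "\<phi> \<in> NP_roots h" for \<phi> using that by (simp add: NP_roots_def)
  have cv: "conv (ramify n \<phi>)" if "\<phi> \<in> NP_roots h" for \<phi>
    using that pui den by (blast intro: puiseux_conv_ramify)
  have lin: "\<And>\<phi>. \<phi> \<in> NP_roots h \<Longrightarrow> conv_poly ([:- ramify n \<phi>, 1:] ^ NP_mult h \<phi>)"
    using cv by (intro conv_poly_power) simp
  have pr: "conv_poly (\<Prod>\<phi>\<in>NP_roots h. [:- ramify n \<phi>, 1:] ^ NP_mult h \<phi>) \<and>
      (\<forall>\<^sub>F t in nhds 0. \<forall>y. ev (\<Prod>\<phi>\<in>NP_roots h. [:- ramify n \<phi>, 1:] ^ NP_mult h \<phi>) t y =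
        (\<Prod>\<phi>\<in>NP_roots h. ev ([:- ramify n \<phi>, 1:] ^ NP_mult h \<phi>) t y))"
    by (rule ev_prod[OF fin lin])
  have "\<forall>\<phi>\<in>NP_roots h. \<forall>\<^sub>F t in nhds 0. \<forall>y. ev ([:- ramify n \<phi>, 1:] ^ NP_mult h \<phi>) t y =
      (y - eval_fps (ramify n \<phi>) t) ^ NP_mult h \<phi>"
    using ev_linear_power[OF cv] by blast
  then have "\<forall>\<^sub>F t in nhds 0. \<forall>\<phi>\<in>NP_roots h. \<forall>y. ev ([:- ramify n \<phi>, 1:] ^ NP_mult h \<phi>) t y =
      (y - eval_fps (ramify n \<phi>) t) ^ NP_mult h \<phi>"
    by (rule eventually_ball_finite[OF fin])
  with conjunct2[OF pr] ev_mult[OF u(1) conjunct1[OF pr]]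
  have "\<forall>\<^sub>F t in nhds 0. \<forall>y. ev (ramify_poly n h) t y =
      ev u t y * (\<Prod>\<phi>\<in>NP_roots h. (y - eval_fps (ramify n \<phi>) t) ^ NP_mult h \<phi>)"
    by eventually_elim (simp add: fact)
  note E1 = eventually_of_real[OF this]
  have "\<forall>\<phi>\<in>NP_roots h. \<forall>\<^sub>F t in at_right 0. \<forall>y. eval_fps (ramify n \<phi>) (of_real t) = complex_of_real y \<longrightarrow>
      real_series \<phi>"
  proof
    fix \<phi> assume "\<phi> \<in> NP_roots h"
    then show "\<forall>\<^sub>F t in at_right 0. \<forall>y. eval_fps (ramify n \<phi>) (of_real t) = complex_of_real y \<longrightarrow> real_series \<phi>"
      using eval_nonreal_series[of \<phi> n] pui den by (cases "real_series \<phi>") auto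
  qed
  from eventually_ball_finite[OF fin this] E1
  have "\<forall>\<^sub>F t in at_right 0. \<forall>y. peval h (t ^ n) y = 0 \<longrightarrow> ev u (of_real t) (of_real y) \<noteq> 0 \<longrightarrow>
      (\<exists>\<phi>\<in>NP_roots h. real_series \<phi> \<and> y = branch_at n \<phi> t)"
  proof eventually_elim
    case (elim t)
    show ?case
    proof safe
      fix y assume z: "peval h (t ^ n) y = 0" and nz: "ev u (of_real t) (of_real y) \<noteq> 0"
      have "ev (ramify_poly n h) (of_real t) (of_real y) = 0" using z n by (simp add: ev_ramify_poly)
      then have "(\<Prod>\<phi>\<in>NP_roots h. (of_real y - eval_fps (ramify n \<phi>) (of_real t)) ^ NP_mult h \<phi>) = 0"
        using elim(2) nz by auto
      then obtain \<phi> where \<phi>: "\<phi> \<in> NP_roots h" "of_real y - eval_fps (ramify n \<phi>) (of_real t) = 0"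
        using fin by auto
      then have "eval_fps (ramify n \<phi>) (of_real t) = of_real y" by simp
      with \<phi> elim(1) show "\<exists>\<phi>\<in>NP_roots h. real_series \<phi> \<and> y = branch_at n \<phi> t" by (intro bexI[of _ \<phi>]) auto
    qed
  qed
  then obtain d1 where d1: "d1 > 0" "\<And>t y. 0 < t \<Longrightarrow> t < d1 \<Longrightarrow> peval h (t ^ n) y = 0 \<Longrightarrow>
    ev u (of_real t) (of_real y) \<noteq> 0 \<Longrightarrow> \<exists>\<phi>\<in>NP_roots h. real_series \<phi> \<and> y = branch_at n \<phi> t"
    by (auto simp: eventually_at_right_field)
  have "isCont (\<lambda>z. ev u (fst z) (snd z)) (0, 0)"
    using eventually_nhds_x_imp_x[OF isCont_ev[OF u(1)]] by blast
  moreover have "ev u 0 0 = coeff u 0 $ 0"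
    by (cases u) (simp add: eval_fps_at_0)
  ultimately have "((\<lambda>z. ev u (fst z) (snd z)) \<longlongrightarrow> coeff u 0 $ 0) (nhds (0, 0))"
    using tendsto_at_iff_tendsto_nhds[of "\<lambda>z. ev u (fst z) (snd z)" "(0, 0)"]
    by (simp add: isCont_def)
  then have "\<forall>\<^sub>F z in nhds (0, 0). ev u (fst z) (snd z) \<noteq> 0"
    using u(2) by (rule tendsto_imp_eventually_ne)
  then obtain d2 where d2: "d2 > 0" "\<And>z. dist z (0, 0) < d2 \<Longrightarrow> ev u (fst z) (snd z) \<noteq> 0"
    by (auto simp: eventually_nhds_metric)
  have d2': "ev u (of_real t) (of_real y) \<noteq> 0" if "\<bar>t\<bar> < d2 / 2" "\<bar>y\<bar> < d2 / 2" for t y :: real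
  proof -
    have "dist (complex_of_real t, complex_of_real y) (0, 0) \<le> \<bar>t\<bar> + \<bar>y\<bar>"
      using sqrt_sum_squares_le_sum_abs[of t y] by (simp add: dist_prod_def)
    then show ?thesis using d2(2)[of "(of_real t, of_real y)"] that by simp
  qed
  define d where "d = min d1 (d2 / 2)"
  have d: "d > 0" using d1 d2 by (simp add: d_def)
  show ?thesis
  \<comment> \<open>The bound d^n on x becomes the bound d on its n-th root.\<close>
  proof (intro exI[of _ "min d (d ^ n)"] conjI allI impI)
    show "min d (d ^ n) > 0" using d by simp
    fix x y assume x: "0 < x" "x < min d (d ^ n)" and y: "\<bar>y\<bar> < min d (d ^ n)" and z: "peval h x y = 0"
    let ?t = "root n x"
    have t: "?t > 0" "?t ^ n = x" using x n by (auto simp: real_root_pow_pos2)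
    have "?t < root n (d ^ n)" using x n by (intro real_root_less_mono) auto
    then have "?t < d" using n d by (simp add: real_root_power_cancel)
    then have "\<exists>\<phi>\<in>NP_roots h. real_series \<phi> \<and> y = branch_at n \<phi> ?t"
      using t z y by (intro d1(2) d2') (auto simp: d_def)
    then show "\<exists>\<gamma>\<in>NP_roots h. real_series \<gamma> \<and> y = branch_val \<gamma> x"
      using branch_val_eq[OF den x(1)] by metis
  qed
qed

section \<open>Critical points on circles\<close>

lemma isCont_peval: "isCont (\<lambda>z. peval h (fst z) (snd z)) z"
proof (induction h)
  case (pCons a h)
  then show ?case unfolding peval_pCons by (auto intro!: continuous_intros)
qed simp

lemma peval_add: "peval (p + q) x y = peval p x y + peval q x y"
  and peval_mult: "peval (p * q) x y = peval p x y * peval q x y"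
  and peval_diff: "peval (p - q) x y = peval p x y - peval q x y"
  and peval_xvar: "peval xvar x y = x"
  and peval_yvar: "peval yvar x y = y"
  by (simp_all add: peval_def xvar_def yvar_def)

lemma peval_G_poly:
  "peval (G_poly f g) x y =
    y * (peval g x y * peval (dx f) x y - peval f x y * peval (dx g) x y) -
    x * (peval g x y * peval (dy f) x y - peval f x y * peval (dy g) x y)"
  by (simp only: G_poly_def peval_diff peval_mult peval_xvar peval_yvar)

lemma peval_has_derivative:
  assumes "(X has_real_derivative X') (at t)" "(Y has_real_derivative Y') (at t)"
  shows "((\<lambda>t. peval h (X t) (Y t)) has_real_derivative
    peval (dx h) (X t) (Y t) * X' + peval (dy h) (X t) (Y t) * Y') (at t)"
proof (induction h)
  case (pCons a h)
  have "((\<lambda>t. poly a (X t) + Y t * peval h (X t) (Y t)) has_real_derivative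
    poly (pderiv a) (X t) * X' + (Y' * peval h (X t) (Y t) +
      (peval (dx h) (X t) (Y t) * X' + peval (dy h) (X t) (Y t) * Y') * Y t)) (at t)"
    by (intro DERIV_add DERIV_mult pCons assms DERIV_chain2[OF poly_DERIV])
  moreover have "dx (pCons a h) = pCons (pderiv a) (dx h)" by (simp add: dx_def map_poly_pCons)
  moreover have "dy (pCons a h) = h + pCons 0 (dy h)" by (simp add: dy_def pderiv_pCons)
  ultimately show ?case by (simp add: peval_add algebra_simps)
qed (simp add: dx_def dy_def)

text \<open>On a circle around the origin, \<open>\<bar>f / g\<bar>\<close> can only reach the value \<open>\<epsilon>\<close> if it has a maximum at
  a point with \<open>g \<noteq> 0\<close>. There the angular derivative of \<open>f / g\<close>, which is \<open>- G / g\<^sup>2\<close>, vanishes.\<close>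

lemma circle_max:
  fixes z :: "real \<times> real"
  assumes e: "\<epsilon> > 0"
    and crit: "\<And>z. 0 < norm z \<Longrightarrow> norm z < \<delta> \<Longrightarrow> peval (G_poly f g) (fst z) (snd z) = 0 \<Longrightarrow>
      peval g (fst z) (snd z) \<noteq> 0 \<Longrightarrow> \<bar>peval f (fst z) (snd z)\<bar> < \<epsilon> * \<bar>peval g (fst z) (snd z)\<bar>"
    and pole: "\<And>z. 0 < norm z \<Longrightarrow> norm z < \<delta> \<Longrightarrow> peval g (fst z) (snd z) = 0 \<Longrightarrow>
      \<forall>\<^sub>F w in nhds z. peval g (fst w) (snd w) \<noteq> 0 \<longrightarrow>
        \<bar>peval f (fst w) (snd w)\<bar> < \<epsilon> * \<bar>peval g (fst w) (snd w)\<bar>"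
    and z: "0 < norm z" "norm z < \<delta>" "peval g (fst z) (snd z) \<noteq> 0"
  shows "\<bar>peval f (fst z) (snd z)\<bar> < \<epsilon> * \<bar>peval g (fst z) (snd z)\<bar>"
proof (rule ccontr)
  assume contra: "\<not> ?thesis"
  define F where "F w = peval f (fst w) (snd w)" for w :: "real \<times> real"
  define H where "H w = peval g (fst w) (snd w)" for w :: "real \<times> real"
  define r where "r = norm z"
  have r: "0 < r" "r < \<delta>" using z by (auto simp: r_def)
  have cont: "isCont F w" "isCont H w" for w
    unfolding F_def H_def by (rule isCont_peval)+
  \<comment> \<open>The points of the circle with H nonzero where the bound fails. The set is closed
    although H may vanish on the circle, because \<open>pole\<close> keeps it away from those
    zeros.\<close>
  define K where "K = {w \<in> sphere 0 r. H w \<noteq> 0 \<and> \<epsilon> * \<bar>H w\<bar> \<le> \<bar>F w\<bar>}"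
  have "open (- K)"
  proof (subst open_subopen, safe)
    fix w assume w: "w \<notin> K"
    have "\<forall>\<^sub>F v in nhds w. v \<notin> K"
    proof (cases "w \<in> sphere 0 r")
      case False
      then have "\<forall>\<^sub>F v in nhds w. v \<in> - sphere 0 r" by (intro eventually_nhds_in_open) auto
      then show ?thesis by eventually_elim (auto simp: K_def)
    next
      case True
      show ?thesis
      proof (cases "H w = 0")
        case True
        with \<open>w \<in> sphere 0 r\<close> r pole[of w] have "\<forall>\<^sub>F v in nhds w. H v \<noteq> 0 \<longrightarrow> \<bar>F v\<bar> < \<epsilon> * \<bar>H v\<bar>"
          by (simp add: H_def F_def)
        then show ?thesis by eventually_elim (auto simp: K_def)
      next
        case False
        with w True have "\<epsilon> * \<bar>H w\<bar> - \<bar>F w\<bar> > 0" by (auto simp: K_def)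
        moreover have "isCont (\<lambda>v. \<epsilon> * \<bar>H v\<bar> - \<bar>F v\<bar>) w" by (intro continuous_intros cont)
        then have "((\<lambda>v. \<epsilon> * \<bar>H v\<bar> - \<bar>F v\<bar>) \<longlongrightarrow> \<epsilon> * \<bar>H w\<bar> - \<bar>F w\<bar>) (nhds w)"
          using tendsto_at_iff_tendsto_nhds[of "\<lambda>v. \<epsilon> * \<bar>H v\<bar> - \<bar>F v\<bar>" w] by (simp add: isCont_def)
        ultimately have "\<forall>\<^sub>F v in nhds w. \<epsilon> * \<bar>H v\<bar> - \<bar>F v\<bar> > 0" by (intro order_tendstoD(1))
        then show ?thesis by eventually_elim (auto simp: K_def)
      qed
    qed
    then show "\<exists>T. open T \<and> w \<in> T \<and> T \<subseteq> - K" by (auto simp: eventually_nhds)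
  qed
  then have "closed K" by (simp add: closed_def)
  moreover have "K = sphere 0 r \<inter> K" by (auto simp: K_def)
  ultimately have "compact K" by (metis compact_Int_closed compact_sphere)
  moreover have "z \<in> K" using contra z by (auto simp: K_def r_def F_def H_def)
  moreover have "continuous_on K (\<lambda>w. \<bar>F w / H w\<bar>)"
    by (intro continuous_at_imp_continuous_on ballI continuous_intros cont) (auto simp: K_def)
  ultimately obtain q where q: "q \<in> K" "\<And>w. w \<in> K \<Longrightarrow> \<bar>F w / H w\<bar> \<le> \<bar>F q / H q\<bar>"
    using continuous_attains_sup[of K] by blast
  from q(1) have q': "norm q = r" "H q \<noteq> 0" "\<epsilon> * \<bar>H q\<bar> \<le> \<bar>F q\<bar>" by (auto simp: K_def)
  have ge: "\<epsilon> \<le> \<bar>F q / H q\<bar>" using q' by (simp add: abs_divide le_divide_eq)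
  \<comment> \<open>Off K the quotient is below \<open>\<epsilon>\<close>, or it is 0 because H
    vanishes and division by zero gives 0; so q is a maximum over the whole circle.\<close>
  have max: "\<bar>F w / H w\<bar> \<le> \<bar>F q / H q\<bar>" if "norm w = r" for w
  proof (cases "w \<in> K")
    case False
    show ?thesis
    proof (cases "H w = 0")
      case False
      with \<open>w \<notin> K\<close> that have "\<bar>F w\<bar> < \<epsilon> * \<bar>H w\<bar>" by (auto simp: K_def)
      then have "\<bar>F w / H w\<bar> < \<epsilon>" using False by (simp add: abs_divide divide_less_eq)
      with ge show ?thesis by simp
    qed simp
  qed (rule q(2))
  have "(fst q)\<^sup>2 + (snd q)\<^sup>2 = r\<^sup>2"
    using q'(1) by (metis norm_prod_def prod.collapse real_norm_def power2_abs real_sqrt_pow2 sum_power2_ge_zero)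
  then have "(fst q / r)\<^sup>2 + (snd q / r)\<^sup>2 = 1"
    using r by (simp add: power_divide add_divide_distrib[symmetric])
  then obtain \<theta> where \<theta>: "fst q / r = cos \<theta>" "snd q / r = sin \<theta>" by (rule sincos_total_2pi)
  then have qp: "q = (r * cos \<theta>, r * sin \<theta>)" using r by (auto simp: prod_eq_iff field_simps)
  define p where "p u = (r * cos u, r * sin u)" for u
  have np: "norm (p u) = r" for u
  proof -
    have "(r * cos u)\<^sup>2 + (r * sin u)\<^sup>2 = r\<^sup>2"
      by (simp add: power_mult_distrib distrib_left[symmetric])
    then show ?thesis using r by (simp add: p_def norm_prod_def)
  qed
  \<comment> \<open>The derivative of h at q in the direction (- y, x) tangent to the
    circle.\<close>
  define DF where "DF h = peval (dx h) (fst q) (snd q) * (- snd q) + peval (dy h) (fst q) (snd q) * fst q" for h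
  have der: "((\<lambda>u. peval h (fst (p u)) (snd (p u))) has_real_derivative DF h) (at \<theta>)" for h
    unfolding p_def DF_def fst_conv snd_conv qp
    by (rule peval_has_derivative) (auto intro!: derivative_eq_intros)
  have p\<theta>: "p \<theta> = q" by (simp add: p_def qp)
  define D where "D = (DF f * H q - F q * DF g) / (H q * H q)"
  have "((\<lambda>u. F (p u) / H (p u)) has_real_derivative D) (at \<theta>)"
    using DERIV_divide[OF der[of f] der[of g]] q'(2) unfolding F_def H_def D_def p\<theta> by simp
  \<comment> \<open>The square avoids differentiating the absolute value; the extra factor F / H is
    cancelled below since F is nonzero at q.\<close>
  from DERIV_power[OF this, of 2]
  have "((\<lambda>u. (F (p u) / H (p u))\<^sup>2) has_real_derivative 2 * (D * (F q / H q))) (at \<theta>)"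
    by (simp add: p\<theta>)
  moreover have "\<forall>u. \<bar>\<theta> - u\<bar> < 1 \<longrightarrow> (F (p u) / H (p u))\<^sup>2 \<le> (F (p \<theta>) / H (p \<theta>))\<^sup>2"
    using max[OF np] unfolding p\<theta> by (metis abs_le_square_iff)
  ultimately have "2 * (D * (F q / H q)) = 0"
    by (rule DERIV_local_max[OF _ zero_less_one])
  moreover have "F q \<noteq> 0" using ge e by auto
  ultimately have "DF f * H q - F q * DF g = 0" using q'(2) by (auto simp: D_def)
  then have "peval (G_poly f g) (fst q) (snd q) = 0"
    by (simp add: peval_G_poly DF_def F_def H_def algebra_simps)
  with crit[of q] q' r show False by (simp add: F_def H_def)
qed

text \<open>Trades the quotient for a product inequality on square neighbourhoods; g(0, 0) = 0 keeps
  the centre out on both sides.\<close>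

lemma limit_iff:
  assumes "peval g 0 0 = 0"
  shows "((\<lambda>(x, y). peval f x y / peval g x y) \<longlongrightarrow> 0) (at (0, 0) within {(x, y). peval g x y \<noteq> 0}) \<longleftrightarrow>
    (\<forall>\<epsilon>>0. \<exists>\<delta>>0. \<forall>x y. \<bar>x\<bar> < \<delta> \<longrightarrow> \<bar>y\<bar> < \<delta> \<longrightarrow> peval g x y \<noteq> 0 \<longrightarrow> \<bar>peval f x y\<bar> \<le> \<epsilon> * \<bar>peval g x y\<bar>)"
    (is "?L \<longleftrightarrow> ?R")
proof -
  have quot: "\<bar>a\<bar> / \<bar>b\<bar> < \<epsilon> \<longleftrightarrow> \<bar>a\<bar> < \<epsilon> * \<bar>b\<bar>" if "b \<noteq> 0" for a b \<epsilon> :: real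
    using that by (simp add: divide_less_eq)
  have nz: "(x, y) \<noteq> 0" if "peval g x y \<noteq> 0" for x y
    using that assms by (auto simp: zero_prod_def)
  have L: "?L \<longleftrightarrow> (\<forall>\<epsilon>>0. \<exists>\<delta>>0. \<forall>x y. peval g x y \<noteq> 0 \<longrightarrow> norm (x, y) < \<delta> \<longrightarrow>
      \<bar>peval f x y\<bar> < \<epsilon> * \<bar>peval g x y\<bar>)"
    unfolding Lim_within
    by (intro all_cong ex_cong conj_cong refl) (auto simp: dist_norm quot nz zero_prod_def[symmetric])
  have small: "\<bar>x\<bar> \<le> norm (x, y)" "\<bar>y\<bar> \<le> norm (x, y)" for x y :: real
    using norm_fst_le[of x y] norm_snd_le[of y x] by auto
  have big: "norm (x, y) \<le> \<bar>x\<bar> + \<bar>y\<bar>" for x y :: real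
    using sqrt_sum_squares_le_sum_abs[of x y] by (simp add: norm_prod_def)
  show ?thesis unfolding L
  proof safe
    fix \<epsilon> :: real assume "\<epsilon> > 0"
      and "\<forall>\<epsilon>>0. \<exists>\<delta>>0. \<forall>x y. peval g x y \<noteq> 0 \<longrightarrow> norm (x, y) < \<delta> \<longrightarrow> \<bar>peval f x y\<bar> < \<epsilon> * \<bar>peval g x y\<bar>"
    then obtain \<delta> where d: "\<delta> > 0"
      "\<And>x y. peval g x y \<noteq> 0 \<Longrightarrow> norm (x, y) < \<delta> \<Longrightarrow> \<bar>peval f x y\<bar> < \<epsilon> * \<bar>peval g x y\<bar>" by blast
    show "\<exists>\<delta>>0. \<forall>x y. \<bar>x\<bar> < \<delta> \<longrightarrow> \<bar>y\<bar> < \<delta> \<longrightarrow> peval g x y \<noteq> 0 \<longrightarrow> \<bar>peval f x y\<bar> \<le> \<epsilon> * \<bar>peval g x y\<bar>"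
    proof (intro exI[of _ "\<delta> / 2"] conjI allI impI)
      fix x y assume "\<bar>x\<bar> < \<delta> / 2" "\<bar>y\<bar> < \<delta> / 2" "peval g x y \<noteq> 0"
      then show "\<bar>peval f x y\<bar> \<le> \<epsilon> * \<bar>peval g x y\<bar>" using big[of x y] d(2)[of x y] by linarith
    qed (use d in simp)
  next
    fix \<epsilon> :: real assume e: "\<epsilon> > 0" and R: ?R
    \<comment> \<open>Half of \<open>\<epsilon>\<close> restores the strict inequality, as g is
      nonzero.\<close>
    then have "\<epsilon> / 2 > 0" by simp
    with R obtain \<delta> where d: "\<delta> > 0"
      "\<And>x y. \<bar>x\<bar> < \<delta> \<Longrightarrow> \<bar>y\<bar> < \<delta> \<Longrightarrow> peval g x y \<noteq> 0 \<Longrightarrow> \<bar>peval f x y\<bar> \<le> \<epsilon> / 2 * \<bar>peval g x y\<bar>" by blast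
    show "\<exists>\<delta>>0. \<forall>x y. peval g x y \<noteq> 0 \<longrightarrow> norm (x, y) < \<delta> \<longrightarrow> \<bar>peval f x y\<bar> < \<epsilon> * \<bar>peval g x y\<bar>"
    proof (intro exI[of _ \<delta>] conjI allI impI)
      fix x y assume g: "peval g x y \<noteq> 0" and "norm (x, y) < \<delta>"
      then have "\<bar>peval f x y\<bar> \<le> \<epsilon> / 2 * \<bar>peval g x y\<bar>"
        using small[where x = x and y = y] by (intro d(2)) (auto intro: order_le_less_trans)
      also have "\<dots> < \<epsilon> * \<bar>peval g x y\<bar>" using e g by simp
      finally show "\<bar>peval f x y\<bar> < \<epsilon> * \<bar>peval g x y\<bar>" .
    qed (use d in simp)
  qed
qed

section \<open>Behaviour on the y-axis\<close>

lemma peval_axis: "poly (map_poly (\<lambda>c. complex_of_real (coeff c 0)) h) (of_real y) = of_real (peval h 0 y)"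
  by (induction h) (simp_all add: map_poly_pCons poly_0_coeff_0)

lemma axis_nonzero:
  assumes "regular m h"
  shows "\<exists>\<delta>>0. \<forall>y. y \<noteq> 0 \<longrightarrow> \<bar>y\<bar> < \<delta> \<longrightarrow> peval h 0 y \<noteq> 0"
proof -
  let ?p = "map_poly (\<lambda>c. complex_of_real (coeff c 0)) h"
  have "coeff ?p m \<noteq> 0" using assms by (simp add: coeff_map_poly regular_def)
  then have "?p \<noteq> 0" by auto
  from finite_set_avoid[OF poly_roots_finite[OF this], of 0] obtain d where
    d: "d > 0" "\<And>x. poly ?p x = 0 \<Longrightarrow> x \<noteq> 0 \<Longrightarrow> d \<le> dist 0 x" by auto
  show ?thesis
  proof (intro exI[of _ d] conjI allI impI d(1))
    fix y assume y: "y \<noteq> 0" "\<bar>y\<bar> < d"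
    show "peval h 0 y \<noteq> 0"
    proof
      assume "peval h 0 y = 0"
      then have "poly ?p (of_real y) = 0" by (simp add: peval_axis)
      from d(2)[OF this] y show False by simp
    qed
  qed
qed

text \<open>By regularity the order of h is the order of h(0, y) at y = 0, so f and g can be
  compared on the y-axis, where g has no other zeros near the origin.\<close>

lemma ord_less_if_small:
  assumes f: "regular m f" and g: "regular n g"
    and small: "\<And>\<epsilon>. \<epsilon> > 0 \<Longrightarrow> \<exists>\<delta>>0. \<forall>x y. \<bar>x\<bar> < \<delta> \<longrightarrow> \<bar>y\<bar> < \<delta> \<longrightarrow> peval g x y \<noteq> 0 \<longrightarrow>
      \<bar>peval f x y\<bar> \<le> \<epsilon> * \<bar>peval g x y\<bar>"
  shows "n < m"
proof -
  define A where "A h = fps_of_poly (map_poly (\<lambda>c. complex_of_real (coeff c 0)) h)" for h :: "real poly poly"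
  have nth: "A h $ j = complex_of_real (coeff (coeff h j) 0)" for h j by (simp add: A_def coeff_map_poly)
  have eval: "eval_fps (A h) (of_real y) = of_real (peval h 0 y)" for h y by (simp add: A_def peval_axis)
  have sub: "subdegree (A h) = k \<and> A h \<noteq> 0" if "regular k h" for h k
  proof -
    have "A h $ k \<noteq> 0" "\<And>j. j < k \<Longrightarrow> A h $ j = 0" using that by (auto simp: nth regular_def)
    then show ?thesis by (auto intro: subdegreeI)
  qed
  obtain d0 where d0: "d0 > 0" "\<And>y. y \<noteq> 0 \<Longrightarrow> \<bar>y\<bar> < d0 \<Longrightarrow> peval g 0 y \<noteq> 0"
    using axis_nonzero[OF g] by blast
  have "subdegree (A g) < subdegree (A f)"
  proof (rule subdegree_less_if_small)
    fix \<epsilon> :: real assume "\<epsilon> > 0"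
    from small[OF this] obtain d where d: "d > 0"
      "\<And>x y. \<bar>x\<bar> < d \<Longrightarrow> \<bar>y\<bar> < d \<Longrightarrow> peval g x y \<noteq> 0 \<Longrightarrow> \<bar>peval f x y\<bar> \<le> \<epsilon> * \<bar>peval g x y\<bar>" by blast
    show "\<forall>\<^sub>F t in at_right 0. norm (eval_fps (A f) (complex_of_real t)) \<le> \<epsilon> * norm (eval_fps (A g) (complex_of_real t))"
      using d d0 by (auto simp: eventually_at_right_field eval intro!: exI[of _ "min d d0"])
  qed (use sub[OF f] sub[OF g] in \<open>auto simp: A_def\<close>)
  then show ?thesis using sub f g by metis
qed

section \<open>Splitting off a half-branch\<close>

definition cofactor :: "real poly poly \<Rightarrow> frac_series \<Rightarrow> complex fps poly" where
  "cofactor h \<gamma> = (SOME Q. ramify_poly (denom \<gamma>) h = [:- ramify (denom \<gamma>) \<gamma>, 1:] ^ NP_mult h \<gamma> * Q)"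

text \<open>Cancellation in an integral domain makes the choice in the definition unique; maximality
  of the multiplicity makes the quotient nonzero along \<open>\<gamma>\<close>.\<close>

lemma cofactor:
  assumes "puiseux \<gamma>" "h \<noteq> 0"
  shows "ramify_poly (denom \<gamma>) h = [:- ramify (denom \<gamma>) \<gamma>, 1:] ^ NP_mult h \<gamma> * cofactor h \<gamma>"
    and "poly (cofactor h \<gamma>) (ramify (denom \<gamma>) \<gamma>) \<noteq> 0" and "conv_poly (cofactor h \<gamma>)"
proof -
  note d = puiseuxD[OF assms(1)]
  let ?G = "ramify (denom \<gamma>) \<gamma>"
  have nz: "ramify_poly (denom \<gamma>) h \<noteq> 0" using ramify_poly_nonzero d assms by blast
  from order_decomp'[OF this, of ?G] obtain Q where
    Q: "ramify_poly (denom \<gamma>) h = [:- ?G, 1:] ^ NP_mult h \<gamma> * Q" "poly Q ?G \<noteq> 0"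
    unfolding NP_mult_def by blast
  show *: "ramify_poly (denom \<gamma>) h = [:- ?G, 1:] ^ NP_mult h \<gamma> * cofactor h \<gamma>"
    unfolding cofactor_def by (rule someI[of _ Q]) (rule Q(1))
  then have "[:- ?G, 1:] ^ NP_mult h \<gamma> * cofactor h \<gamma> = [:- ?G, 1:] ^ NP_mult h \<gamma> * Q" using Q by simp
  then have "cofactor h \<gamma> = Q" by (subst (asm) mult_left_cancel) simp_all
  with Q show "poly (cofactor h \<gamma>) ?G \<noteq> 0" by simp
  have "conv_poly (ramify_poly (denom \<gamma>) h)" using d by (simp add: conv_poly_ramify_poly)
  then show "conv_poly (cofactor h \<gamma>)"
    using puiseux_conv_ramify[OF assms(1) d(1)] unfolding * by (rule conv_poly_linear_power_cancel)
qed

text \<open>For h = f this is \<open>f\<^sub>1(x, \<gamma>)\<close> of the overview, as a series in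
  the root of x.\<close>

abbreviation lead :: "real poly poly \<Rightarrow> frac_series \<Rightarrow> complex fps" where
  "lead h \<gamma> \<equiv> poly (cofactor h \<gamma>) (ramify (denom \<gamma>) \<gamma>)"

text \<open>What is needed about h near a real half-branch, collected for one small t: the
  factorization at all real y, with a second factor that is continuous there and nonzero on the
  branch.\<close>

lemma curve_real:
  assumes g: "puiseux \<gamma>" "real_series \<gamma>" and h: "h \<noteq> 0"
  shows "\<forall>\<^sub>F t in at_right 0.
      (\<forall>y. complex_of_real (peval h (t ^ denom \<gamma>) y) =
        of_real (y - branch_at (denom \<gamma>) \<gamma> t) ^ NP_mult h \<gamma> * ev (cofactor h \<gamma>) (of_real t) (of_real y)) \<and>
      eval_fps (lead h \<gamma>) (of_real t) = ev (cofactor h \<gamma>) (of_real t) (of_real (branch_at (denom \<gamma>) \<gamma> t)) \<and>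
      ev (cofactor h \<gamma>) (of_real t) (of_real (branch_at (denom \<gamma>) \<gamma> t)) \<noteq> 0 \<and>
      (\<forall>y. isCont (\<lambda>z. ev (cofactor h \<gamma>) (fst z) (snd z)) (of_real t, y))"
proof -
  let ?n = "denom \<gamma>"
  let ?G = "ramify ?n \<gamma>" and ?Q = "cofactor h \<gamma>"
  note d = puiseuxD[OF g(1)] and c = cofactor[OF g(1) h]
  have G: "conv ?G" by (rule puiseux_conv_ramify[OF g(1) d(1)])
  have lead: "conv (lead h \<gamma>)" using c G by (intro conv_poly_poly)
  from eventually_of_real[OF ev_linear_power_mult[OF G c(3), of "NP_mult h \<gamma>"]]
    eventually_of_real[OF eval_fps_poly[OF c(3) G]] eval_fps_nonzero[OF lead c(2)]
    eventually_of_real[OF isCont_ev[OF c(3)]] eval_real_series[OF g(1) d(1) g(2)]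
  show ?thesis
  proof eventually_elim
    case (elim t)
    have "complex_of_real (peval h (t ^ ?n) y) =
        of_real (y - branch_at ?n \<gamma> t) ^ NP_mult h \<gamma> * ev ?Q (of_real t) (of_real y)" for y
    proof -
      have "complex_of_real (peval h (t ^ ?n) y) = ev (ramify_poly ?n h) (of_real t) (of_real y)"
        using d by (simp add: ev_ramify_poly)
      also have "\<dots> = (of_real y - eval_fps ?G (of_real t)) ^ NP_mult h \<gamma> * ev ?Q (of_real t) (of_real y)"
        using elim(1) c(1) by simp
      also have "of_real y - eval_fps ?G (of_real t) = of_real (y - branch_at ?n \<gamma> t)"
        using elim(5) by simp
      finally show ?thesis .
    qed
    with elim show ?case by auto
  qed
qed

text \<open>Conditions (ii) and (iii) both say this of the half-branches \<open>\<gamma>\<close> concerned; it means that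
  \<open>f / g\<close> tends to 0 near \<open>\<gamma>\<close>.\<close>

definition dominated :: "real poly poly \<Rightarrow> real poly poly \<Rightarrow> frac_series \<Rightarrow> bool" where
  "dominated f g \<gamma> \<longleftrightarrow> NP_mult g \<gamma> < NP_mult f \<gamma> \<or>
     NP_mult g \<gamma> = NP_mult f \<gamma> \<and> subdegree (lead g \<gamma>) < subdegree (lead f \<gamma>)"

lemma tendsto_branch_at:
  assumes "puiseux \<gamma>"
  shows "(branch_at (denom \<gamma>) \<gamma> \<longlongrightarrow> 0) (at_right 0)"
proof -
  note d = puiseuxD[OF assms]
  have "(branch_at (denom \<gamma>) \<gamma> \<longlongrightarrow> Re (ramify (denom \<gamma>) \<gamma> $ 0)) (at_right 0)"
    by (intro tendsto_Re tendsto_eval_fps_real puiseux_conv_ramify assms d)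
  then show ?thesis using assms d by (simp add: puiseux_ramify_0)
qed

text \<open>\<open>\<gamma>\<close> may consist of zeros of g, where the hypothesis is silent. So t
  is fixed while y tends to the branch, after the power of the distance contained in f has been
  cancelled.\<close>

lemma dominated_if_small:
  assumes \<gamma>: "puiseux \<gamma>" "real_series \<gamma>" and f: "f \<noteq> 0" and g: "g \<noteq> 0"
    and small: "\<And>\<epsilon>. \<epsilon> > 0 \<Longrightarrow> \<exists>\<delta>>0. \<forall>x y. \<bar>x\<bar> < \<delta> \<longrightarrow> \<bar>y\<bar> < \<delta> \<longrightarrow> peval g x y \<noteq> 0 \<longrightarrow>
      \<bar>peval f x y\<bar> \<le> \<epsilon> * \<bar>peval g x y\<bar>"
  shows "dominated f g \<gamma>"
proof (cases "NP_mult f \<gamma> \<le> NP_mult g \<gamma>")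
  case True
  let ?n = "denom \<gamma>"
  let ?c = "branch_at ?n \<gamma>" and ?k = "NP_mult g \<gamma> - NP_mult f \<gamma>"
  note d = puiseuxD[OF \<gamma>(1)]
  \<comment> \<open>The factor \<open>0 ^ ?k\<close> is 1 for equal multiplicities and 0 otherwise,
    so one limit treats both cases.\<close>
  have *: "\<forall>\<^sub>F t in at_right 0. norm (eval_fps (lead f \<gamma>) (of_real t)) \<le>
      \<epsilon> * (0 ^ ?k * norm (eval_fps (lead g \<gamma>) (of_real t)))" if e: "\<epsilon> > 0" for \<epsilon>
  proof -
    from small[OF e] obtain \<delta> where \<delta>: "\<delta> > 0"
      "\<And>x y. \<bar>x\<bar> < \<delta> \<Longrightarrow> \<bar>y\<bar> < \<delta> \<Longrightarrow> peval g x y \<noteq> 0 \<Longrightarrow> \<bar>peval f x y\<bar> \<le> \<epsilon> * \<bar>peval g x y\<bar>" by blast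
    have "((\<lambda>t :: real. \<bar>t ^ ?n\<bar>) \<longlongrightarrow> \<bar>0 ^ ?n\<bar>) (at_right 0)" by (intro tendsto_intros)
    then have "((\<lambda>t :: real. \<bar>t ^ ?n\<bar>) \<longlongrightarrow> 0) (at_right 0)" using d by (simp add: power_0_left)
    then have "\<forall>\<^sub>F t in at_right (0 :: real). \<bar>t ^ ?n\<bar> < \<delta>" using \<delta>(1) by (rule order_tendstoD(2))
    moreover have "((\<lambda>t. \<bar>?c t\<bar>) \<longlongrightarrow> \<bar>0\<bar>) (at_right 0)" by (intro tendsto_rabs tendsto_branch_at \<gamma>)
    then have "\<forall>\<^sub>F t in at_right 0. \<bar>?c t\<bar> < \<delta>" using \<delta>(1) by (intro order_tendstoD(2)) auto
    ultimately show ?thesis using curve_real[OF \<gamma> f] curve_real[OF \<gamma> g]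
    proof eventually_elim
      case (elim t)
      let ?A = "\<lambda>y. norm (ev (cofactor f \<gamma>) (of_real t) (complex_of_real y))"
      let ?B = "\<lambda>y. norm (ev (cofactor g \<gamma>) (of_real t) (complex_of_real y))"
      note Ft = elim(3)[THEN conjunct1, THEN spec]
      note Gt = elim(4)[THEN conjunct1, THEN spec]
      have cont: "isCont ?A y" "isCont ?B y" for y
        unfolding ev_def by (intro continuous_intros)+
      have "?A (?c t) \<le> \<epsilon> * (\<bar>?c t - ?c t\<bar> ^ ?k * ?B (?c t))"
      proof (rule tendsto_le[of "at (?c t)"])
        show "(?A \<longlongrightarrow> ?A (?c t)) (at (?c t))" using cont by (simp add: isCont_def)
        have "isCont (\<lambda>y. \<epsilon> * (\<bar>y - ?c t\<bar> ^ ?k * ?B y)) (?c t)" by (intro continuous_intros cont)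
        then show "((\<lambda>y. \<epsilon> * (\<bar>y - ?c t\<bar> ^ ?k * ?B y)) \<longlongrightarrow> \<epsilon> * (\<bar>?c t - ?c t\<bar> ^ ?k * ?B (?c t))) (at (?c t))"
          by (simp add: isCont_def)
        have "(?B \<longlongrightarrow> ?B (?c t)) (at (?c t))" using cont by (simp add: isCont_def)
        then have "\<forall>\<^sub>F y in at (?c t). ?B y \<noteq> 0"
          using elim(4) by (intro tendsto_imp_eventually_ne) auto
        moreover have "((\<lambda>y. \<bar>y\<bar>) \<longlongrightarrow> \<bar>?c t\<bar>) (at (?c t))" by (intro tendsto_intros)
        then have "\<forall>\<^sub>F y in at (?c t). \<bar>y\<bar> < \<delta>" using elim(2) by (rule order_tendstoD(2))
        moreover have "\<forall>\<^sub>F y in at (?c t). y \<noteq> ?c t" by (rule eventually_neq_at_within)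
        ultimately show "\<forall>\<^sub>F y in at (?c t). ?A y \<le> \<epsilon> * (\<bar>y - ?c t\<bar> ^ ?k * ?B y)"
        proof eventually_elim
          case (elim y)
          let ?w = "\<bar>y - ?c t\<bar>"
          have w: "?w > 0" using elim by simp
          have F: "\<bar>peval f (t ^ ?n) y\<bar> = ?w ^ NP_mult f \<gamma> * ?A y"
            using arg_cong[OF Ft[of y], of norm]
            by (simp add: norm_mult norm_power del: of_real_diff)
          have G: "\<bar>peval g (t ^ ?n) y\<bar> = ?w ^ NP_mult g \<gamma> * ?B y"
            using arg_cong[OF Gt[of y], of norm]
            by (simp add: norm_mult norm_power del: of_real_diff)
          have "\<bar>peval g (t ^ ?n) y\<bar> \<noteq> 0" unfolding G using w elim by simp
          then have "?w ^ NP_mult f \<gamma> * ?A y \<le> \<epsilon> * (?w ^ NP_mult g \<gamma> * ?B y)"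
            unfolding F[symmetric] G[symmetric] using \<open>\<bar>t ^ ?n\<bar> < \<delta>\<close> elim by (intro \<delta>(2)) auto
          also have "?w ^ NP_mult g \<gamma> = ?w ^ NP_mult f \<gamma> * ?w ^ ?k"
            using True by (simp add: power_add[symmetric])
          finally have "?w ^ NP_mult f \<gamma> * ?A y \<le> ?w ^ NP_mult f \<gamma> * (\<epsilon> * (?w ^ ?k * ?B y))"
            by (simp add: mult_ac)
          then show ?case by (rule mult_left_le_imp_le) (use w in simp)
        qed
      qed simp
      then show ?case using elim by simp
    qed
  qed
  have "NP_mult f \<gamma> = NP_mult g \<gamma>"
  proof (rule ccontr)
    assume "NP_mult f \<gamma> \<noteq> NP_mult g \<gamma>"
    then have "?k > 0" using True by simp
    \<comment> \<open>A surplus linear factor of g would force \<open>lead f \<gamma>\<close> to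
      vanish at small t.\<close>
    then have "\<forall>\<^sub>F t in at_right 0. norm (eval_fps (lead f \<gamma>) (complex_of_real t)) \<le> 0"
      using *[of 1] by (simp add: power_0_left)
    with curve_real[OF \<gamma> f] have "\<forall>\<^sub>F t in at_right (0 :: real). False"
      by eventually_elim auto
    then show False by simp
  qed
  moreover have "subdegree (lead g \<gamma>) < subdegree (lead f \<gamma>)"
  proof (rule subdegree_less_if_small)
    have "conv (ramify ?n \<gamma>)" using \<gamma> d by (intro puiseux_conv_ramify)
    then show "conv (lead f \<gamma>)" "conv (lead g \<gamma>)" "lead f \<gamma> \<noteq> 0" "lead g \<gamma> \<noteq> 0"
      using cofactor[OF \<gamma>(1) f] cofactor[OF \<gamma>(1) g] by (auto intro: conv_poly_poly)
    show "\<forall>\<^sub>F t in at_right 0. norm (eval_fps (lead f \<gamma>) (of_real t)) \<le> \<epsilon> * norm (eval_fps (lead g \<gamma>) (of_real t))"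
      if "\<epsilon> > 0" for \<epsilon> using *[OF that] calculation by simp
  qed
  ultimately show ?thesis by (simp add: dominated_def)
qed (simp add: dominated_def)

section \<open>The limit criterion\<close>

text \<open>\<open>circle_max\<close> asks at a pole for smallness on a neighbourhood, not just
  along the branch. Continuity provides it once the common power of the distance to the branch is
  cancelled.\<close>

lemma small_if_dominated:
  assumes \<gamma>: "puiseux \<gamma>" "real_series \<gamma>" and f: "f \<noteq> 0" and g: "g \<noteq> 0"
    and dom: "dominated f g \<gamma>" and e: "\<epsilon> > 0"
  shows "\<forall>\<^sub>F t in at_right 0. \<forall>\<^sub>F z in nhds (t ^ denom \<gamma>, branch_at (denom \<gamma>) \<gamma> t).
    peval g (fst z) (snd z) \<noteq> 0 \<longrightarrow> \<bar>peval f (fst z) (snd z)\<bar> < \<epsilon> * \<bar>peval g (fst z) (snd z)\<bar>"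
proof -
  let ?n = "denom \<gamma>"
  let ?c = "branch_at ?n \<gamma>" and ?k = "NP_mult f \<gamma> - NP_mult g \<gamma>"
  let ?A = "\<lambda>t y. norm (ev (cofactor f \<gamma>) (of_real t) (complex_of_real y))"
  let ?B = "\<lambda>t y. norm (ev (cofactor g \<gamma>) (of_real t) (complex_of_real y))"
  note d = puiseuxD[OF \<gamma>(1)]
  \<comment> \<open>Positivity is the desired bound with the distance to the power
    \<open>NP_mult g \<gamma>\<close> divided out. On the branch it comes from the order comparison
    if \<open>?k = 0\<close>, and otherwise from the vanishing of the second term.\<close>
  define \<Psi> where "\<Psi> t y = \<epsilon> * ?B t y - \<bar>y - ?c t\<bar> ^ ?k * ?A t y" for t y
  have conv: "conv (ramify ?n \<gamma>)" using \<gamma> d by (intro puiseux_conv_ramify)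
  have le: "NP_mult g \<gamma> \<le> NP_mult f \<gamma>" using dom by (auto simp: dominated_def)
  have "\<forall>\<^sub>F t in at_right 0. 0 < \<Psi> t (?c t)"
  proof (cases "?k = 0")
    case True
    then have "subdegree (lead g \<gamma>) < subdegree (lead f \<gamma>)" using dom le by (auto simp: dominated_def)
    then have "\<forall>\<^sub>F t in at_right 0. norm (eval_fps (lead f \<gamma>) (complex_of_real t)) <
        \<epsilon> * norm (eval_fps (lead g \<gamma>) (complex_of_real t))"
      using cofactor[OF \<gamma>(1) f] cofactor[OF \<gamma>(1) g] e conv by (intro small_if_subdegree_less conv_poly_poly) auto
    with curve_real[OF \<gamma> f] curve_real[OF \<gamma> g] show ?thesis
      by eventually_elim (simp add: \<Psi>_def True)
  next
    case False
    from curve_real[OF \<gamma> g] show ?thesis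
      by eventually_elim (use False e in \<open>simp add: \<Psi>_def power_0_left\<close>)
  qed
  with curve_real[OF \<gamma> f] curve_real[OF \<gamma> g] eventually_of_real[OF isCont_eval_fps_eventually[OF conv]]
  have "\<forall>\<^sub>F t in at_right 0. 0 < \<Psi> t (?c t) \<and>
      (\<forall>y. complex_of_real (peval f (t ^ ?n) y) =
        of_real (y - ?c t) ^ NP_mult f \<gamma> * ev (cofactor f \<gamma>) (of_real t) (of_real y)) \<and>
      (\<forall>y. complex_of_real (peval g (t ^ ?n) y) =
        of_real (y - ?c t) ^ NP_mult g \<gamma> * ev (cofactor g \<gamma>) (of_real t) (of_real y)) \<and>
      (\<forall>y. isCont (\<lambda>z. ev (cofactor f \<gamma>) (fst z) (snd z)) (of_real t, y)) \<and>
      (\<forall>y. isCont (\<lambda>z. ev (cofactor g \<gamma>) (fst z) (snd z)) (of_real t, y)) \<and>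
      isCont (eval_fps (ramify ?n \<gamma>)) (of_real t)" (is "\<forall>\<^sub>F t in _. ?E t")
    by eventually_elim (elim conjE, intro conjI; assumption)
  \<comment> \<open>A neighbourhood of a branch point involves other values of t, so the facts are
    needed on an interval.\<close>
  then obtain r where r: "r > 0" and E: "\<And>t. 0 < t \<Longrightarrow> t < r \<Longrightarrow> ?E t"
    unfolding eventually_at_right_field by blast
  note pos = E[THEN conjunct1]
  note F = E[THEN conjunct2, THEN conjunct1, THEN spec]
  note G = E[THEN conjunct2, THEN conjunct2, THEN conjunct1, THEN spec]
  note contf = E[THEN conjunct2, THEN conjunct2, THEN conjunct2, THEN conjunct1, THEN spec]
  note contg = E[THEN conjunct2, THEN conjunct2, THEN conjunct2, THEN conjunct2, THEN conjunct1, THEN spec]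
  note contc = E[THEN conjunct2, THEN conjunct2, THEN conjunct2, THEN conjunct2, THEN conjunct2]
  have "\<forall>\<^sub>F z in nhds (t ^ ?n, ?c t).
      peval g (fst z) (snd z) \<noteq> 0 \<longrightarrow> \<bar>peval f (fst z) (snd z)\<bar> < \<epsilon> * \<bar>peval g (fst z) (snd z)\<bar>"
    if t: "0 < t" "t < r" for t
  proof -
    let ?z0 = "(t ^ ?n, ?c t)"
    have rt: "root ?n (t ^ ?n) = t" using t d by (simp add: real_root_power_cancel)
    have croot: "isCont (\<lambda>z. root ?n (fst z)) ?z0" by (intro continuous_intros)
    have cev: "isCont (\<lambda>z. ev P (of_real (root ?n (fst z))) (complex_of_real (snd z))) ?z0"
      if "\<And>y. isCont (\<lambda>z. ev P (fst z) (snd z)) (of_real t, y)" for P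
    proof -
      have "isCont (\<lambda>z. (complex_of_real (root ?n (fst z)), complex_of_real (snd z))) ?z0"
        by (intro continuous_intros croot)
      moreover have "isCont (\<lambda>z. ev P (fst z) (snd z))
          (complex_of_real (root ?n (fst ?z0)), complex_of_real (snd ?z0))"
        using that rt by simp
      ultimately show ?thesis
        using isCont_o2[where g = "\<lambda>z. ev P (fst z) (snd z)"] by fastforce
    qed
    have "isCont (\<lambda>z. complex_of_real (root ?n (fst z))) ?z0" by (intro continuous_intros croot)
    moreover have "isCont (eval_fps (ramify ?n \<gamma>)) (complex_of_real (root ?n (fst ?z0)))"
      using contc[OF t] rt by simp
    ultimately have "isCont (\<lambda>z. eval_fps (ramify ?n \<gamma>) (of_real (root ?n (fst z)))) ?z0"
      by (rule isCont_o2)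
    then have "isCont (\<lambda>z. ?c (root ?n (fst z))) ?z0" by (rule isCont_Re)
    then have "isCont (\<lambda>z. \<Psi> (root ?n (fst z)) (snd z)) ?z0"
      unfolding \<Psi>_def using contf[OF t] contg[OF t] by (intro continuous_intros cev) auto
    then have "((\<lambda>z. \<Psi> (root ?n (fst z)) (snd z)) \<longlongrightarrow> \<Psi> t (?c t)) (nhds ?z0)"
      using tendsto_at_iff_tendsto_nhds[of "\<lambda>z. \<Psi> (root ?n (fst z)) (snd z)" ?z0] rt
      by (simp add: isCont_def)
    then have "\<forall>\<^sub>F z in nhds ?z0. 0 < \<Psi> (root ?n (fst z)) (snd z)"
      using pos[OF t] by (rule order_tendstoD(1))
    moreover have lim: "((\<lambda>z. root ?n (fst z)) \<longlongrightarrow> t) (nhds ?z0)"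
      using tendsto_at_iff_tendsto_nhds[of "\<lambda>z. root ?n (fst z)" ?z0] rt croot by (simp add: isCont_def)
    ultimately show ?thesis
      using order_tendstoD(1)[OF lim t(1)] order_tendstoD(2)[OF lim t(2)]
    proof eventually_elim
      case (elim z)
      let ?t = "root ?n (fst z)" and ?y = "snd z"
      let ?w = "\<bar>?y - ?c ?t\<bar>"
      have x: "fst z = ?t ^ ?n" using elim(2) d by (metis real_root_gt_0_iff real_root_pow_pos2 less_imp_le)
      have Fz: "\<bar>peval f (fst z) ?y\<bar> = ?w ^ NP_mult f \<gamma> * ?A ?t ?y"
        using arg_cong[OF F[OF elim(2,3), of ?y], of norm] unfolding x[symmetric]
        by (simp add: norm_mult norm_power del: of_real_diff)
      have Gz: "\<bar>peval g (fst z) ?y\<bar> = ?w ^ NP_mult g \<gamma> * ?B ?t ?y"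
        using arg_cong[OF G[OF elim(2,3), of ?y], of norm] unfolding x[symmetric]
        by (simp add: norm_mult norm_power del: of_real_diff)
      have "?w ^ NP_mult g \<gamma> * ?B ?t ?y \<noteq> 0" unfolding Gz[symmetric] using elim(4) by simp
      then have w: "?w ^ NP_mult g \<gamma> > 0" by (metis abs_ge_zero mult_eq_0_iff zero_le_power order_le_less)
      have "?w ^ NP_mult f \<gamma> * ?A ?t ?y = ?w ^ NP_mult g \<gamma> * (?w ^ ?k * ?A ?t ?y)"
        using le by (simp add: power_add[symmetric] mult.assoc[symmetric])
      also have "\<dots> < ?w ^ NP_mult g \<gamma> * (\<epsilon> * ?B ?t ?y)"
        using elim(1) w by (intro mult_strict_left_mono) (simp_all add: \<Psi>_def)
      finally show ?case unfolding Fz Gz by (simp only: mult_ac)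
    qed
  qed
  then show ?thesis using r by (auto simp: eventually_at_right_field)
qed

lemma eventually_branch_val:
  assumes "puiseux \<gamma>" and ev: "\<forall>\<^sub>F t in at_right 0. Q (t ^ denom \<gamma>) (branch_at (denom \<gamma>) \<gamma> t)"
  shows "\<forall>\<^sub>F x in at_right 0. Q x (branch_val \<gamma> x)"
proof -
  let ?n = "denom \<gamma>"
  note d = puiseuxD[OF assms(1)]
  from ev obtain r where r: "r > 0" "\<And>t. 0 < t \<Longrightarrow> t < r \<Longrightarrow> Q (t ^ ?n) (branch_at ?n \<gamma> t)"
    by (auto simp: eventually_at_right_field)
  have "Q x (branch_val \<gamma> x)" if x: "0 < x" "x < r ^ ?n" for x
  proof -
    have "root ?n x < root ?n (r ^ ?n)" using x d by (intro real_root_less_mono) auto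
    then have "root ?n x < r" using r d by (simp add: real_root_power_cancel)
    then show ?thesis using r(2)[of "root ?n x"] x d by (simp add: branch_val_def real_root_pow_pos2)
  qed
  then show ?thesis using r(1) by (auto simp: eventually_at_right_field intro!: exI[of _ "r ^ ?n"])
qed

lemma NP_mult_pos_iff:
  assumes "puiseux \<gamma>" "h \<noteq> 0"
  shows "0 < NP_mult h \<gamma> \<longleftrightarrow> \<gamma> \<in> NP_roots h"
  using NP_roots_iff[OF puiseuxD(1)[OF assms(1)], of h] assms
    ramify_poly_nonzero[OF puiseuxD(2)[OF assms(1)] assms(2)]
  by (simp add: NP_mult_def order_gt_0_iff)

lemma peval_branch_val_eq_0:
  assumes "\<gamma> \<in> NP_roots h" "real_series \<gamma>" "h \<noteq> 0"
  shows "\<forall>\<^sub>F x in at_right 0. peval h x (branch_val \<gamma> x) = 0"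
proof -
  have p: "puiseux \<gamma>" using assms by (simp add: NP_roots_def)
  have k: "NP_mult h \<gamma> > 0" using NP_mult_pos_iff[OF p assms(3)] assms(1) by simp
  from curve_real[OF p assms(2,3)]
  have "\<forall>\<^sub>F t in at_right 0. peval h (t ^ denom \<gamma>) (branch_at (denom \<gamma>) \<gamma> t) = 0"
  proof eventually_elim
    case (elim t)
    then have "complex_of_real (peval h (t ^ denom \<gamma>) (branch_at (denom \<gamma>) \<gamma> t)) = 0"
      using k by (simp del: of_real_eq_0_iff add: power_0_left)
    then show ?case by simp
  qed
  then show ?thesis by (rule eventually_branch_val[OF p])
qed

lemma finite_NP_roots: "regular m h \<Longrightarrow> finite (NP_roots h)"
  using newton_puiseux by blast

text \<open>The relevant zeros lie on finitely many real half-branches, so one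
  \<open>\<delta>\<close> suffices. The role of H is played by
  \<open>xscale s (G_poly f g)\<close>.\<close>

lemma local_bound:
  assumes f: "f \<noteq> 0" and g: "regular m g" and H: "regular k H" and e: "\<epsilon> > 0"
    and domH: "\<And>\<gamma>. \<gamma> \<in> NP_roots H \<Longrightarrow> real_series \<gamma> \<Longrightarrow> \<gamma> \<notin> NP_roots f \<Longrightarrow> \<gamma> \<notin> NP_roots g \<Longrightarrow> dominated f g \<gamma>"
    and domg: "\<And>\<gamma>. \<gamma> \<in> NP_roots g \<Longrightarrow> real_series \<gamma> \<Longrightarrow> dominated f g \<gamma>"
  shows "\<exists>\<delta>>0. \<forall>x y. 0 < x \<longrightarrow> x < \<delta> \<longrightarrow> \<bar>y\<bar> < \<delta> \<longrightarrow>
      (peval H x y = 0 \<longrightarrow> peval g x y \<noteq> 0 \<longrightarrow> \<bar>peval f x y\<bar> < \<epsilon> * \<bar>peval g x y\<bar>) \<and>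
      (peval g x y = 0 \<longrightarrow> (\<forall>\<^sub>F z in nhds (x, y). peval g (fst z) (snd z) \<noteq> 0 \<longrightarrow>
        \<bar>peval f (fst z) (snd z)\<bar> < \<epsilon> * \<bar>peval g (fst z) (snd z)\<bar>))"
proof -
  have g0: "g \<noteq> 0" by (rule regular_nonzero[OF g])
  have pui: "puiseux \<gamma>" if "\<gamma> \<in> NP_roots h" for \<gamma> h using that by (simp add: NP_roots_def)
  let ?S = "\<lambda>x y. \<forall>\<^sub>F z in nhds (x, y). peval g (fst z) (snd z) \<noteq> 0 \<longrightarrow>
        \<bar>peval f (fst z) (snd z)\<bar> < \<epsilon> * \<bar>peval g (fst z) (snd z)\<bar>"
  let ?W = "\<lambda>x y. peval g x y \<noteq> 0 \<longrightarrow> \<bar>peval f x y\<bar> < \<epsilon> * \<bar>peval g x y\<bar>"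
  have S: "\<forall>\<^sub>F x in at_right 0. ?S x (branch_val \<gamma> x)"
    if "puiseux \<gamma>" "real_series \<gamma>" "dominated f g \<gamma>" for \<gamma>
    using small_if_dominated[OF that(1,2) f g0 that(3) e] by (rule eventually_branch_val[OF that(1)])
  have SW: "?W x y" if "?S x y" for x y
    using eventually_nhds_x_imp_x[OF that] by simp
  have W: "\<forall>\<^sub>F x in at_right 0. ?W x (branch_val \<gamma> x)" if \<gamma>: "\<gamma> \<in> NP_roots H" "real_series \<gamma>" for \<gamma>
  \<comment> \<open>On a root shared with f the left side is 0; on one shared with g the premise
    fails.\<close>
  proof (cases "\<gamma> \<in> NP_roots f \<union> NP_roots g")
    case True
    then show ?thesis
    proof
      assume "\<gamma> \<in> NP_roots f"
      from peval_branch_val_eq_0[OF this \<gamma>(2) f] show ?thesis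
        by eventually_elim (use e in simp)
    next
      assume "\<gamma> \<in> NP_roots g"
      from peval_branch_val_eq_0[OF this \<gamma>(2) g0] show ?thesis by eventually_elim simp
    qed
  next
    case False
    then have "\<forall>\<^sub>F x in at_right 0. ?S x (branch_val \<gamma> x)" using \<gamma> domH pui by (intro S) auto
    then show ?thesis by eventually_elim (rule SW)
  qed
  have fin: "finite {\<gamma> \<in> NP_roots H. real_series \<gamma>}" "finite {\<gamma> \<in> NP_roots g. real_series \<gamma>}"
    using finite_NP_roots[OF H] finite_NP_roots[OF g] by auto
  have "\<forall>\<^sub>F x in at_right 0. \<forall>\<gamma>\<in>{\<gamma> \<in> NP_roots H. real_series \<gamma>}. ?W x (branch_val \<gamma> x)"
    using W by (intro eventually_ball_finite[OF fin(1)]) auto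
  moreover have "\<forall>\<^sub>F x in at_right 0. \<forall>\<gamma>\<in>{\<gamma> \<in> NP_roots g. real_series \<gamma>}. ?S x (branch_val \<gamma> x)"
    using S domg pui by (intro eventually_ball_finite[OF fin(2)]) auto
  ultimately have "\<forall>\<^sub>F x in at_right 0. (\<forall>\<gamma>\<in>{\<gamma> \<in> NP_roots H. real_series \<gamma>}. ?W x (branch_val \<gamma> x)) \<and>
      (\<forall>\<gamma>\<in>{\<gamma> \<in> NP_roots g. real_series \<gamma>}. ?S x (branch_val \<gamma> x))"
    by (rule eventually_conj)
  then obtain r where r: "r > 0" "\<And>x. 0 < x \<Longrightarrow> x < r \<Longrightarrow>
      (\<forall>\<gamma>\<in>{\<gamma> \<in> NP_roots H. real_series \<gamma>}. ?W x (branch_val \<gamma> x)) \<and>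
      (\<forall>\<gamma>\<in>{\<gamma> \<in> NP_roots g. real_series \<gamma>}. ?S x (branch_val \<gamma> x))"
    unfolding eventually_at_right_field by blast
  from real_zeros[OF H] obtain dH where dH: "dH > 0" "\<And>x y. 0 < x \<Longrightarrow> x < dH \<Longrightarrow> \<bar>y\<bar> < dH \<Longrightarrow>
    peval H x y = 0 \<Longrightarrow> \<exists>\<gamma>\<in>NP_roots H. real_series \<gamma> \<and> y = branch_val \<gamma> x" by blast
  from real_zeros[OF g] obtain dg where dg: "dg > 0" "\<And>x y. 0 < x \<Longrightarrow> x < dg \<Longrightarrow> \<bar>y\<bar> < dg \<Longrightarrow>
    peval g x y = 0 \<Longrightarrow> \<exists>\<gamma>\<in>NP_roots g. real_series \<gamma> \<and> y = branch_val \<gamma> x" by blast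
  show ?thesis
  proof (rule exI[of _ "min r (min dH dg)"], rule conjI, use r dH dg in simp, intro allI impI)
    fix x y assume x: "0 < x" "x < min r (min dH dg)" and y: "\<bar>y\<bar> < min r (min dH dg)"
    have "?W x y" if "peval H x y = 0"
      using dH(2)[of x y] r(2)[of x] x y that by auto
    moreover have "?S x y" if "peval g x y = 0"
    proof -
      obtain \<gamma> where "\<gamma> \<in> NP_roots g" "real_series \<gamma>" "y = branch_val \<gamma> x"
        using dg(2)[of x y] x y \<open>peval g x y = 0\<close> by auto
      then show ?thesis using conjunct2[OF r(2)[of x]] x by auto
    qed
    ultimately show "(peval H x y = 0 \<longrightarrow> ?W x y) \<and> (peval g x y = 0 \<longrightarrow> ?S x y)" by blast
  qed
qed

text \<open>Both multiplicities are 0, so the cofactors are the ramified polynomials themselves, and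
  both orders are subdegrees over the denominator of \<open>\<gamma>\<close>.\<close>

lemma dominated_nonroot_iff:
  assumes "puiseux \<gamma>" "f \<noteq> 0" "g \<noteq> 0" "\<gamma> \<notin> NP_roots f" "\<gamma> \<notin> NP_roots g"
  shows "dominated f g \<gamma> \<longleftrightarrow> ord_series (subst g \<gamma>) < ord_series (subst f \<gamma>)"
proof -
  have k: "NP_mult f \<gamma> = 0" "NP_mult g \<gamma> = 0"
    using NP_mult_pos_iff[OF assms(1)] assms by auto
  have "ramify_poly (denom \<gamma>) f = cofactor f \<gamma>" "ramify_poly (denom \<gamma>) g = cofactor g \<gamma>"
    using cofactor(1)[OF assms(1,2)] cofactor(1)[OF assms(1,3)] by (simp_all add: k)
  then show ?thesis
    using assms puiseuxD(2)[OF assms(1)]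
    by (simp add: dominated_def k ord_series_subst divide_less_cancel)
qed

text \<open>A root of g has positive multiplicity in g, so domination forces it to be a root of f.
  For equal multiplicities \<open>mult_sum_eq\<close> turns both sums into subdegrees over the same
  denominator.\<close>

lemma dominated_root_iff:
  assumes f: "regular m f" and g: "regular k g" and \<gamma>: "\<gamma> \<in> NP_roots g"
  shows "dominated f g \<gamma> \<longleftrightarrow> \<gamma> \<in> NP_roots f \<and>
    (NP_mult f \<gamma> > NP_mult g \<gamma> \<or> NP_mult f \<gamma> = NP_mult g \<gamma> \<and>
      (\<Sum>\<phi> \<in> NP_roots f - {\<gamma>}. ereal (real (NP_mult f \<phi>)) * ord_series (series_diff \<gamma> \<phi>)) >
      (\<Sum>\<psi> \<in> NP_roots g - {\<gamma>}. ereal (real (NP_mult g \<psi>)) * ord_series (series_diff \<gamma> \<psi>)))"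
proof -
  have p: "puiseux \<gamma>" using \<gamma> by (simp add: NP_roots_def)
  note d = puiseuxD[OF p] and f0 = regular_nonzero[OF f] and g0 = regular_nonzero[OF g]
  have "NP_mult g \<gamma> > 0" using NP_mult_pos_iff[OF p g0] \<gamma> by simp
  then have root: "\<gamma> \<in> NP_roots f" if "dominated f g \<gamma>"
    using that NP_mult_pos_iff[OF p f0] by (auto simp: dominated_def)
  note sumg = mult_sum_eq(2)[OF g \<gamma> d(1) cofactor(1,2)[OF p g0]]
  show ?thesis
  proof (cases "\<gamma> \<in> NP_roots f")
    case True
    note sumf = mult_sum_eq(2)[OF f True d(1) cofactor(1,2)[OF p f0]]
    show ?thesis unfolding sumf sumg using True d(2)
      by (auto simp: dominated_def divide_less_cancel)
  qed (use root in blast)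
qed

theorem theorem4p13:
  fixes f g :: "real poly poly"
  assumes "f \<noteq> 0" and "g \<noteq> 0"
    and "peval f 0 0 = 0" and "peval g 0 0 = 0"
    and "y_regular f" and "y_regular g" and "y_regular (G_poly f g)"
  shows "((\<lambda>(x, y). peval f x y / peval g x y) \<longlongrightarrow> 0)
           (at (0, 0) within {(x, y). peval g x y \<noteq> 0})
     \<longleftrightarrow>
       ord_poly f > ord_poly g
     \<and> (\<forall>s \<in> {1, -1}. \<forall>\<gamma> \<in> NP_real_roots s (G_poly f g) - (NP_real_roots s f \<union> NP_real_roots s g).
          ord_series (subst (xscale s f) \<gamma>) > ord_series (subst (xscale s g) \<gamma>))
     \<and> (\<forall>s \<in> {1, -1}. \<forall>\<gamma> \<in> NP_real_roots s g.
          \<gamma> \<in> NP_real_roots s f \<and>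
          (NP_mult (xscale s f) \<gamma> > NP_mult (xscale s g) \<gamma> \<or>
           NP_mult (xscale s f) \<gamma> = NP_mult (xscale s g) \<gamma> \<and>
           (\<Sum>\<phi> \<in> NP_roots (xscale s f) - {\<gamma>}.
              ereal (real (NP_mult (xscale s f) \<phi>)) * ord_series (series_diff \<gamma> \<phi>))
           > (\<Sum>\<psi> \<in> NP_roots (xscale s g) - {\<gamma>}.
              ereal (real (NP_mult (xscale s g) \<psi>)) * ord_series (series_diff \<gamma> \<psi>))))"
    (is "?L \<longleftrightarrow> ?i \<and> ?ii \<and> ?iii")
proof -
  define S :: "real set" where "S = {1, - 1}"
  have S: "s \<noteq> 0" "\<bar>s\<bar> = 1" "s * s = 1" if "s \<in> S" for s using that by (auto simp: S_def)
  note reg = y_regularD[OF assms(5)] y_regularD[OF assms(6)] y_regularD[OF assms(7)]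
  have regs: "regular (ord_poly f) (xscale s f)" "regular (ord_poly g) (xscale s g)"
    "regular (ord_poly (G_poly f g)) (xscale s (G_poly f g))" if "s \<in> S" for s
    using reg S(1)[OF that] by (simp_all add: regular_xscale)
  have nz: "xscale s f \<noteq> 0" "xscale s g \<noteq> 0" if "s \<in> S" for s
    using regs that by (blast dest: regular_nonzero)+
  have pui: "puiseux \<gamma>" if "\<gamma> \<in> NP_roots h" for \<gamma> h using that by (simp add: NP_roots_def)
  have ii: "?ii \<longleftrightarrow> (\<forall>s\<in>S. \<forall>\<gamma>\<in>NP_roots (xscale s (G_poly f g)). real_series \<gamma> \<longrightarrow>
      \<gamma> \<notin> NP_roots (xscale s f) \<longrightarrow> \<gamma> \<notin> NP_roots (xscale s g) \<longrightarrow> dominated (xscale s f) (xscale s g) \<gamma>)"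
    unfolding S_def[symmetric]
  proof (rule ball_cong[OF refl])
    fix s assume s: "s \<in> S"
    have "(\<forall>\<gamma>\<in>NP_real_roots s (G_poly f g) - (NP_real_roots s f \<union> NP_real_roots s g). P \<gamma>) \<longleftrightarrow>
      (\<forall>\<gamma>\<in>NP_roots (xscale s (G_poly f g)). real_series \<gamma> \<longrightarrow>
        \<gamma> \<notin> NP_roots (xscale s f) \<longrightarrow> \<gamma> \<notin> NP_roots (xscale s g) \<longrightarrow> P \<gamma>)" for P
      unfolding NP_real_roots_def by blast
    then show "(\<forall>\<gamma>\<in>NP_real_roots s (G_poly f g) - (NP_real_roots s f \<union> NP_real_roots s g).
        ord_series (subst (xscale s g) \<gamma>) < ord_series (subst (xscale s f) \<gamma>)) \<longleftrightarrow>
      (\<forall>\<gamma>\<in>NP_roots (xscale s (G_poly f g)). real_series \<gamma> \<longrightarrow> \<gamma> \<notin> NP_roots (xscale s f) \<longrightarrow>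
        \<gamma> \<notin> NP_roots (xscale s g) \<longrightarrow> dominated (xscale s f) (xscale s g) \<gamma>)"
      using dominated_nonroot_iff[OF pui nz[OF s]] by simp
  qed
  have iii: "?iii \<longleftrightarrow> (\<forall>s\<in>S. \<forall>\<gamma>\<in>NP_roots (xscale s g). real_series \<gamma> \<longrightarrow>
      dominated (xscale s f) (xscale s g) \<gamma>)"
    unfolding S_def[symmetric]
  proof (rule ball_cong[OF refl])
    fix s assume s: "s \<in> S"
    have "(\<forall>\<gamma>\<in>NP_real_roots s g. \<gamma> \<in> NP_real_roots s f \<and> P \<gamma>) \<longleftrightarrow>
      (\<forall>\<gamma>\<in>NP_roots (xscale s g). real_series \<gamma> \<longrightarrow> \<gamma> \<in> NP_roots (xscale s f) \<and> P \<gamma>)" for P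
      unfolding NP_real_roots_def by blast
    then show "(\<forall>\<gamma>\<in>NP_real_roots s g. \<gamma> \<in> NP_real_roots s f \<and>
          (NP_mult (xscale s f) \<gamma> > NP_mult (xscale s g) \<gamma> \<or>
           NP_mult (xscale s f) \<gamma> = NP_mult (xscale s g) \<gamma> \<and>
           (\<Sum>\<phi> \<in> NP_roots (xscale s f) - {\<gamma>}.
              ereal (real (NP_mult (xscale s f) \<phi>)) * ord_series (series_diff \<gamma> \<phi>))
           > (\<Sum>\<psi> \<in> NP_roots (xscale s g) - {\<gamma>}.
              ereal (real (NP_mult (xscale s g) \<psi>)) * ord_series (series_diff \<gamma> \<psi>)))) \<longleftrightarrow>
      (\<forall>\<gamma>\<in>NP_roots (xscale s g). real_series \<gamma> \<longrightarrow> dominated (xscale s f) (xscale s g) \<gamma>)"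
      using dominated_root_iff[OF regs(1)[OF s] regs(2)[OF s]] by simp
  qed
  show ?thesis unfolding ii iii limit_iff[OF assms(4)]
  proof (intro iffI conjI; (elim conjE)?)
    assume small: "\<forall>\<epsilon>>0. \<exists>\<delta>>0. \<forall>x y. \<bar>x\<bar> < \<delta> \<longrightarrow> \<bar>y\<bar> < \<delta> \<longrightarrow> peval g x y \<noteq> 0 \<longrightarrow>
      \<bar>peval f x y\<bar> \<le> \<epsilon> * \<bar>peval g x y\<bar>"
    then show ?i by (intro ord_less_if_small[OF reg(1,2)]) blast
    \<comment> \<open>The square neighbourhood is invariant under x -> - x, so the bound passes to
      the reflected pair.\<close>
    have "\<exists>\<delta>>0. \<forall>x y. \<bar>x\<bar> < \<delta> \<longrightarrow> \<bar>y\<bar> < \<delta> \<longrightarrow> peval (xscale s g) x y \<noteq> 0 \<longrightarrow>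
      \<bar>peval (xscale s f) x y\<bar> \<le> \<epsilon> * \<bar>peval (xscale s g) x y\<bar>" if "s \<in> S" "\<epsilon> > 0" for s \<epsilon>
    proof -
      from small that obtain \<delta> where "\<delta> > 0" "\<And>x y. \<bar>x\<bar> < \<delta> \<Longrightarrow> \<bar>y\<bar> < \<delta> \<Longrightarrow> peval g x y \<noteq> 0 \<Longrightarrow>
        \<bar>peval f x y\<bar> \<le> \<epsilon> * \<bar>peval g x y\<bar>" by blast
      with S(2)[OF that(1)] show ?thesis
        by (intro exI[of _ \<delta>]) (simp add: peval_xscale abs_mult)
    qed
    then have dom: "dominated (xscale s f) (xscale s g) \<gamma>" if "s \<in> S" "puiseux \<gamma>" "real_series \<gamma>" for s \<gamma>
      using that nz by (intro dominated_if_small) auto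
    show "\<forall>s\<in>S. \<forall>\<gamma>\<in>NP_roots (xscale s (G_poly f g)). real_series \<gamma> \<longrightarrow>
      \<gamma> \<notin> NP_roots (xscale s f) \<longrightarrow> \<gamma> \<notin> NP_roots (xscale s g) \<longrightarrow> dominated (xscale s f) (xscale s g) \<gamma>"
      "\<forall>s\<in>S. \<forall>\<gamma>\<in>NP_roots (xscale s g). real_series \<gamma> \<longrightarrow> dominated (xscale s f) (xscale s g) \<gamma>"
      using dom pui by blast+
  next
    assume domG: "\<forall>s\<in>S. \<forall>\<gamma>\<in>NP_roots (xscale s (G_poly f g)). real_series \<gamma> \<longrightarrow>
      \<gamma> \<notin> NP_roots (xscale s f) \<longrightarrow> \<gamma> \<notin> NP_roots (xscale s g) \<longrightarrow> dominated (xscale s f) (xscale s g) \<gamma>"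
      and domg: "\<forall>s\<in>S. \<forall>\<gamma>\<in>NP_roots (xscale s g). real_series \<gamma> \<longrightarrow> dominated (xscale s f) (xscale s g) \<gamma>"
    show "\<forall>\<epsilon>>0. \<exists>\<delta>>0. \<forall>x y. \<bar>x\<bar> < \<delta> \<longrightarrow> \<bar>y\<bar> < \<delta> \<longrightarrow> peval g x y \<noteq> 0 \<longrightarrow>
      \<bar>peval f x y\<bar> \<le> \<epsilon> * \<bar>peval g x y\<bar>"
    proof (intro allI impI)
      fix \<epsilon> :: real assume e: "\<epsilon> > 0"
      let ?B = "\<lambda>f g x y. \<bar>peval f x y\<bar> < \<epsilon> * \<bar>peval g x y\<bar>"
      define P where "P s \<delta> \<longleftrightarrow> (\<forall>x y. 0 < x \<longrightarrow> x < \<delta> \<longrightarrow> \<bar>y\<bar> < \<delta> \<longrightarrow>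
          (peval (xscale s (G_poly f g)) x y = 0 \<longrightarrow> peval (xscale s g) x y \<noteq> 0 \<longrightarrow> ?B (xscale s f) (xscale s g) x y) \<and>
          (peval (xscale s g) x y = 0 \<longrightarrow> (\<forall>\<^sub>F z in nhds (x, y). peval (xscale s g) (fst z) (snd z) \<noteq> 0 \<longrightarrow>
            ?B (xscale s f) (xscale s g) (fst z) (snd z))))" for s \<delta>
      have "\<exists>\<delta>>0. P s \<delta>" if "s \<in> S" for s
        unfolding P_def
        by (rule local_bound[OF nz(1)[OF that] regs(2)[OF that] regs(3)[OF that] e])
          (simp_all add: domG[rule_format] domg[rule_format] that)
      then obtain d where d: "\<And>s. s \<in> S \<Longrightarrow> d s > 0" "\<And>s. s \<in> S \<Longrightarrow> P s (d s)" by metis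
      have dP1: "?B (xscale s f) (xscale s g) x y"
        if "s \<in> S" "0 < x" "x < d s" "\<bar>y\<bar> < d s" "peval (xscale s (G_poly f g)) x y = 0"
          "peval (xscale s g) x y \<noteq> 0" for s x y
        using d(2)[OF that(1)] that(2-) unfolding P_def by blast
      have dP2: "\<forall>\<^sub>F z in nhds (x, y). peval (xscale s g) (fst z) (snd z) \<noteq> 0 \<longrightarrow>
            ?B (xscale s f) (xscale s g) (fst z) (snd z)"
        if "s \<in> S" "0 < x" "x < d s" "\<bar>y\<bar> < d s" "peval (xscale s g) x y = 0" for s x y
        using d(2)[OF that(1)] that(2-) unfolding P_def by blast
      from axis_nonzero[OF reg(3)] obtain dG where
        dG: "dG > 0" "\<And>y. y \<noteq> 0 \<Longrightarrow> \<bar>y\<bar> < dG \<Longrightarrow> peval (G_poly f g) 0 y \<noteq> 0" by blast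
      from axis_nonzero[OF reg(2)] obtain dg where
        dg: "dg > 0" "\<And>y. y \<noteq> 0 \<Longrightarrow> \<bar>y\<bar> < dg \<Longrightarrow> peval g 0 y \<noteq> 0" by blast
      \<comment> \<open>Small enough for both half-planes and for the axis between them.\<close>
      define \<delta> where "\<delta> = min (min (d 1) (d (- 1))) (min dG dg)"
      have \<delta>: "\<delta> > 0" using d(1) dG dg by (simp add: \<delta>_def S_def)
      have \<delta>s: "\<delta> \<le> d s" if "s \<in> S" for s using that by (auto simp: \<delta>_def S_def)
      have bounds: "\<bar>fst z\<bar> < \<delta>" "\<bar>snd z\<bar> < \<delta>" if "norm z < \<delta>" for z :: "real \<times> real"
        using that norm_fst_le[of "fst z" "snd z"] norm_snd_le[of "snd z" "fst z"] by auto
      have side: "sgn (fst z) \<in> S \<and> 0 < sgn (fst z) * fst z \<and> sgn (fst z) * fst z < d (sgn (fst z)) \<and>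
          \<bar>snd z\<bar> < d (sgn (fst z))" if "norm z < \<delta>" "fst z \<noteq> 0" for z :: "real \<times> real"
      proof -
        have s: "sgn (fst z) \<in> S" using that by (auto simp: S_def sgn_if)
        have "sgn (fst z) * fst z = \<bar>fst z\<bar>" by (simp add: abs_sgn mult.commute)
        then show ?thesis using s \<delta>s[OF s] bounds[OF that(1)] that by auto
      qed
      have axis: "peval (G_poly f g) (fst z) (snd z) \<noteq> 0 \<and> peval g (fst z) (snd z) \<noteq> 0"
        if "0 < norm z" "norm z < \<delta>" "fst z = 0" for z :: "real \<times> real"
      proof -
        have "snd z \<noteq> 0" using that by (cases z) (auto simp: zero_prod_def)
        then show ?thesis using dG(2) dg(2) bounds(2)[OF that(2)] that(3) by (auto simp: \<delta>_def)
      qed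
      \<comment> \<open>With s = sgn x, the reflection moves any point off the axis to x > 0, and s
        * s = 1 restores the value.\<close>
      have flip: "peval (xscale s h) (s * x) y = peval h x y" if "s \<in> S" for s h x y
        using S(3)[OF that] by (simp add: peval_xscale mult.assoc[symmetric])
      have main: "?B f g (fst z) (snd z)" if "0 < norm z" "norm z < \<delta>" "peval g (fst z) (snd z) \<noteq> 0" for z
        using e _ _ that
      proof (rule circle_max)
        fix z :: "real \<times> real" assume z: "0 < norm z" "norm z < \<delta>"
          and G0: "peval (G_poly f g) (fst z) (snd z) = 0" and g0: "peval g (fst z) (snd z) \<noteq> 0"
        have "fst z \<noteq> 0" using axis[OF z] G0 by blast
        note sd = side[OF z(2) this]
        then show "?B f g (fst z) (snd z)"
          using dP1[of "sgn (fst z)" "sgn (fst z) * fst z" "snd z"] G0 g0 by (simp add: flip)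
      next
        fix z :: "real \<times> real" assume z: "0 < norm z" "norm z < \<delta>" and g0: "peval g (fst z) (snd z) = 0"
        let ?s = "sgn (fst z)"
        have "fst z \<noteq> 0" using axis[OF z] g0 by blast
        note sd = side[OF z(2) this]
        then have "\<forall>\<^sub>F w in nhds (?s * fst z, snd z). peval (xscale ?s g) (fst w) (snd w) \<noteq> 0 \<longrightarrow>
            ?B (xscale ?s f) (xscale ?s g) (fst w) (snd w)"
          using g0 by (intro dP2) (simp_all add: flip)
        \<comment> \<open>The neighbourhood obtained at the reflected point is pulled back along the
          continuous reflection.\<close>
        moreover have "filterlim (\<lambda>w. (?s * fst w, snd w)) (nhds (?s * fst z, snd z)) (nhds z)"
          by (intro tendsto_intros filterlim_ident)
        ultimately have "\<forall>\<^sub>F w in nhds z. peval (xscale ?s g) (?s * fst w) (snd w) \<noteq> 0 \<longrightarrow>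
            ?B (xscale ?s f) (xscale ?s g) (?s * fst w) (snd w)"
          by (auto simp: filterlim_iff)
        then show "\<forall>\<^sub>F w in nhds z. peval g (fst w) (snd w) \<noteq> 0 \<longrightarrow> ?B f g (fst w) (snd w)"
          using sd by (simp add: flip)
      qed
      show "\<exists>\<delta>>0. \<forall>x y. \<bar>x\<bar> < \<delta> \<longrightarrow> \<bar>y\<bar> < \<delta> \<longrightarrow> peval g x y \<noteq> 0 \<longrightarrow>
        \<bar>peval f x y\<bar> \<le> \<epsilon> * \<bar>peval g x y\<bar>"
      proof (intro exI[of _ "\<delta> / 2"] conjI allI impI)
        fix x y assume xy: "\<bar>x\<bar> < \<delta> / 2" "\<bar>y\<bar> < \<delta> / 2" and g0: "peval g x y \<noteq> 0"
        have "norm (x, y) \<le> \<bar>x\<bar> + \<bar>y\<bar>"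
          using sqrt_sum_squares_le_sum_abs[of x y] by (simp add: norm_prod_def)
        moreover have "(x, y) \<noteq> 0" using g0 assms(4) by (auto simp: zero_prod_def)
        ultimately show "\<bar>peval f x y\<bar> \<le> \<epsilon> * \<bar>peval g x y\<bar>"
          using main[of "(x, y)"] xy g0 by auto
      qed (use \<delta> in simp)
    qed
  qed
qed

end
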